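(* (a) For the Witt algebra $\mathcal{W}$ one has $\mathrm{H}^2(\mathcal{W},\mathcal{W})=0$; hence the Witt algebra is formally rigid. (b) For the Virasoro algebra $\mathcal{V}$ one has $\mathrm{H}^2(\mathcal{V},\mathcal{V})=0$; hence the Virasoro algebra is formally rigid.
   Context: The Witt algebra $\mathcal{W}$ is the complex Lie algebra with basis $\{l_n\mid n\in\mathbb{Z}\}$ (elements are finite linear combinations) and bracket $[l_n,l_m]=(m-n)l_{n+m}$. The Virasoro algebra $\mathcal{V}$ is the complex Lie algebra with basis $\{l_n\mid n\in\mathbb{Z}\}\cup\{c\}$ and bracket $[l_n,l_m]=(m-n)l_{n+m}+\frac{1}{12}(m^3-m)\delta_{n,-m}\,c$, $[l_n,c]=0$. For a Lie algebra $\mathcal{L}$ over a field $\mathbb{K}$ of characteristic zero, $\mathrm{H}^2(\mathcal{L},\mathcal{L})$ denotes the second Lie algebra (Chevalley–Eilenberg) cohomology with values in the adjoint module; $2$-cochains are the elements of $\mathrm{Hom}_{\mathbb{K}}(\bigwedge^2\mathcal{L},\mathcal{L})$. Let $A$ be a commutative complete local $\mathbb{K}$-algebra with unit, $A=\varprojlim_n A/m^n$, where $m$ is its maximal ideal, $A/m\cong\mathbb{K}$, $\dim(m^k/m^{k+1})<\infty$ for all $k$, and let $\epsilon:A\to A/m\cong\mathbb{K}$ be the augmentation. A formal deformation of $\mathcal{L}$ with base $A$ is a Lie $A$-algebra structure on the completed tensor product $A\widehat{\otimes}\mathcal{L}=\varprojlim_n\big((A/m^n)\otimes\mathcal{L}\big)$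 such that $\epsilon\widehat{\otimes}\mathrm{id}:A\widehat{\otimes}\mathcal{L}\to\mathbb{K}\otimes\mathcal{L}=\mathcal{L}$ is a Lie algebra homomorphism. Two formal deformations with the same base $A$ are equivalent if there is a Lie $A$-algebra isomorphism between the two Lie structures on $A\widehat{\otimes}\mathcal{L}$ compatible with $\epsilon\widehat{\otimes}\mathrm{id}$. The trivial deformation is the one with $[1\otimes x,1\otimes y]=1\otimes[x,y]$ for all $x,y\in\mathcal{L}$. $\mathcal{L}$ is formally rigid if every formal deformation of $\mathcal{L}$ (over every such base) is equivalent to the trivial one. *)

theory Defs
  imports Complex_Main "HOL-Library.Poly_Mapping" "HOL-Library.Set_Algebras"
    "HOL-Library.FuncSet"
begin

section \<open>Lie algebras and their second adjoint cohomology\<close>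

locale lie_algebra = vector_space scale
  for scale :: "'k::field_char_0 \<Rightarrow> 'l::ab_group_add \<Rightarrow> 'l" +
  fixes bracket :: "'l \<Rightarrow> 'l \<Rightarrow> 'l"
  assumes linear_right: "Vector_Spaces.linear scale scale (\<lambda>y. bracket x y)"
    and linear_left: "Vector_Spaces.linear scale scale (\<lambda>x. bracket x y)"
    and alternating: "bracket x x = 0"
    and jacobi: "bracket x (bracket y z) + bracket y (bracket z x) + bracket z (bracket x y) = 0"
begin

definition C1 :: "('l \<Rightarrow> 'l) set"
  where "C1 = {\<phi>. Vector_Spaces.linear scale scale \<phi>}"

text \<open>Linear maps on the exterior square, given as alternating bilinear maps.\<close>

definition C2 :: "('l \<Rightarrow> 'l \<Rightarrow> 'l) set"
  where "C2 = {\<psi>. (\<forall>x. Vector_Spaces.linear scale scale (\<lambda>y. \<psi> x y)) \<and>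
                   (\<forall>y. Vector_Spaces.linear scale scale (\<lambda>x. \<psi> x y)) \<and>
                   (\<forall>x. \<psi> x x = 0)}"

text \<open>The Chevalley--Eilenberg differentials for the adjoint module.\<close>

definition d1 :: "('l \<Rightarrow> 'l) \<Rightarrow> 'l \<Rightarrow> 'l \<Rightarrow> 'l"
  where "d1 \<phi> = (\<lambda>x y. bracket x (\<phi> y) - bracket y (\<phi> x) - \<phi> (bracket x y))"

definition d2 :: "('l \<Rightarrow> 'l \<Rightarrow> 'l) \<Rightarrow> 'l \<Rightarrow> 'l \<Rightarrow> 'l \<Rightarrow> 'l"
  where "d2 \<psi> = (\<lambda>x y z. bracket x (\<psi> y z) - bracket y (\<psi> x z) + bracket z (\<psi> x y)
                         - \<psi> (bracket x y) z + \<psi> (bracket x z) y - \<psi> (bracket y z) x)"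

definition Z2 :: "('l \<Rightarrow> 'l \<Rightarrow> 'l) set"
  where "Z2 = {\<psi> \<in> C2. \<forall>x y z. d2 \<psi> x y z = 0}"

definition B2 :: "('l \<Rightarrow> 'l \<Rightarrow> 'l) set"
  where "B2 = d1 ` C1"

definition H2 :: "('l \<Rightarrow> 'l \<Rightarrow> 'l) set set"
  where "H2 = Z2 // {(\<psi>, \<psi>') \<in> Z2 \<times> Z2. (\<lambda>x y. \<psi> x y - \<psi>' x y) \<in> B2}"

text \<open>The zero element of the quotient space \<open>Z2/B2\<close> is the coset \<open>B2\<close>.\<close>

definition H2_vanishes :: bool
  where "H2_vanishes \<longleftrightarrow> H2 = {B2}"

end


section \<open>Complete local algebras\<close>

abbreviation is_ideal :: "'a::comm_ring_1 set \<Rightarrow> bool"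
  where "is_ideal I \<equiv> module.subspace (*) I"

definition is_maximal_ideal :: "'a::comm_ring_1 set \<Rightarrow> bool"
  where "is_maximal_ideal I \<longleftrightarrow>
    is_ideal I \<and> I \<noteq> UNIV \<and> (\<forall>J. is_ideal J \<longrightarrow> I \<subseteq> J \<longrightarrow> J = I \<or> J = UNIV)"

primrec ideal_power :: "'a::comm_ring_1 set \<Rightarrow> nat \<Rightarrow> 'a set"
  where
    "ideal_power I 0 = UNIV"
  | "ideal_power I (Suc n) = module.span (*) {a * b | a b. a \<in> I \<and> b \<in> ideal_power I n}"

text \<open>
  For a descending sequence \<open>N\<close> of subgroups of an abelian group \<open>G\<close>, the inverse limit of the
  groups \<open>G/N n\<close>; the transition map sends a coset of \<open>N (Suc n)\<close> to the coset of \<open>N n\<close>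
  containing it.
\<close>

definition inverse_limit :: "(nat \<Rightarrow> 'g::ab_group_add set) \<Rightarrow> (nat \<Rightarrow> 'g set) set"
  where "inverse_limit N = {t. \<forall>n. (\<exists>x. t n = x +o N n) \<and> t (Suc n) \<subseteq> t n}"

text \<open>
  The augmentation \<open>eps\<close> is the algebra homomorphism with kernel \<open>m\<close>; its existence is the
  condition that \<open>A/m\<close> is isomorphic to the ground field.
\<close>

locale complete_local_algebra = vector_space scale
  for scale :: "'k::field_char_0 \<Rightarrow> 'a::comm_ring_1 \<Rightarrow> 'a" +
  fixes m :: "'a set" and eps :: "'a \<Rightarrow> 'k"
  assumes scale_mult: "scale c (a * b) = scale c a * b"
    and local: "is_maximal_ideal I \<longleftrightarrow> I = m"
    and eps_linear: "Vector_Spaces.linear scale (*) eps"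
    and eps_one: "eps 1 = 1"
    and eps_mult: "eps (a * b) = eps a * eps b"
    and eps_kernel: "eps a = 0 \<longleftrightarrow> a \<in> m"
    and complete: "bij_betw (\<lambda>a n. a +o ideal_power m n) UNIV (inverse_limit (ideal_power m))"
    and finite_dim: "\<exists>B. finite B \<and> B \<subseteq> ideal_power m k \<and>
                         ideal_power m k \<subseteq> span (B \<union> ideal_power m (Suc k))"


section \<open>Completed tensor product and formal deformations\<close>

inductive_set subgroup_generated_by :: "'g::ab_group_add set \<Rightarrow> 'g set" for S
  where
    zero: "0 \<in> subgroup_generated_by S"
  | incl: "x \<in> S \<Longrightarrow> x \<in> subgroup_generated_by S"
  | diff: "x \<in> subgroup_generated_by S \<Longrightarrow> y \<in> subgroup_generated_by S
           \<Longrightarrow> x - y \<in> subgroup_generated_by S"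

type_synonym ('a, 'l) cosets = "nat \<Rightarrow> ('a \<times> 'l \<Rightarrow>\<^sub>0 int) set"

locale deformation_base =
  A: complete_local_algebra scaleA m eps + lie_algebra scale bracket
  for scaleA :: "'k::field_char_0 \<Rightarrow> 'a::comm_ring_1 \<Rightarrow> 'a" and m eps
    and scale :: "'k \<Rightarrow> 'l::ab_group_add \<Rightarrow> 'l" and bracket
begin

text \<open>
  The tensor product of \<open>A/m^n\<close> and \<open>L\<close> over the ground field is the free abelian group on symbols
  \<open>(a, x)\<close> modulo the subgroup \<open>tensor_rel n\<close>; here \<open>a\<close> in \<open>A\<close> stands for its class modulo \<open>m^n\<close>,
  which is enforced by the last family of relations.
\<close>

definition tensor_rel :: "('a, 'l) cosets"
  where "tensor_rel n = subgroup_generated_by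
    ({frag_of (a + b, x) - frag_of (a, x) - frag_of (b, x) | a b x. True} \<union>
     {frag_of (a, x + y) - frag_of (a, x) - frag_of (a, y) | a x y. True} \<union>
     {frag_of (scaleA c a, x) - frag_of (a, scale c x) | c a x. True} \<union>
     {frag_of (a, x) - frag_of (b, x) | a b x. a - b \<in> ideal_power m n})"

definition ctensor :: "('a, 'l) cosets set"
  where "ctensor = inverse_limit tensor_rel"

definition ct_zero :: "('a, 'l) cosets"
  where "ct_zero = tensor_rel"

definition ct_add ::
  "('a, 'l) cosets \<Rightarrow> ('a, 'l) cosets \<Rightarrow> ('a, 'l) cosets"
  where "ct_add s t = (\<lambda>n. s n + t n)"

text \<open>
  Multiplication by \<open>a\<close> is induced by \<open>(b, x) \<mapsto> (a b, x)\<close>.  The image of a coset is only part of a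
  coset, hence the summand \<open>tensor_rel n\<close>.
\<close>

definition ct_smult ::
  "'a \<Rightarrow> ('a, 'l) cosets \<Rightarrow> ('a, 'l) cosets"
  where "ct_smult a t =
    (\<lambda>n. frag_extend (\<lambda>(b, x). frag_of (a * b, x)) ` t n + tensor_rel n)"

definition ct_pure :: "'a \<Rightarrow> 'l \<Rightarrow> ('a, 'l) cosets"
  where "ct_pure a x = (\<lambda>n. frag_of (a, x) +o tensor_rel n)"

text \<open>
  The map \<open>eps \<otimes> id\<close> into the Lie algebra: project to the component \<open>A/m \<otimes> L\<close> and send the class of
  \<open>(a, x)\<close> to \<open>eps a \<cdot> x\<close>; all representatives of a class have the same value.
\<close>

definition ct_eps :: "('a, 'l) cosets \<Rightarrow> 'l"
  where "ct_eps t = the_elem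
    ((\<lambda>f. \<Sum>(a, x)\<in>Poly_Mapping.keys f.
        scale (of_int (Poly_Mapping.lookup f (a, x)) * eps a) x) ` t 1)"

definition A_linear ::
  "(('a, 'l) cosets \<Rightarrow> ('a, 'l) cosets) \<Rightarrow> bool"
  where "A_linear F \<longleftrightarrow>
    F \<in> ctensor \<rightarrow> ctensor \<and>
    (\<forall>s\<in>ctensor. \<forall>t\<in>ctensor. F (ct_add s t) = ct_add (F s) (F t)) \<and>
    (\<forall>a. \<forall>t\<in>ctensor. F (ct_smult a t) = ct_smult a (F t))"

definition A_lie_bracket ::
  "(('a, 'l) cosets \<Rightarrow> ('a, 'l) cosets \<Rightarrow> ('a, 'l) cosets) \<Rightarrow> bool"
  where "A_lie_bracket D \<longleftrightarrow>
    (\<forall>s\<in>ctensor. A_linear (\<lambda>t. D s t)) \<and>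
    (\<forall>t\<in>ctensor. A_linear (\<lambda>s. D s t)) \<and>
    (\<forall>t\<in>ctensor. D t t = ct_zero) \<and>
    (\<forall>s\<in>ctensor. \<forall>t\<in>ctensor. \<forall>u\<in>ctensor.
       ct_add (D s (D t u)) (ct_add (D t (D u s)) (D u (D s t))) = ct_zero)"

definition formal_deformation ::
  "(('a, 'l) cosets \<Rightarrow> ('a, 'l) cosets \<Rightarrow> ('a, 'l) cosets) \<Rightarrow> bool"
  where "formal_deformation D \<longleftrightarrow>
    A_lie_bracket D \<and>
    (\<forall>s\<in>ctensor. \<forall>t\<in>ctensor. ct_eps (D s t) = bracket (ct_eps s) (ct_eps t))"

definition trivial_deformation ::
  "(('a, 'l) cosets \<Rightarrow> ('a, 'l) cosets \<Rightarrow> ('a, 'l) cosets) \<Rightarrow> bool"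
  where "trivial_deformation D \<longleftrightarrow>
    formal_deformation D \<and> (\<forall>x y. D (ct_pure 1 x) (ct_pure 1 y) = ct_pure 1 (bracket x y))"

definition equivalent_deformations ::
  "(('a, 'l) cosets \<Rightarrow> ('a, 'l) cosets \<Rightarrow> ('a, 'l) cosets) \<Rightarrow>
   (('a, 'l) cosets \<Rightarrow> ('a, 'l) cosets \<Rightarrow> ('a, 'l) cosets) \<Rightarrow> bool"
  where "equivalent_deformations D D' \<longleftrightarrow>
    (\<exists>\<Phi>. A_linear \<Phi> \<and> bij_betw \<Phi> ctensor ctensor \<and>
         (\<forall>s\<in>ctensor. \<forall>t\<in>ctensor. \<Phi> (D s t) = D' (\<Phi> s) (\<Phi> t)) \<and>
         (\<forall>t\<in>ctensor. ct_eps (\<Phi> t) = ct_eps t))"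

end

text \<open>
  A definition cannot quantify over types, so the type \<open>'a\<close> of the base is a parameter; a theorem
  that leaves \<open>'a\<close> free covers all bases.
\<close>

definition (in lie_algebra) formally_rigid :: "'a::comm_ring_1 itself \<Rightarrow> bool"
  where "formally_rigid _ \<longleftrightarrow>
    (\<forall>(scaleA :: 'k \<Rightarrow> 'a \<Rightarrow> 'a) m eps. complete_local_algebra scaleA m eps \<longrightarrow>
      (\<forall>D. deformation_base.formal_deformation scaleA m eps scale bracket D \<longrightarrow>
        (\<exists>D\<^sub>0. deformation_base.trivial_deformation scaleA m eps scale bracket D\<^sub>0 \<and>
              deformation_base.equivalent_deformations scaleA m eps scale D D\<^sub>0)))"


section \<open>The Witt and Virasoro algebras\<close>

definition pm_scale :: "'k::field \<Rightarrow> ('i \<Rightarrow>\<^sub>0 'k) \<Rightarrow> ('i \<Rightarrow>\<^sub>0 'k)"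
  where "pm_scale c f = Poly_Mapping.map (\<lambda>x. c * x) f"

definition bilinear_extension ::
  "('i \<Rightarrow> 'i \<Rightarrow> ('i \<Rightarrow>\<^sub>0 'k::field)) \<Rightarrow> ('i \<Rightarrow>\<^sub>0 'k) \<Rightarrow> ('i \<Rightarrow>\<^sub>0 'k) \<Rightarrow> ('i \<Rightarrow>\<^sub>0 'k)"
  where "bilinear_extension b f g =
    (\<Sum>i\<in>Poly_Mapping.keys f. \<Sum>j\<in>Poly_Mapping.keys g.
       pm_scale (Poly_Mapping.lookup f i * Poly_Mapping.lookup g j) (b i j))"

text \<open>\<open>Poly_Mapping.single n 1\<close> is the basis vector \<open>l\<^sub>n\<close>.\<close>

definition witt_basis_bracket :: "int \<Rightarrow> int \<Rightarrow> (int \<Rightarrow>\<^sub>0 complex)"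
  where "witt_basis_bracket n m = Poly_Mapping.single (n + m) (of_int (m - n))"

definition witt_bracket :: "(int \<Rightarrow>\<^sub>0 complex) \<Rightarrow> (int \<Rightarrow>\<^sub>0 complex) \<Rightarrow> (int \<Rightarrow>\<^sub>0 complex)"
  where "witt_bracket = bilinear_extension witt_basis_bracket"

datatype virasoro_index = L int | Central

fun virasoro_basis_bracket ::
  "virasoro_index \<Rightarrow> virasoro_index \<Rightarrow> (virasoro_index \<Rightarrow>\<^sub>0 complex)"
  where
    "virasoro_basis_bracket (L n) (L m) =
       Poly_Mapping.single (L (n + m)) (of_int (m - n)) +
       (if n = - m then Poly_Mapping.single Central (of_int (m ^ 3 - m) / 12) else 0)"
  | "virasoro_basis_bracket (L n) Central = 0"
  | "virasoro_basis_bracket Central (L n) = 0"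
  | "virasoro_basis_bracket Central Central = 0"

definition virasoro_bracket ::
  "(virasoro_index \<Rightarrow>\<^sub>0 complex) \<Rightarrow> (virasoro_index \<Rightarrow>\<^sub>0 complex) \<Rightarrow> (virasoro_index \<Rightarrow>\<^sub>0 complex)"
  where "virasoro_bracket = bilinear_extension virasoro_basis_bracket"

lemma lookup_pm_scale: "Poly_Mapping.lookup (pm_scale c f) i = c * Poly_Mapping.lookup f i"
  by (simp add: pm_scale_def Poly_Mapping.map.rep_eq when_def)

lemma vector_space_pm_scale: "vector_space (pm_scale :: 'k::field \<Rightarrow> ('i \<Rightarrow>\<^sub>0 'k) \<Rightarrow> _)"
  by unfold_locales
    (auto intro!: poly_mapping_eqI simp: lookup_pm_scale lookup_add algebra_simps)

lemma bilinear_extension_superset: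
  assumes "finite I" "finite J" "Poly_Mapping.keys f \<subseteq> I" "Poly_Mapping.keys g \<subseteq> J"
  shows "bilinear_extension b f g = (\<Sum>i\<in>I. \<Sum>j\<in>J.
           pm_scale (Poly_Mapping.lookup f i * Poly_Mapping.lookup g j) (b i j))"
proof -
  interpret vector_space "pm_scale :: 'b \<Rightarrow> ('a \<Rightarrow>\<^sub>0 'b) \<Rightarrow> _" by (rule vector_space_pm_scale)
  have "(\<Sum>j\<in>Poly_Mapping.keys g.
           pm_scale (Poly_Mapping.lookup f i * Poly_Mapping.lookup g j) (b i j)) =
        (\<Sum>j\<in>J. pm_scale (Poly_Mapping.lookup f i * Poly_Mapping.lookup g j) (b i j))" for i
    using assms by (intro sum.mono_neutral_left) (auto simp: in_keys_iff)
  then show ?thesis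
    unfolding bilinear_extension_def using assms
    by (simp only:) (rule sum.mono_neutral_left; auto simp: in_keys_iff)
qed

lemma bilinear_extension_add_left:
  "bilinear_extension b (f + f') g = bilinear_extension b f g + bilinear_extension b f' g"
proof -
  interpret vector_space "pm_scale :: 'b \<Rightarrow> ('a \<Rightarrow>\<^sub>0 'b) \<Rightarrow> _" by (rule vector_space_pm_scale)
  let ?I = "Poly_Mapping.keys f \<union> Poly_Mapping.keys f'"
  let ?J = "Poly_Mapping.keys g"
  have "Poly_Mapping.keys (f + f') \<subseteq> ?I" by (rule Poly_Mapping.keys_add)
  then show ?thesis
    by (subst (1 2 3) bilinear_extension_superset[of ?I ?J])
      (auto simp: lookup_add distrib_right scale_left_distrib sum.distrib)
qed

lemma bilinear_extension_add_right:
  "bilinear_extension b f (g + g') = bilinear_extension b f g + bilinear_extension b f g'"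
proof -
  interpret vector_space "pm_scale :: 'b \<Rightarrow> ('a \<Rightarrow>\<^sub>0 'b) \<Rightarrow> _" by (rule vector_space_pm_scale)
  let ?J = "Poly_Mapping.keys g \<union> Poly_Mapping.keys g'"
  let ?I = "Poly_Mapping.keys f"
  have "Poly_Mapping.keys (g + g') \<subseteq> ?J" by (rule Poly_Mapping.keys_add)
  then show ?thesis
    by (subst (1 2 3) bilinear_extension_superset[of ?I ?J])
      (auto simp: lookup_add distrib_left scale_left_distrib sum.distrib)
qed

lemma bilinear_extension_scale_left:
  "bilinear_extension b (pm_scale c f) g = pm_scale c (bilinear_extension b f g)"
proof -
  interpret vector_space "pm_scale :: 'b \<Rightarrow> ('a \<Rightarrow>\<^sub>0 'b) \<Rightarrow> _" by (rule vector_space_pm_scale)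
  have "Poly_Mapping.keys (pm_scale c f) \<subseteq> Poly_Mapping.keys f"
    by (auto simp: in_keys_iff lookup_pm_scale)
  then show ?thesis
    by (subst (1 2) bilinear_extension_superset[of "Poly_Mapping.keys f" "Poly_Mapping.keys g"])
      (auto simp: lookup_pm_scale scale_sum_right mult.assoc)
qed

lemma bilinear_extension_scale_right:
  "bilinear_extension b f (pm_scale c g) = pm_scale c (bilinear_extension b f g)"
proof -
  interpret vector_space "pm_scale :: 'b \<Rightarrow> ('a \<Rightarrow>\<^sub>0 'b) \<Rightarrow> _" by (rule vector_space_pm_scale)
  have "Poly_Mapping.keys (pm_scale c g) \<subseteq> Poly_Mapping.keys g"
    by (auto simp: in_keys_iff lookup_pm_scale)
  then show ?thesis
    by (subst (1 2) bilinear_extension_superset[of "Poly_Mapping.keys f" "Poly_Mapping.keys g"])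
      (auto simp: lookup_pm_scale scale_sum_right mult.left_commute)
qed

lemma bilinear_extension_single:
  "bilinear_extension b (Poly_Mapping.single i c) (Poly_Mapping.single j d) = pm_scale (c * d) (b i j)"
  by (subst bilinear_extension_superset[of "{i}" "{j}"]) auto

lemma pm_induct [case_names add single]:
  assumes "\<And>f g. P f \<Longrightarrow> P g \<Longrightarrow> P (f + g)" "\<And>i c. P (Poly_Mapping.single i c)"
  shows "P (f :: 'i \<Rightarrow>\<^sub>0 'k::field)"
proof (induction f rule: Poly_Mapping.update_induct)
  case const
  show ?case using assms(2)[of undefined 0] by simp
next
  case (update f i c)
  have "Poly_Mapping.update i c f = f + Poly_Mapping.single i c"
    using update by (auto intro!: poly_mapping_eqI
      simp: Poly_Mapping.lookup_update lookup_add lookup_single when_def in_keys_iff)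
  with update assms show ?case by simp
qed

lemma pm_scale_single: "pm_scale c (Poly_Mapping.single i d) = Poly_Mapping.single i (c * d)"
  by (rule poly_mapping_eqI) (simp add: lookup_pm_scale lookup_single when_def)

lemma lie_algebra_bilinear_extension:
  fixes b :: "'i \<Rightarrow> 'i \<Rightarrow> ('i \<Rightarrow>\<^sub>0 'k::field_char_0)"
  assumes alt: "\<And>i j. b i j = - b j i"
    and jac: "\<And>i j k. bilinear_extension b (Poly_Mapping.single i 1) (b j k)
                + bilinear_extension b (Poly_Mapping.single j 1) (b k i)
                + bilinear_extension b (Poly_Mapping.single k 1) (b i j) = 0"
  shows "lie_algebra pm_scale (bilinear_extension b)"
proof -
  let ?B = "bilinear_extension b"
  interpret V: vector_space "pm_scale :: 'k \<Rightarrow> ('i \<Rightarrow>\<^sub>0 'k) \<Rightarrow> _" by (rule vector_space_pm_scale)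
  note lin = bilinear_extension_add_left bilinear_extension_add_right
    bilinear_extension_scale_left bilinear_extension_scale_right
  have anti: "?B f g = - ?B g f" for f g
  proof -
    have "?B f g = (\<Sum>j\<in>Poly_Mapping.keys g. \<Sum>i\<in>Poly_Mapping.keys f.
            pm_scale (Poly_Mapping.lookup f i * Poly_Mapping.lookup g j) (b i j))"
      unfolding bilinear_extension_def by (rule sum.swap)
    also have "\<dots> = (\<Sum>j\<in>Poly_Mapping.keys g. \<Sum>i\<in>Poly_Mapping.keys f.
            - pm_scale (Poly_Mapping.lookup g j * Poly_Mapping.lookup f i) (b j i))"
      by (intro sum.cong refl) (metis alt V.scale_minus_right mult.commute)
    finally show ?thesis by (simp add: bilinear_extension_def sum_negf)
  qed
  have self: "?B f f = 0" for f
  proof (rule poly_mapping_eqI)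
    fix i
    have "Poly_Mapping.lookup (?B f f) i = - Poly_Mapping.lookup (?B f f) i"
      by (metis anti lookup_uminus)
    then show "Poly_Mapping.lookup (?B f f) i = Poly_Mapping.lookup 0 i" by simp
  qed
  define J where "J f g h = ?B f (?B g h) + ?B g (?B h f) + ?B h (?B f g)" for f g h
  have J_add: "J (f + f') g h = J f g h + J f' g h" "J f (g + g') h = J f g h + J f g' h"
    "J f g (h + h') = J f g h + J f g h'" for f f' g g' h h'
    by (simp_all add: J_def lin add_ac)
  have J_single: "J (Poly_Mapping.single i c) (Poly_Mapping.single j d) (Poly_Mapping.single k e) = 0"
    for i j k c d e
  proof -
    have s: "Poly_Mapping.single i c = pm_scale c (Poly_Mapping.single i 1)" for i :: 'i and c :: 'k
      by (simp add: pm_scale_single)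
    have "J (Poly_Mapping.single i c) (Poly_Mapping.single j d) (Poly_Mapping.single k e) =
        pm_scale (c * d * e) (J (Poly_Mapping.single i 1) (Poly_Mapping.single j 1) (Poly_Mapping.single k 1))"
      unfolding s[of _ c] s[of _ d] s[of _ e] J_def lin
      by (simp add: V.scale_right_distrib mult_ac)
    also have "\<dots> = 0"
      by (simp add: J_def bilinear_extension_single jac)
    finally show ?thesis .
  qed
  have jacobi: "?B f (?B g h) + ?B g (?B h f) + ?B h (?B f g) = 0" for f g h
  proof -
    have 1: "J f (Poly_Mapping.single j d) (Poly_Mapping.single k e) = 0" for f j d k e
      by (induction f rule: pm_induct) (simp_all add: J_add J_single)
    have 2: "J f g (Poly_Mapping.single k e) = 0" for f g k e
      by (induction g rule: pm_induct) (simp_all add: J_add 1)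
    have "J f g h = 0"
      by (induction h rule: pm_induct) (simp_all add: J_add 2)
    then show ?thesis by (simp add: J_def)
  qed
  show ?thesis
    by (unfold_locales) (auto simp: lin self jacobi)
qed

interpretation witt: lie_algebra pm_scale witt_bracket
  unfolding witt_bracket_def
proof (rule lie_algebra_bilinear_extension)
  fix i j k :: int
  show "witt_basis_bracket i j = - witt_basis_bracket j i"
    by (auto intro!: poly_mapping_eqI simp: witt_basis_bracket_def lookup_single when_def add.commute)
  show "bilinear_extension witt_basis_bracket (Poly_Mapping.single i 1) (witt_basis_bracket j k)
      + bilinear_extension witt_basis_bracket (Poly_Mapping.single j 1) (witt_basis_bracket k i)
      + bilinear_extension witt_basis_bracket (Poly_Mapping.single k 1) (witt_basis_bracket i j) = 0"
    unfolding witt_basis_bracket_def bilinear_extension_single pm_scale_single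
    by (auto intro!: poly_mapping_eqI simp: lookup_add lookup_single when_def algebra_simps)
qed

lemma virasoro_basis_bracket_central [simp]:
  "virasoro_basis_bracket i Central = 0" "virasoro_basis_bracket Central i = 0"
  by (cases i; simp)+

interpretation virasoro: lie_algebra pm_scale virasoro_bracket
  unfolding virasoro_bracket_def
proof (rule lie_algebra_bilinear_extension)
  interpret V: vector_space "pm_scale :: complex \<Rightarrow> (virasoro_index \<Rightarrow>\<^sub>0 complex) \<Rightarrow> _"
    by (rule vector_space_pm_scale)
  let ?B = "bilinear_extension virasoro_basis_bracket"
  fix i j k :: virasoro_index
  show alt: "virasoro_basis_bracket i j = - virasoro_basis_bracket j i" for i j
    by (cases i; cases j)
      (auto intro!: poly_mapping_eqI simp: lookup_add lookup_single when_def add.commute field_simps)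
  have z: "?B f 0 = 0" for f by (simp add: bilinear_extension_def)
  have C: "?B (Poly_Mapping.single Central 1) f = 0" for f
    by (simp add: bilinear_extension_def)
  have LC: "?B (Poly_Mapping.single i 1) (Poly_Mapping.single Central c) = 0" for i c
    by (simp add: bilinear_extension_single)
  have LL: "?B (Poly_Mapping.single (L n) 1) (virasoro_basis_bracket (L p) (L q)) =
     Poly_Mapping.single (L (n + p + q)) (of_int ((q - p) * (p + q - n))) +
     Poly_Mapping.single Central
       (if n + p + q = 0 then of_int ((q - p) * ((p + q) ^ 3 - (p + q))) / 12 else 0)" for n p q
    by (auto simp: bilinear_extension_add_right LC z bilinear_extension_single
          V.scale_right_distrib pm_scale_single add.assoc)
  show "?B (Poly_Mapping.single i 1) (virasoro_basis_bracket j k)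
      + ?B (Poly_Mapping.single j 1) (virasoro_basis_bracket k i)
      + ?B (Poly_Mapping.single k 1) (virasoro_basis_bracket i j) = 0"
  proof (cases "i = Central \<or> j = Central \<or> k = Central")
    case True
    then show ?thesis by (auto simp: C z)
  next
    case False
    then obtain n p q where [simp]: "i = L n" "j = L p" "k = L q"
      by (metis virasoro_index.exhaust)
    have s: "p + q + n = n + p + q" "q + n + p = n + p + q" by simp_all
    define a where "a n p q = (of_int ((q - p) * (p + q - n)) :: complex)" for n p q :: int
    define c where "c n p q = (if n + p + q = 0
      then of_int ((q - p) * ((p + q) ^ 3 - (p + q))) / 12 else 0 :: complex)" for n p q :: int
    have a: "a n p q + a p q n + a q n p = 0"
      unfolding a_def of_int_add[symmetric] by (simp add: algebra_simps)
    have c: "c n p q + c p q n + c q n p = 0"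
    proof (cases "n + p + q = 0")
      case True
      then have n: "n = - p - q" by simp
      show ?thesis
        unfolding c_def s using True
        by (simp add: add_divide_distrib[symmetric] of_int_add[symmetric] del: of_int_add of_int_mult of_int_diff of_int_power)
           (simp add: n algebra_simps power3_eq_cube)
    qed (simp add: c_def s)
    have LL': "?B (Poly_Mapping.single (L n) 1) (virasoro_basis_bracket (L p) (L q)) =
      Poly_Mapping.single (L (n + p + q)) (a n p q) + Poly_Mapping.single Central (c n p q)" for n p q
      by (simp only: LL a_def c_def)
    have "?B (Poly_Mapping.single i 1) (virasoro_basis_bracket j k)
      + ?B (Poly_Mapping.single j 1) (virasoro_basis_bracket k i)
      + ?B (Poly_Mapping.single k 1) (virasoro_basis_bracket i j)
      = Poly_Mapping.single (L (n + p + q)) (a n p q + a p q n + a q n p)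
        + Poly_Mapping.single Central (c n p q + c p q n + c q n p)"
      unfolding \<open>i = L n\<close> \<open>j = L p\<close> \<open>k = L q\<close> LL' s single_add
      by (simp only: add_ac)
    then show ?thesis by (simp add: a c)
  qed
qed

end

theory Submission
  imports Defs "HOL-Library.Function_Algebras"
begin

text \<open>
  The argument has two independent halves.

  \<^bold>\<open>Vanishing of the second cohomology.\<close>  In both algebras the element \<open>z = l\<^sub>0\<close> acts diagonally on
  the basis, with eigenvalue the degree.  For a cocycle \<open>\<psi>\<close>, Cartan's formula says that the Lie
  derivative of \<open>\<psi>\<close> along \<open>z\<close> is the coboundary of the contraction \<open>\<psi> z\<close>
  (\<open>lie_derivative2_cocycle\<close>); dividing the components of \<open>\<psi> z\<close> by their degrees shows that
  \<open>\<psi>\<close> is cohomologous to a cocycle of degree zero (\<open>homogeneous_representative\<close>).  For the Witt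
  algebra such a cocycle is a matrix of numbers \<open>f i j\<close> with \<open>\<psi>(l\<^sub>i, l\<^sub>j) = f i j l\<^sub>i\<^sub>+\<^sub>j\<close>.  Subtracting
  a coboundary one reaches \<open>f i 1 = 0\<close> and \<open>f 2 (-1) = 0\<close>, and then the cocycle condition for triples
  containing an index among \<open>1\<close>, \<open>0\<close>, \<open>-1\<close>, \<open>-2\<close> forces \<open>f = 0\<close>
  (\<open>witt_coefficient_cocycle_zero\<close>).  For the Virasoro algebra, \<open>x \<mapsto> \<psi>(x, c)\<close> is a derivation of
  degree zero and can be made zero by a multiple of \<open>c \<mapsto> l\<^sub>0\<close>; after that the components along the
  \<open>l\<^sub>n\<close> satisfy the Witt cocycle condition, and the remaining central component is a scalar
  2-cocycle of the Witt algebra, hence a combination of \<open>i\<^sup>3\<close> and \<open>i\<close>, which is a coboundary.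

  \<^bold>\<open>Vanishing cohomology implies formal rigidity\<close>, for an arbitrary Lie algebra \<open>L\<close> and base \<open>A\<close>
  (\<open>formally_rigid_if_H2_vanishes\<close>).  Let \<open>A'\<close> be the space of linear functionals on \<open>A\<close> that vanish on
  some power of the maximal ideal \<open>m\<close>.  As the quotients \<open>A/m^n\<close> are finite dimensional, the completed
  tensor product of \<open>A\<close> and \<open>L\<close> is \<open>Hom(A', L)\<close>: an element \<open>t\<close> corresponds to the map sending \<open>\<beta>\<close> to
  \<open>(\<beta> \<otimes> id) t\<close> (\<open>to_hom_bij\<close>).  In this model there are no cosets and no convergence conditions; the
  level \<open>n\<close> of the filtration consists of the homomorphisms that vanish on the annihilator \<open>dual n\<close> of
  \<open>m^n\<close>.  Level \<open>n\<close> is generated by finitely many multiples by elements of \<open>m^n\<close>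
  (\<open>filtration_generated\<close>), so every \<open>A\<close>-linear map is continuous and is determined by its values on
  the constants \<open>1 \<otimes> x\<close> (\<open>hom_linear_determined\<close>).

  Given a deformation \<open>D\<close>, an equivalence \<open>\<Phi>\<close> with the trivial deformation is built degree by degree.
  If \<open>\<Phi>(D(s, t)) - [\<Phi> s, \<Phi> t]\<close> lies in level \<open>n \<ge> 1\<close>, then by the Jacobi identities its components modulo
  level \<open>n + 1\<close>, with respect to a basis of \<open>m^n/m^{n+1}\<close>, are 2-cocycles of \<open>L\<close>
  (\<open>obstruction_in_Z2\<close>).  They are coboundaries of maps \<open>\<phi>\<^sub>c\<close>, and adding the \<open>A\<close>-linear
  extension of \<open>\<Sum> c \<phi>\<^sub>c\<close> to \<open>\<Phi>\<close> moves the defect to level \<open>n + 1\<close> (\<open>approximate_equivalence_step\<close>).  The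
  limit is an exact homomorphism that is the identity modulo \<open>m\<close>, hence bijective
  (\<open>hom_linear_unipotent_bij\<close>).
\<close>

section \<open>Cochains with values in the adjoint module\<close>

context lie_algebra
begin

lemma bracket_add_right: "bracket x (y + z) = bracket x y + bracket x z"
  using linear_right[of x] by (simp add: Vector_Spaces.linear_iff)

lemma bracket_add_left: "bracket (x + y) z = bracket x z + bracket y z"
  using linear_left[of z] by (simp add: Vector_Spaces.linear_iff)

lemma bracket_scale_right: "bracket x (scale c y) = scale c (bracket x y)"
  using linear_right[of x] by (simp add: Vector_Spaces.linear_iff)

lemma bracket_scale_left: "bracket (scale c x) y = scale c (bracket x y)"
  using linear_left[of y] by (simp add: Vector_Spaces.linear_iff)

lemma bracket_zero_right [simp]: "bracket x 0 = 0"
  using bracket_scale_right[of x 0 0] by simp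

lemma bracket_zero_left [simp]: "bracket 0 x = 0"
  using bracket_scale_left[of 0 0 x] by simp

lemma bracket_minus_right: "bracket x (- y) = - bracket x y"
  using bracket_scale_right[of x "-1" y] by simp

lemma bracket_minus_left: "bracket (- x) y = - bracket x y"
  using bracket_scale_left[of "-1" x y] by simp

lemma bracket_diff_right: "bracket x (y - z) = bracket x y - bracket x z"
  using bracket_add_right[of x y "- z"] by (simp add: bracket_minus_right)

lemma bracket_diff_left: "bracket (x - y) z = bracket x z - bracket y z"
  using bracket_add_left[of x "- y" z] by (simp add: bracket_minus_left)

lemma bracket_sum_right: "bracket x (sum f I) = (\<Sum>i\<in>I. bracket x (f i))"
  by (induction I rule: infinite_finite_induct) (simp_all add: bracket_add_right)

lemma bracket_sum_left: "bracket (sum f I) x = (\<Sum>i\<in>I. bracket (f i) x)"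
  by (induction I rule: infinite_finite_induct) (simp_all add: bracket_add_left)

lemma bracket_anti: "bracket y x = - bracket x y"
proof -
  have "bracket (x + y) (x + y) = bracket x y + bracket y x"
    unfolding bracket_add_left bracket_add_right by (simp add: alternating)
  then show ?thesis by (metis alternating eq_neg_iff_add_eq_0 add.commute)
qed

text \<open>The Jacobi identity as the statement that \<open>bracket x\<close> is a derivation.\<close>

lemma jacobi_derivation:
  "bracket x (bracket y z) = bracket (bracket x y) z + bracket y (bracket x z)"
proof -
  have "bracket x (bracket y z) + bracket y (bracket z x) + bracket z (bracket x y) = 0"
    by (rule jacobi)
  moreover have "bracket y (bracket z x) = - bracket y (bracket x z)"
    by (metis bracket_anti bracket_minus_right)
  moreover have "bracket z (bracket x y) = - bracket (bracket x y) z"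
    by (rule bracket_anti)
  ultimately show ?thesis by (simp add: algebra_simps)
qed

lemmas bracket_linear = bracket_add_left bracket_add_right bracket_diff_left bracket_diff_right
  bracket_minus_left bracket_minus_right bracket_scale_left bracket_scale_right

lemma C1_iff: "\<phi> \<in> C1 \<longleftrightarrow> (\<forall>x y. \<phi> (x + y) = \<phi> x + \<phi> y) \<and> (\<forall>c x. \<phi> (scale c x) = scale c (\<phi> x))"
  by (simp add: C1_def Vector_Spaces.linear_iff vector_space_axioms)

lemma C2_iff: "\<psi> \<in> C2 \<longleftrightarrow>
   (\<forall>x y z. \<psi> x (y + z) = \<psi> x y + \<psi> x z) \<and> (\<forall>c x y. \<psi> x (scale c y) = scale c (\<psi> x y)) \<and>
   (\<forall>x y z. \<psi> (x + y) z = \<psi> x z + \<psi> y z) \<and> (\<forall>c x y. \<psi> (scale c x) y = scale c (\<psi> x y)) \<and>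
   (\<forall>x. \<psi> x x = 0)"
  by (auto simp add: C2_def Vector_Spaces.linear_iff vector_space_axioms)

lemma C1_add: "\<phi> \<in> C1 \<Longrightarrow> \<phi> (x + y) = \<phi> x + \<phi> y"
  and C1_scale: "\<phi> \<in> C1 \<Longrightarrow> \<phi> (scale c x) = scale c (\<phi> x)"
  by (simp_all add: C1_iff)

lemma C1_zero: "\<phi> \<in> C1 \<Longrightarrow> \<phi> 0 = 0"
  using C1_scale[of \<phi> 0 0] by simp

lemma C1_minus: "\<phi> \<in> C1 \<Longrightarrow> \<phi> (- x) = - \<phi> x"
  using C1_scale[of \<phi> "-1" x] by simp

lemma C1_diff: "\<phi> \<in> C1 \<Longrightarrow> \<phi> (x - y) = \<phi> x - \<phi> y"
  using C1_add[of \<phi> x "- y"] by (simp add: C1_minus)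

lemma C2_add_right: "\<psi> \<in> C2 \<Longrightarrow> \<psi> x (y + z) = \<psi> x y + \<psi> x z"
  and C2_add_left: "\<psi> \<in> C2 \<Longrightarrow> \<psi> (x + y) z = \<psi> x z + \<psi> y z"
  and C2_scale_right: "\<psi> \<in> C2 \<Longrightarrow> \<psi> x (scale c y) = scale c (\<psi> x y)"
  and C2_scale_left: "\<psi> \<in> C2 \<Longrightarrow> \<psi> (scale c x) y = scale c (\<psi> x y)"
  and C2_self: "\<psi> \<in> C2 \<Longrightarrow> \<psi> x x = 0"
  by (simp_all add: C2_iff)

lemma C2_anti: assumes "\<psi> \<in> C2" shows "\<psi> y x = - \<psi> x y"
proof -
  have "\<psi> (x + y) (x + y) = \<psi> x y + \<psi> y x"
    using assms by (simp add: C2_add_left C2_add_right C2_self)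
  then show ?thesis using assms by (simp add: C2_self eq_neg_iff_add_eq_0 add.commute)
qed

lemma Z2_C2: "\<psi> \<in> Z2 \<Longrightarrow> \<psi> \<in> C2"
  by (simp add: Z2_def)

lemma Z2_cocycle:
  assumes "\<psi> \<in> Z2"
  shows "bracket x (\<psi> y z) - bracket y (\<psi> x z) + bracket z (\<psi> x y)
    - \<psi> (bracket x y) z + \<psi> (bracket x z) y - \<psi> (bracket y z) x = 0"
  using assms by (simp add: Z2_def d2_def)

lemma d1_in_C2: assumes "\<phi> \<in> C1" shows "d1 \<phi> \<in> C2"
proof -
  have "scale c (bracket x y) - scale c (bracket z w) - scale c v
    = scale c (bracket x y - bracket z w - v)" for c x y z w v
    by (simp add: scale_right_diff_distrib)
  then show ?thesis
    using assms
    by (simp add: C2_iff d1_def bracket_linear C1_add C1_scale C1_zero alternating)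
qed

lemma d2_d1: assumes "\<phi> \<in> C1" shows "d2 (d1 \<phi>) x y z = 0"
proof -
  note lin = bracket_linear C1_add[OF assms] C1_diff[OF assms] C1_minus[OF assms]
  have n: "bracket z x = - bracket x z" "bracket z y = - bracket y z" "bracket y x = - bracket x y"
    by (rule bracket_anti)+
  have b: "bracket (bracket x y) (\<phi> z) = bracket x (bracket y (\<phi> z)) - bracket y (bracket x (\<phi> z))"
    "bracket (bracket x z) (\<phi> y) = bracket x (bracket z (\<phi> y)) - bracket z (bracket x (\<phi> y))"
    "bracket (bracket y z) (\<phi> x) = bracket y (bracket z (\<phi> x)) - bracket z (bracket y (\<phi> x))"
    by (simp_all add: jacobi_derivation[of x y] jacobi_derivation[of x z] jacobi_derivation[of y z])
  have c: "bracket (bracket x y) z = bracket x (bracket y z) - bracket y (bracket x z)"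
    "bracket (bracket x z) y = - bracket y (bracket x z)"
    "bracket (bracket y z) x = - bracket x (bracket y z)"
    using jacobi_derivation[of x y z] bracket_anti[of "bracket x z" y] bracket_anti[of "bracket y z" x]
    by (simp_all add: algebra_simps)
  show ?thesis
    unfolding d2_def d1_def by (simp add: lin b c algebra_simps)
qed

lemma B2_subset_Z2: "B2 \<subseteq> Z2"
  by (auto simp: B2_def Z2_def d2_d1 intro: d1_in_C2)

lemma Z2_diff:
  assumes "\<psi> \<in> Z2" "\<psi>' \<in> Z2"
  shows "(\<lambda>x y. \<psi> x y - \<psi>' x y) \<in> Z2"
proof -
  note C = assms[THEN Z2_C2]
  have "(\<lambda>x y. \<psi> x y - \<psi>' x y) \<in> C2"
    using C by (simp add: C2_iff scale_right_diff_distrib)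
  moreover have "d2 (\<lambda>x y. \<psi> x y - \<psi>' x y) x y z = d2 \<psi> x y z - d2 \<psi>' x y z" for x y z
    by (simp add: d2_def bracket_linear algebra_simps)
  ultimately show ?thesis using assms by (simp add: Z2_def)
qed

lemma C1_sum_maps: "\<phi> \<in> C1 \<Longrightarrow> \<phi>' \<in> C1 \<Longrightarrow> (\<lambda>x. \<phi> x + \<phi>' x) \<in> C1"
  by (simp add: C1_iff scale_right_distrib algebra_simps)

lemma B2_if_difference_in_B2:
  assumes "(\<lambda>x y. \<psi> x y - d1 \<phi> x y) \<in> B2" "\<phi> \<in> C1"
  shows "\<psi> \<in> B2"
proof -
  from assms(1) obtain \<phi>' where \<phi>': "\<phi>' \<in> C1" "(\<lambda>x y. \<psi> x y - d1 \<phi> x y) = d1 \<phi>'"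
    by (auto simp: B2_def)
  have "\<psi> x y = d1 (\<lambda>x. \<phi> x + \<phi>' x) x y" for x y
    using fun_cong[OF fun_cong[OF \<phi>'(2)], of x y] by (simp add: d1_def bracket_linear algebra_simps)
  then have "\<psi> = d1 (\<lambda>x. \<phi> x + \<phi>' x)" by blast
  with \<phi>'(1) assms(2) show ?thesis by (auto simp: B2_def intro!: imageI C1_sum_maps)
qed

lemma Z2_minus_d1: "\<psi> \<in> Z2 \<Longrightarrow> \<phi> \<in> C1 \<Longrightarrow> (\<lambda>x y. \<psi> x y - d1 \<phi> x y) \<in> Z2"
  using B2_subset_Z2 by (intro Z2_diff) (auto simp: B2_def)

lemma zero_in_B2: "(\<lambda>x y. 0) \<in> B2"
proof -
  have "(\<lambda>x. 0) \<in> C1" by (simp add: C1_iff)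
  moreover have "d1 (\<lambda>x. 0) = (\<lambda>x y. 0)" by (simp add: d1_def fun_eq_iff)
  ultimately show ?thesis unfolding B2_def by (metis imageI)
qed

lemma H2_vanishes_iff: "H2_vanishes \<longleftrightarrow> Z2 \<subseteq> B2"
proof
  assume *: "Z2 \<subseteq> B2"
  then have eq: "Z2 = B2" using B2_subset_Z2 by blast
  have "{(\<psi>, \<psi>') \<in> Z2 \<times> Z2. (\<lambda>x y. \<psi> x y - \<psi>' x y) \<in> B2} = Z2 \<times> Z2"
    using Z2_diff * by auto
  moreover have "Z2 \<noteq> {}" using zero_in_B2 eq by auto
  ultimately show H2_vanishes
    using eq unfolding H2_vanishes_def H2_def quotient_def by auto
next
  assume H: H2_vanishes
  show "Z2 \<subseteq> B2"
  proof
    fix \<psi> assume \<psi>: "\<psi> \<in> Z2"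
    let ?R = "{(\<psi>, \<psi>') \<in> Z2 \<times> Z2. (\<lambda>x y. \<psi> x y - \<psi>' x y) \<in> B2}"
    have "?R `` {\<psi>} \<in> H2" using \<psi> unfolding H2_def by (rule quotientI)
    then have "?R `` {\<psi>} = B2" using H by (simp add: H2_vanishes_def)
    moreover have "\<psi> \<in> ?R `` {\<psi>}" using \<psi> zero_in_B2 by simp
    ultimately show "\<psi> \<in> B2" by simp
  qed
qed

text \<open>The Lie derivative, along \<open>z\<close>, of 1-cochains and of 2-cochains.\<close>

definition lie_derivative1 :: "'l \<Rightarrow> ('l \<Rightarrow> 'l) \<Rightarrow> 'l \<Rightarrow> 'l"
  where "lie_derivative1 z \<phi> = (\<lambda>x. bracket z (\<phi> x) - \<phi> (bracket z x))"

definition lie_derivative2 :: "'l \<Rightarrow> ('l \<Rightarrow> 'l \<Rightarrow> 'l) \<Rightarrow> 'l \<Rightarrow> 'l \<Rightarrow> 'l"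
  where "lie_derivative2 z \<psi> = (\<lambda>x y. bracket z (\<psi> x y) - \<psi> (bracket z x) y - \<psi> x (bracket z y))"

text \<open>
  Cartan's formula \<open>L\<^sub>z = d i\<^sub>z + i\<^sub>z d\<close> for a cocycle: the Lie derivative is the coboundary of the
  contraction with \<open>z\<close>.
\<close>

lemma lie_derivative2_cocycle:
  assumes "\<psi> \<in> Z2"
  shows "lie_derivative2 z \<psi> = d1 (\<psi> z)"
proof (intro ext)
  fix x y
  note a = C2_anti[OF Z2_C2[OF assms]]
  show "lie_derivative2 z \<psi> x y = d1 (\<psi> z) x y"
    using Z2_cocycle[OF assms, of z x y] a[of "bracket z y" x] a[of "bracket x y" z]
    by (simp add: lie_derivative2_def d1_def algebra_simps)
qed

text \<open>Lie derivatives commute with the differential.\<close>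

lemma lie_derivative_d1:
  assumes "\<phi> \<in> C1"
  shows "lie_derivative2 z (d1 \<phi>) = d1 (lie_derivative1 z \<phi>)"
proof (intro ext)
  fix x y
  note J = jacobi_derivation[of z x "\<phi> y"] jacobi_derivation[of z y "\<phi> x"] jacobi_derivation[of z x y]
  show "lie_derivative2 z (d1 \<phi>) x y = d1 (lie_derivative1 z \<phi>) x y"
    by (simp add: lie_derivative1_def lie_derivative2_def d1_def bracket_linear J
        C1_add[OF assms] C1_diff[OF assms] algebra_simps)
qed

end

section \<open>Reduction to cochains of degree zero\<close>

text \<open>
  The linear map with prescribed values \<open>v i\<close> on the basis.  It is expressed through
  \<open>bilinear_extension\<close>, with a second argument that is ignored, in order to inherit linearity.
\<close>

definition linear_extension :: "('i \<Rightarrow> ('i \<Rightarrow>\<^sub>0 'k::field)) \<Rightarrow> ('i \<Rightarrow>\<^sub>0 'k) \<Rightarrow> ('i \<Rightarrow>\<^sub>0 'k)"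
  where "linear_extension v f = bilinear_extension (\<lambda>i _. v i) f (Poly_Mapping.single undefined 1)"

lemma linear_extension_single:
  "linear_extension v (Poly_Mapping.single i c) = pm_scale c (v i)"
  by (simp add: linear_extension_def bilinear_extension_single)

lemma linear_extension_add:
  "linear_extension v (f + g) = linear_extension v f + linear_extension v g"
  by (simp add: linear_extension_def bilinear_extension_add_left)

lemma linear_extension_scale:
  "linear_extension v (pm_scale c f) = pm_scale c (linear_extension v f)"
  by (simp add: linear_extension_def bilinear_extension_scale_left)

lemma pm_scale_one_single: "Poly_Mapping.single i c = pm_scale c (Poly_Mapping.single i 1)"
  by (simp add: pm_scale_single)

text \<open>
  A Lie algebra of finitely supported functions in which an element \<open>z\<close> acts diagonally on the basis,
  the eigenvalue of the basis vector \<open>i\<close> being its degree \<open>deg i\<close>.  No further axiom on the grading is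
  needed: the derivation property of the bracket with \<open>z\<close> makes the bracket respect degrees.
\<close>

locale graded_lie_algebra = lie_algebra pm_scale br
  for br :: "('i \<Rightarrow>\<^sub>0 'k::field_char_0) \<Rightarrow> ('i \<Rightarrow>\<^sub>0 'k) \<Rightarrow> ('i \<Rightarrow>\<^sub>0 'k)" +
  fixes deg :: "'i \<Rightarrow> int" and z :: "'i \<Rightarrow>\<^sub>0 'k"
  assumes bracket_z: "br z (Poly_Mapping.single i 1) = pm_scale (of_int (deg i)) (Poly_Mapping.single i 1)"
begin

abbreviation e :: "'i \<Rightarrow> ('i \<Rightarrow>\<^sub>0 'k)"
  where "e i \<equiv> Poly_Mapping.single i 1"

lemma linear_extension_in_C1: "linear_extension v \<in> C1"
  by (simp add: C1_iff linear_extension_add linear_extension_scale)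

lemma C1_eqI:
  assumes "\<phi> \<in> C1" "\<phi>' \<in> C1" "\<And>i. \<phi> (e i) = \<phi>' (e i)"
  shows "\<phi> = \<phi>'"
proof
  fix f
  show "\<phi> f = \<phi>' f"
  proof (induction f rule: pm_induct)
    case (single i c)
    show ?case using assms by (subst (1 2) pm_scale_one_single) (simp add: C1_scale)
  qed (simp add: assms C1_add)
qed

lemma C2_eqI:
  assumes "\<psi> \<in> C2" "\<psi>' \<in> C2" "\<And>i j. \<psi> (e i) (e j) = \<psi>' (e i) (e j)"
  shows "\<psi> = \<psi>'"
proof -
  have C1: "\<psi> x \<in> C1" "(\<lambda>y. \<psi> y x) \<in> C1" if "\<psi> \<in> C2" for \<psi> x
    using that by (simp_all add: C1_iff C2_iff)
  have "\<psi> (e i) = \<psi>' (e i)" for i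
    by (rule C1_eqI) (simp_all add: C1 assms)
  then have "(\<lambda>y. \<psi> y x) = (\<lambda>y. \<psi>' y x)" for x
    by (intro C1_eqI) (simp_all add: C1 assms)
  then show ?thesis by (metis ext)
qed

lemma lookup_bracket_z: "Poly_Mapping.lookup (br z f) k = of_int (deg k) * Poly_Mapping.lookup f k"
proof (induction f rule: pm_induct)
  case (single i c)
  show ?case
    by (subst pm_scale_one_single)
      (simp add: bracket_scale_right bracket_z lookup_pm_scale lookup_single when_def)
qed (simp add: bracket_add_right lookup_add algebra_simps)

lemma lookup_lie_derivative1:
  assumes "\<phi> \<in> C1"
  shows "Poly_Mapping.lookup (lie_derivative1 z \<phi> (e i)) k =
    of_int (deg k - deg i) * Poly_Mapping.lookup (\<phi> (e i)) k"
  using assms by (simp add: lie_derivative1_def lookup_minus lookup_bracket_z bracket_z C1_scale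
      lookup_pm_scale algebra_simps)

lemma lookup_lie_derivative2:
  assumes "\<psi> \<in> C2"
  shows "Poly_Mapping.lookup (lie_derivative2 z \<psi> (e i) (e j)) k =
    of_int (deg k - deg i - deg j) * Poly_Mapping.lookup (\<psi> (e i) (e j)) k"
  using assms by (simp add: lie_derivative2_def lookup_minus lookup_bracket_z bracket_z
      C2_scale_left C2_scale_right lookup_pm_scale lookup_add algebra_simps)

lemma lie_derivative1_in_C1: "\<phi> \<in> C1 \<Longrightarrow> lie_derivative1 x \<phi> \<in> C1"
  by (simp add: C1_iff lie_derivative1_def bracket_linear scale_right_diff_distrib)

text \<open>
  A 2-cochain that is annihilated by the Lie derivative along \<open>z\<close> has degree zero.
\<close>

lemma homogeneous_lookup:
  assumes "\<psi> \<in> C2" "lie_derivative2 z \<psi> = (\<lambda>x y. 0)" "deg k \<noteq> deg i + deg j"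
  shows "Poly_Mapping.lookup (\<psi> (e i) (e j)) k = 0"
proof -
  have "of_int (deg k - deg i - deg j) * Poly_Mapping.lookup (\<psi> (e i) (e j)) k = 0"
    by (simp only: lookup_lie_derivative2[OF assms(1), symmetric] assms(2) lookup_zero)
  moreover have "(of_int (deg k - deg i - deg j) :: 'k) \<noteq> 0"
    using assms(3) unfolding of_int_eq_0_iff by simp
  ultimately show ?thesis by (metis mult_eq_0_iff)
qed

lemma homogeneous_linear_extension:
  assumes "\<And>i k. deg k \<noteq> deg i \<Longrightarrow> Poly_Mapping.lookup (v i) k = 0"
  shows "lie_derivative1 z (linear_extension v) = (\<lambda>x. 0)"
proof (rule C1_eqI)
  show "(\<lambda>x. 0) \<in> C1" by (simp add: C1_iff)
  show "lie_derivative1 z (linear_extension v) (e i) = 0" for i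
    by (rule poly_mapping_eqI)
      (use assms in \<open>auto simp: lookup_lie_derivative1 linear_extension_in_C1 linear_extension_single
        lookup_pm_scale\<close>)
qed (simp add: lie_derivative1_in_C1 linear_extension_in_C1)

lemma lie_derivative2_diff:
  "lie_derivative2 x (\<lambda>a b. \<psi> a b - \<psi>' a b) = (\<lambda>a b. lie_derivative2 x \<psi> a b - lie_derivative2 x \<psi>' a b)"
  by (simp add: fun_eq_iff lie_derivative2_def bracket_diff_right)

lemma homogeneous_diff_d1:
  assumes "lie_derivative2 z \<psi> = (\<lambda>x y. 0)" "\<phi> \<in> C1" "lie_derivative1 z \<phi> = (\<lambda>x. 0)"
  shows "lie_derivative2 z (\<lambda>x y. \<psi> x y - d1 \<phi> x y) = (\<lambda>x y. 0)"
  by (simp add: lie_derivative2_diff assms lie_derivative_d1) (simp add: d1_def)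

text \<open>
  Every cocycle is cohomologous to one of degree zero.  The correcting 1-cochain divides the
  components of \<open>\<psi> z\<close> of nonzero degree by their degree; each \<open>\<psi> z (e i)\<close> has finite support, so
  this is a linear map although infinitely many degrees can occur altogether.
\<close>

lemma homogeneous_representative:
  assumes \<psi>: "\<psi> \<in> Z2"
  obtains \<phi> where "\<phi> \<in> C1" "lie_derivative2 z (\<lambda>x y. \<psi> x y - d1 \<phi> x y) = (\<lambda>x y. 0)"
proof -
  define v where "v i = Poly_Mapping.mapp
    (\<lambda>k c. if deg k = deg i then 0 else c / of_int (deg k - deg i)) (\<psi> z (e i))" for i
  define \<phi> where "\<phi> = linear_extension v"
  have \<phi>: "\<phi> \<in> C1" by (simp add: \<phi>_def linear_extension_in_C1)
  have \<psi>z: "\<psi> z \<in> C1" using Z2_C2[OF \<psi>] by (simp add: C1_iff C2_iff)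
  \<comment> \<open>The part of \<open>\<psi> z\<close> of degree zero; it is killed by the Lie derivative.\<close>
  define \<phi>' where "\<phi>' x = \<psi> z x - lie_derivative1 z \<phi> x" for x
  have \<phi>': "\<phi>' \<in> C1"
    using \<psi>z lie_derivative1_in_C1[OF \<phi>, of z] by (simp add: C1_iff \<phi>'_def scale_right_diff_distrib)
  have lookup_v: "Poly_Mapping.lookup (v i) k =
    (if deg k = deg i then 0 else Poly_Mapping.lookup (\<psi> z (e i)) k / of_int (deg k - deg i))" for i k
    by (auto simp: v_def lookup_mapp when_def in_keys_iff)
  have "Poly_Mapping.lookup (\<phi>' (e i)) k = 0" if "deg k \<noteq> deg i" for i k
  proof -
    have "(of_int (deg k - deg i) :: 'k) \<noteq> 0"
      using that unfolding of_int_eq_0_iff by simp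
    then show ?thesis using that
      by (simp add: \<phi>'_def lookup_minus lookup_lie_derivative1[OF \<phi>])
        (simp add: \<phi>_def linear_extension_single lookup_v lookup_pm_scale)
  qed
  then have "lie_derivative1 z \<phi>' = (\<lambda>x. 0)"
    by (intro C1_eqI lie_derivative1_in_C1 \<phi>' poly_mapping_eqI)
      (auto simp: C1_iff lookup_lie_derivative1[OF \<phi>'])
  then have "lie_derivative2 z (d1 \<phi>') = (\<lambda>x y. 0)"
    by (simp add: lie_derivative_d1[OF \<phi>']) (simp add: d1_def)
  moreover have d: "lie_derivative2 z (\<lambda>x y. \<psi> x y - d1 \<phi> x y) = d1 \<phi>'"
    by (simp add: lie_derivative2_diff lie_derivative2_cocycle[OF \<psi>] lie_derivative_d1[OF \<phi>])
       (simp add: fun_eq_iff d1_def \<phi>'_def bracket_diff_right)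
  ultimately have 0: "lie_derivative2 z (lie_derivative2 z (\<lambda>x y. \<psi> x y - d1 \<phi> x y)) = (\<lambda>x y. 0)"
    by simp
  \<comment> \<open>The Lie derivative acts on components by a scalar, so its square has the same kernel.\<close>
  let ?\<chi> = "\<lambda>x y. \<psi> x y - d1 \<phi> x y"
  have \<chi>: "?\<chi> \<in> C2" using \<psi> \<phi> by (intro Z2_C2 Z2_minus_d1)
  have D\<chi>: "lie_derivative2 z ?\<chi> \<in> C2" unfolding d by (rule d1_in_C2) (rule \<phi>')
  have "lie_derivative2 z ?\<chi> = (\<lambda>x y. 0)"
  proof (rule C2_eqI)
    show "lie_derivative2 z ?\<chi> \<in> C2" by (rule D\<chi>)
    show "(\<lambda>x y. 0) \<in> C2" by (simp add: C2_iff)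
    show "lie_derivative2 z ?\<chi> (e i) (e j) = 0" for i j
    proof (rule poly_mapping_eqI)
      fix k
      have "Poly_Mapping.lookup (lie_derivative2 z (lie_derivative2 z ?\<chi>) (e i) (e j)) k = 0"
        unfolding 0 by simp
      then show "Poly_Mapping.lookup (lie_derivative2 z ?\<chi> (e i) (e j)) k = Poly_Mapping.lookup 0 k"
        unfolding lookup_lie_derivative2[OF D\<chi>] lookup_lie_derivative2[OF \<chi>] by auto
    qed
  qed
  with \<phi> show thesis by (rule that)
qed

lemma H2_vanishes_if_homogeneous:
  assumes "\<And>\<psi>. \<psi> \<in> Z2 \<Longrightarrow> lie_derivative2 z \<psi> = (\<lambda>x y. 0) \<Longrightarrow> \<psi> \<in> B2"
  shows H2_vanishes
  unfolding H2_vanishes_iff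
proof
  fix \<psi> assume \<psi>: "\<psi> \<in> Z2"
  then obtain \<phi> where \<phi>: "\<phi> \<in> C1" "lie_derivative2 z (\<lambda>x y. \<psi> x y - d1 \<phi> x y) = (\<lambda>x y. 0)"
    by (rule homogeneous_representative)
  show "\<psi> \<in> B2"
    by (rule B2_if_difference_in_B2[OF assms[OF _ \<phi>(2)] \<phi>(1)]) (rule Z2_minus_d1[OF \<psi> \<phi>(1)])
qed

lemma C2_single:
  assumes "\<psi> \<in> C2"
  shows "\<psi> (Poly_Mapping.single i c) x = pm_scale c (\<psi> (e i) x)"
    "\<psi> x (Poly_Mapping.single i c) = pm_scale c (\<psi> x (e i))"
  by (metis C2_scale_left[OF assms] pm_scale_one_single, metis C2_scale_right[OF assms] pm_scale_one_single)

end

section \<open>The second cohomology of the Witt algebra\<close>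

text \<open>
  A first-order recurrence over the integers with the step from \<open>1\<close> to \<open>2\<close> omitted: the values at \<open>1\<close>
  and \<open>2\<close> can be chosen independently, and those at \<open>i \<le> 1\<close> do not depend on the value at \<open>2\<close>.
\<close>

lemma int_recurrence:
  fixes g :: "int \<Rightarrow> complex"
  obtains \<phi> where "\<phi> 1 = 0" "\<phi> 2 = p" "\<And>i. i \<noteq> 1 \<Longrightarrow> \<phi> (i + 1) = \<phi> i + g i"
    "\<And>i. i \<le> 1 \<Longrightarrow> \<phi> i = - (\<Sum>k\<in>{i..<1}. g k)"
proof -
  define \<phi> where "\<phi> i = (if i \<le> 1 then - (\<Sum>k\<in>{i..<1}. g k) else p + (\<Sum>k\<in>{2..<i}. g k))" for i
  have step: "\<phi> (i + 1) = \<phi> i + g i" if "i \<noteq> 1" for i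
  proof (cases "i < 1")
    case True
    then have "(\<Sum>k\<in>{i..<1}. g k) = g i + (\<Sum>k\<in>{i + 1..<1}. g k)"
      by (subst sum.remove[of _ i]) (auto intro!: sum.cong)
    with True show ?thesis unfolding \<phi>_def by simp
  next
    case False
    with that have "(\<Sum>k\<in>{2..<i+1}. g k) = (\<Sum>k\<in>{2..<i}. g k) + g i"
      by (subst sum.remove[of _ i]) (auto intro!: sum.cong)
    with False that show ?thesis unfolding \<phi>_def by simp
  qed
  show thesis
  proof (rule that)
    show "\<phi> 1 = 0" "\<phi> 2 = p" by (simp_all add: \<phi>_def)
    show "\<phi> (i + 1) = \<phi> i + g i" if "i \<noteq> 1" for i using that by (rule step)
    show "\<phi> i = - (\<Sum>k\<in>{i..<1}. g k)" if "i \<le> 1" for i using that by (simp add: \<phi>_def)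
  qed
qed

text \<open>
  The condition on \<open>f\<close> for \<open>(l\<^sub>i, l\<^sub>j) \<mapsto> f i j l\<^sub>i\<^sub>+\<^sub>j\<close> to be a 2-cocycle of the Witt algebra.
\<close>

definition witt_coefficient_cocycle :: "(int \<Rightarrow> int \<Rightarrow> complex) \<Rightarrow> bool"
  where "witt_coefficient_cocycle f \<longleftrightarrow> (\<forall>i j. f j i = - f i j) \<and>
    (\<forall>i j k. of_int (j + k - i) * f j k - of_int (i + k - j) * f i k + of_int (i + j - k) * f i j
      - of_int (j - i) * f (i + j) k + of_int (k - i) * f (i + k) j - of_int (k - j) * f (j + k) i = 0)"

text \<open>
  The main computation.  Write \<open>C\<^sub>j\<close> for the column \<open>f _ j\<close>.  Triples containing \<open>1\<close> give a recurrence
  linking \<open>C\<^sub>j\<close> and \<open>C\<^sub>j\<^sub>+\<^sub>1\<close>; it propagates the vanishing of \<open>C\<^sub>1\<close> to \<open>C\<^sub>0\<close> (with the help of the triple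
  \<open>(-1, 2, 0)\<close>), to \<open>C\<^sub>-\<^sub>1\<close> (with the help of \<open>f 2 (-1) = 0\<close>) and to
  \<open>C\<^sub>-\<^sub>2\<close> up to one parameter \<open>f 2 (-2)\<close>.  That parameter vanishes by the triple \<open>(2, 3, -2)\<close>.  Then \<open>C\<^sub>2 = 0\<close> follows, and since \<open>l\<^sub>-\<^sub>2\<close>, \<open>l\<^sub>-\<^sub>1\<close>, \<open>l\<^sub>1\<close>, \<open>l\<^sub>2\<close> generate the Witt
  algebra, all columns vanish.
\<close>

lemma witt_coefficient_cocycle_zero:
  assumes f: "witt_coefficient_cocycle f" and f1: "\<And>i. f i 1 = 0" and f21: "f 2 (-1) = 0"
  shows "f i j = 0"
proof -
  have anti: "f j i = - f i j" for i j
    by (rule f[unfolded witt_coefficient_cocycle_def, THEN conjunct1, rule_format])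
  have coc: "of_int (j + k - i) * f j k - of_int (i + k - j) * f i k + of_int (i + j - k) * f i j
      - of_int (j - i) * f (i + j) k + of_int (k - i) * f (i + k) j - of_int (k - j) * f (j + k) i = 0"
    for i j k by (rule f[unfolded witt_coefficient_cocycle_def, THEN conjunct2, rule_format])
  have self: "f i i = 0" for i
  proof -
    have "2 * f i i = 0" by (subst (1) mult_2) (metis anti add.left_inverse)
    then show ?thesis by simp
  qed
  have cancel: "x = 0" if "of_int k * x = 0" "k \<noteq> 0" for k and x :: complex
    using that by simp
  \<comment> \<open>The triple \<open>(i, j, 1)\<close>.\<close>
  have up: "of_int (i + j - 1) * f i j = of_int (i - 1) * f (i + 1) j + of_int (j - 1) * f i (j + 1)" for i j
    using coc[where i = i and j = j and k = 1] anti[of i "j + 1"] by (simp add: f1 algebra_simps)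
  \<comment> \<open>The triple \<open>(i, j, 0)\<close>: the column of \<open>0\<close> is additive off the diagonal.\<close>
  have zero: "of_int (j - i) * (f j 0 + f i 0 - f (i + j) 0) = 0" for i j
    using coc[where i = i and j = j and k = 0] by (simp add: anti[of j i] algebra_simps)
  have up0: "f (i + 1) 0 = f i 0" if "i \<noteq> 1" for i
  proof -
    have "of_int (i - 1) * (f (i + 1) 0 - f i 0) = 0"
      using up[of i 0] by (simp add: f1 algebra_simps)
    then have "f (i + 1) 0 - f i 0 = 0" by (rule cancel) (use that in simp)
    then show ?thesis by simp
  qed
  have f10: "f 1 0 = 0" using f1[of 0] anti[of 1 0] by simp
  have le0: "f i 0 = 0" if "i \<le> 1" for i
    using that
  proof (induction i rule: int_le_induct)
    case (step i) then show ?case using up0[of "i - 1"] by simp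
  qed (rule f10)
  have f20: "f 2 0 = 0" using zero[of "-1" 2] le0[of "-1"] f10 by simp
  have ge0: "f i 0 = 0" if "i \<ge> 2" for i
    using that
  proof (induction i rule: int_ge_induct)
    case (step i) then show ?case using up0[of i] by simp
  qed (rule f20)
  have z0: "f i 0 = 0" for i using le0 ge0 by (cases "i \<le> 1") auto
  have up1: "of_int (i - 2) * f i (-1) = of_int (i - 1) * f (i + 1) (-1)" for i
    using up[of i "-1"] by (simp add: z0)
  have le1: "f i (-1) = 0" if "i \<le> 1" for i
    using that
  proof (induction i rule: int_le_induct)
    case base show ?case using f1[of "-1"] anti[of 1 "-1"] by simp
  next
    case (step i)
    then have "of_int (i - 3) * f (i - 1) (-1) = 0" using up1[of "i - 1"] by simp
    then show ?case by (rule cancel) (use step in simp)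
  qed
  have ge1: "f i (-1) = 0" if "i \<ge> 2" for i
    using that
  proof (induction i rule: int_ge_induct)
    case base show ?case by (rule f21)
  next
    case (step i)
    then have "of_int (i - 1) * f (i + 1) (-1) = 0" using up1[of i] by simp
    then show ?case by (rule cancel) (use step in simp)
  qed
  have z1: "f i (-1) = 0" for i using le1 ge1 by (cases "i \<le> 1") auto
  \<comment> \<open>The triple \<open>(i, j, -1)\<close>.\<close>
  have down: "of_int (i + j + 1) * f i j = of_int (i + 1) * f (i - 1) j + of_int (j + 1) * f i (j - 1)" for i j
    using coc[where i = i and j = j and k = "-1"] anti[of "j - 1" i] by (simp add: z1 algebra_simps)
  have up2: "of_int (i - 3) * f i (-2) = of_int (i - 1) * f (i + 1) (-2)" for i
    using up[of i "-2"] by (simp add: z1)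
  have le2: "f i (-2) = 0" if "i \<le> 1" for i
    using that
  proof (induction i rule: int_le_induct)
    case base show ?case using f1[of "-2"] anti[of 1 "-2"] by simp
  next
    case (step i)
    then have "of_int (i - 4) * f (i - 1) (-2) = 0" using up2[of "i - 1"] by simp
    then show ?case by (rule cancel) (use step in simp)
  qed
  have ge2: "f i (-2) = 0" if "i \<ge> 4" for i
    using that
  proof (induction i rule: int_ge_induct)
    case base show ?case using up2[of 3] by simp
  next
    case (step i)
    then have "of_int (i - 1) * f (i + 1) (-2) = 0" using up2[of i] by simp
    then show ?case by (rule cancel) (use step in simp)
  qed
  \<comment> \<open>The factor \<open>i - 3\<close> in \<open>up2\<close> leaves the entries at \<open>2\<close> and \<open>3\<close> undetermined, up to this relation.\<close>
  have f32: "f 3 (-2) = - f 2 (-2)" using up2[of 2] by simp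
  \<comment> \<open>Needed for the triple \<open>(2, 3, -2)\<close>: both terms on the right of \<open>down\<close> vanish.\<close>
  have f23: "f 2 3 = 0" using down[of 2 3] f1[of 3] anti[of 1 3] self[of 2] by simp
  have f22: "f 2 (-2) = 0"
    using coc[where i = 2 and j = 3 and k = "-2"] ge2[of 5] z0[of 3] anti[of 0 3] f1[of 2] anti[of 2 1]
    by (simp add: f32 f23)
  have z2: "f i (-2) = 0" for i
  proof -
    consider "i \<le> 1" | "i = 2" | "i = 3" | "i \<ge> 4" by linarith
    then show ?thesis using le2 ge2 f22 f32 by cases auto
  qed
  have down2: "of_int (i + 3) * f i 2 = of_int (i + 1) * f (i - 1) 2" for i
    using down[of i 2] by (simp add: f1 add.commute)
  \<comment> \<open>The \<open>l\<^sub>j\<close> whose column vanishes span a subalgebra.\<close>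
  have gen: "f i (j + k) = 0" if "j \<noteq> k" "\<And>i. f i j = 0" "\<And>i. f i k = 0" for i j k
  proof -
    have "of_int (k - j) * f (j + k) i = 0"
      using coc[where i = i and j = j and k = k] that(2,3) by simp
    then have "f (j + k) i = 0" by (rule cancel) (use that(1) in simp)
    then show ?thesis using anti[of "j + k" i] by simp
  qed
  have neg: "\<forall>i. f i j = 0" if "j \<le> -2" for j
    using that
  proof (induction j rule: int_le_induct)
    case base show ?case using z2 by simp
  next
    case (step j) then show ?case using gen[of j "-1"] z1 by simp
  qed
  have le3: "f i j = 0" if le: "j \<le> 1" for i j
  proof -
    consider "j \<le> -2" | "j = -1" | "j = 0" | "j = 1" using le by linarith
    then show ?thesis using neg z1 z0 f1 by cases auto
  qed
  have z3: "f i 2 = 0" for i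
  proof (cases "i \<le> 1")
    case True then show ?thesis using le3[of i 2] anti[of 2 i] by simp
  next
    case False
    then have "i \<ge> 2" by simp
    then show ?thesis
    proof (induction i rule: int_ge_induct)
      case base show ?case by (rule self)
    next
      case (step i)
      then have "of_int (i + 4) * f (i + 1) 2 = 0" using down2[of "i + 1"] by (simp add: add.assoc)
      then show ?case by (rule cancel) (use step in simp)
    qed
  qed
  have pos: "\<forall>i. f i j = 0" if "j \<ge> 2" for j
    using that
  proof (induction j rule: int_ge_induct)
    case (step j) then show ?case using gen[of j 1] f1 by simp
  qed (simp add: z3)
  show ?thesis using le3 pos by (cases "j \<le> 1") auto
qed

lemma witt_coefficient_cocycle_coboundary:
  assumes f: "witt_coefficient_cocycle f"
  obtains \<phi> where "\<And>i j. f i j = of_int (j - i) * (\<phi> j + \<phi> i - \<phi> (i + j))"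
proof -
  \<comment> \<open>The recurrence makes the column of \<open>1\<close> agree with the coboundary for every \<open>i\<close>; the free value
      \<open>\<phi> 2\<close> is spent on the entry at \<open>(2, -1)\<close>.\<close>
  define g where "g i = - f i 1 / of_int (1 - i)" for i
  obtain \<phi> where \<phi>: "\<phi> 1 = 0" "\<phi> 2 = - f 2 (-1) / 3 + (\<Sum>k\<in>{-1..<1}. g k)"
    "\<And>i. i \<noteq> 1 \<Longrightarrow> \<phi> (i + 1) = \<phi> i + g i" "\<And>i. i \<le> 1 \<Longrightarrow> \<phi> i = - (\<Sum>k\<in>{i..<1}. g k)"
    by (rule int_recurrence[of "- f 2 (-1) / 3 + (\<Sum>k\<in>{-1..<1}. g k)" g]) blast
  define d where "d i j = of_int (j - i) * (\<phi> j + \<phi> i - \<phi> (i + j))" for i j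
  have anti: "f j i = - f i j" for i j
    by (rule f[unfolded witt_coefficient_cocycle_def, THEN conjunct1, rule_format])
  have sub: "(a1 - b1) - (a2 - b2) + (a3 - b3) - (a4 - b4) + (a5 - b5) - (a6 - b6) = 0"
    if "b1 - b2 + b3 - b4 + b5 - b6 = 0" "a1 - a2 + a3 - a4 + a5 - a6 = 0"
    for a1 a2 a3 a4 a5 a6 b1 b2 b3 b4 b5 b6 :: complex
  proof -
    have "(a1 - b1) - (a2 - b2) + (a3 - b3) - (a4 - b4) + (a5 - b5) - (a6 - b6)
      = (a1 - a2 + a3 - a4 + a5 - a6) - (b1 - b2 + b3 - b4 + b5 - b6)" by simp
    then show ?thesis by (simp only: that) simp
  qed
  have "witt_coefficient_cocycle (\<lambda>i j. f i j - d i j)"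
    unfolding witt_coefficient_cocycle_def
  proof (intro conjI allI)
    show "f j i - d j i = - (f i j - d i j)" for i j
      using anti[of j i] by (simp add: d_def algebra_simps)
    fix i j k
    define I J K :: complex where "I = of_int i" and "J = of_int j" and "K = of_int k"
    define S where "S = \<phi> (i + j + k)"
    have d: "d j k = (K - J) * (\<phi> k + \<phi> j - \<phi> (j + k))" "d i k = (K - I) * (\<phi> k + \<phi> i - \<phi> (i + k))"
      "d i j = (J - I) * (\<phi> j + \<phi> i - \<phi> (i + j))" "d (i + j) k = (K - (I + J)) * (\<phi> k + \<phi> (i + j) - S)"
      "d (i + k) j = (J - (I + K)) * (\<phi> j + \<phi> (i + k) - S)" "d (j + k) i = (I - (J + K)) * (\<phi> i + \<phi> (j + k) - S)"
      by (simp_all add: d_def I_def J_def K_def S_def ac_simps)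
    have "of_int (j + k - i) * d j k - of_int (i + k - j) * d i k + of_int (i + j - k) * d i j
      - of_int (j - i) * d (i + j) k + of_int (k - i) * d (i + k) j - of_int (k - j) * d (j + k) i
      = (J + K - I) * d j k - (I + K - J) * d i k + (I + J - K) * d i j
      - (J - I) * d (i + j) k + (K - I) * d (i + k) j - (K - J) * d (j + k) i"
      by (simp add: I_def J_def K_def)
    also have "\<dots> = 0"
      unfolding d by (simp add: algebra_simps)
    finally have "of_int (j + k - i) * d j k - of_int (i + k - j) * d i k + of_int (i + j - k) * d i j
      - of_int (j - i) * d (i + j) k + of_int (k - i) * d (i + k) j - of_int (k - j) * d (j + k) i = 0" .
    moreover have "of_int (j + k - i) * f j k - of_int (i + k - j) * f i k + of_int (i + j - k) * f i j
      - of_int (j - i) * f (i + j) k + of_int (k - i) * f (i + k) j - of_int (k - j) * f (j + k) i = 0"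
      by (rule f[unfolded witt_coefficient_cocycle_def, THEN conjunct2, rule_format])
    ultimately show "of_int (j + k - i) * (f j k - d j k) - of_int (i + k - j) * (f i k - d i k)
      + of_int (i + j - k) * (f i j - d i j) - of_int (j - i) * (f (i + j) k - d (i + j) k)
      + of_int (k - i) * (f (i + k) j - d (i + k) j) - of_int (k - j) * (f (j + k) i - d (j + k) i) = 0"
      unfolding right_diff_distrib by (rule sub)
  qed
  moreover have "f i 1 - d i 1 = 0" for i
  proof (cases "i = 1")
    case True
    have "2 * f 1 1 = 0" by (subst (1) mult_2) (metis anti add.left_inverse)
    with True show ?thesis by (simp add: d_def)
  next
    case False
    then have "(of_int (1 - i) :: complex) \<noteq> 0" unfolding of_int_eq_0_iff by simp
    with False show ?thesis by (simp add: d_def \<phi>(1,3) g_def)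
  qed
  moreover have "f 2 (-1) - d 2 (-1) = 0"
    using \<phi>(2) \<phi>(4)[of "-1"] by (simp add: d_def \<phi>(1))
  ultimately have "f i j - d i j = 0" for i j
    by (rule witt_coefficient_cocycle_zero)
  then show thesis by (intro that[of \<phi>]) (simp add: d_def)
qed

lemma witt_bracket_single:
  "witt_bracket (Poly_Mapping.single i c) (Poly_Mapping.single j d) =
   Poly_Mapping.single (i + j) (c * d * of_int (j - i))"
  by (simp add: witt_bracket_def witt_basis_bracket_def bilinear_extension_single pm_scale_single)

interpretation witt_graded: graded_lie_algebra witt_bracket "\<lambda>i. i" "Poly_Mapping.single 0 1"
  by unfold_locales (simp add: witt_bracket_single pm_scale_single del: single_one)

theorem witt_H2_vanishes: "witt.H2_vanishes"
proof (rule witt_graded.H2_vanishes_if_homogeneous)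
  fix \<psi> assume \<psi>: "\<psi> \<in> witt.Z2"
    and hom: "witt.lie_derivative2 (Poly_Mapping.single 0 1) \<psi> = (\<lambda>x y. 0)"
  note C2 = witt.Z2_C2[OF \<psi>]
  define f where "f i j = Poly_Mapping.lookup (\<psi> (witt_graded.e i) (witt_graded.e j)) (i + j)" for i j
  have \<psi>f: "\<psi> (witt_graded.e i) (witt_graded.e j) = Poly_Mapping.single (i + j) (f i j)" for i j
    using witt_graded.homogeneous_lookup[OF C2 hom]
    by (intro poly_mapping_eqI) (auto simp: f_def lookup_single when_def)
  have \<psi>s: "\<psi> (Poly_Mapping.single i c) (Poly_Mapping.single j d) = Poly_Mapping.single (i + j) (c * d * f i j)"
    for i j c d
    unfolding witt_graded.C2_single(1)[OF C2, of i c] witt_graded.C2_single(2)[OF C2, of _ j d]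
    by (simp add: \<psi>f pm_scale_single mult_ac)
  have "witt_coefficient_cocycle f"
    unfolding witt_coefficient_cocycle_def
  proof (intro conjI allI)
    show "f j i = - f i j" for i j
      unfolding f_def by (subst witt.C2_anti[OF C2]) (simp add: add.commute)
    fix i j k
    have "Poly_Mapping.lookup
     (witt_bracket (witt_graded.e i) (\<psi> (witt_graded.e j) (witt_graded.e k))
     - witt_bracket (witt_graded.e j) (\<psi> (witt_graded.e i) (witt_graded.e k))
     + witt_bracket (witt_graded.e k) (\<psi> (witt_graded.e i) (witt_graded.e j))
     - \<psi> (witt_bracket (witt_graded.e i) (witt_graded.e j)) (witt_graded.e k)
     + \<psi> (witt_bracket (witt_graded.e i) (witt_graded.e k)) (witt_graded.e j)
     - \<psi> (witt_bracket (witt_graded.e j) (witt_graded.e k)) (witt_graded.e i)) (i + j + k) = 0"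
      unfolding witt.Z2_cocycle[OF \<psi>] by simp
    then show "of_int (j + k - i) * f j k - of_int (i + k - j) * f i k + of_int (i + j - k) * f i j
      - of_int (j - i) * f (i + j) k + of_int (k - i) * f (i + k) j - of_int (k - j) * f (j + k) i = 0"
      unfolding witt_bracket_single \<psi>s
      by (simp add: lookup_add lookup_minus lookup_single add_ac) (simp add: algebra_simps)
  qed
  then obtain \<phi> where \<phi>: "\<And>i j. f i j = of_int (j - i) * (\<phi> j + \<phi> i - \<phi> (i + j))"
    by (rule witt_coefficient_cocycle_coboundary) blast
  let ?\<phi> = "linear_extension (\<lambda>i. Poly_Mapping.single i (\<phi> i))"
  have \<phi>C: "?\<phi> \<in> witt.C1" by (rule witt_graded.linear_extension_in_C1)
  have "\<psi> = witt.d1 ?\<phi>"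
  proof (rule witt_graded.C2_eqI[OF C2 witt.d1_in_C2[OF \<phi>C]])
    fix i j
    show "\<psi> (witt_graded.e i) (witt_graded.e j) = witt.d1 ?\<phi> (witt_graded.e i) (witt_graded.e j)"
      by (rule poly_mapping_eqI)
        (simp add: witt.d1_def \<psi>f \<phi> linear_extension_single pm_scale_single witt_bracket_single
          lookup_minus lookup_single when_def add.commute[of j i], simp add: algebra_simps)
  qed
  with \<phi>C show "\<psi> \<in> witt.B2" unfolding witt.B2_def by blast
qed

section \<open>The second cohomology of the Virasoro algebra\<close>

lemma virasoro_bracket_single:
  "virasoro_bracket (Poly_Mapping.single (L n) a) (Poly_Mapping.single (L m) b) =
   Poly_Mapping.single (L (n + m)) (a * b * of_int (m - n)) +
   Poly_Mapping.single Central (if n + m = 0 then a * b * of_int (m ^ 3 - m) / 12 else 0)"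
proof -
  have "pm_scale c (f + g) = pm_scale c f + pm_scale c g" for c :: complex and f g :: "virasoro_index \<Rightarrow>\<^sub>0 complex"
    by (rule poly_mapping_eqI) (simp add: lookup_pm_scale lookup_add algebra_simps)
  moreover have "n = - m \<longleftrightarrow> n + m = 0" by auto
  ultimately show ?thesis
    unfolding virasoro_bracket_def bilinear_extension_single virasoro_basis_bracket.simps
    by (simp add: pm_scale_single)
qed

lemma virasoro_bracket_central [simp]:
  "virasoro_bracket (Poly_Mapping.single Central a) f = 0"
  "virasoro_bracket f (Poly_Mapping.single Central a) = 0"
proof -
  show *: "virasoro_bracket (Poly_Mapping.single Central a) f = 0" for f
    by (simp add: virasoro_bracket_def bilinear_extension_def)
  show "virasoro_bracket f (Poly_Mapping.single Central a) = 0"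
    using *[of f] virasoro.bracket_anti[of f "Poly_Mapping.single Central a"] by simp
qed

primrec virasoro_degree :: "virasoro_index \<Rightarrow> int"
  where "virasoro_degree (L n) = n" | "virasoro_degree Central = 0"

interpretation virasoro_graded: graded_lie_algebra virasoro_bracket virasoro_degree "Poly_Mapping.single (L 0) 1"
proof
  fix i
  show "virasoro_bracket (Poly_Mapping.single (L 0) 1) (Poly_Mapping.single i 1) =
    pm_scale (of_int (virasoro_degree i)) (Poly_Mapping.single i 1)"
    by (cases i) (simp_all add: virasoro_bracket_single pm_scale_single)
qed

abbreviation virasoro_l :: "int \<Rightarrow> (virasoro_index \<Rightarrow>\<^sub>0 complex)"
  where "virasoro_l n \<equiv> Poly_Mapping.single (L n) 1"

abbreviation virasoro_c :: "virasoro_index \<Rightarrow>\<^sub>0 complex"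
  where "virasoro_c \<equiv> Poly_Mapping.single Central 1"

lemma virasoro_C2_eqI:
  assumes \<psi>: "\<psi> \<in> virasoro.C2" and \<psi>': "\<psi>' \<in> virasoro.C2"
    and LL: "\<And>i j. \<psi> (virasoro_l i) (virasoro_l j) = \<psi>' (virasoro_l i) (virasoro_l j)"
    and LC: "\<And>i. \<psi> (virasoro_l i) virasoro_c = \<psi>' (virasoro_l i) virasoro_c"
  shows "\<psi> = \<psi>'"
proof (rule virasoro_graded.C2_eqI[OF \<psi> \<psi>'])
  fix i j
  show "\<psi> (Poly_Mapping.single i 1) (Poly_Mapping.single j 1) = \<psi>' (Poly_Mapping.single i 1) (Poly_Mapping.single j 1)"
  proof (cases i; cases j)
    fix n assume "i = Central" "j = L n"
    then show ?thesis
      using LC[of n] virasoro.C2_anti[OF \<psi>, of virasoro_c "virasoro_l n"]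
        virasoro.C2_anti[OF \<psi>', of virasoro_c "virasoro_l n"] by simp
  qed (simp_all add: LL LC virasoro.C2_self[OF \<psi>] virasoro.C2_self[OF \<psi>'])
qed

lemma virasoro_homogeneous_LC:
  assumes "\<psi> \<in> virasoro.C2" "virasoro.lie_derivative2 (virasoro_l 0) \<psi> = (\<lambda>x y. 0)"
  shows "\<psi> (virasoro_l i) virasoro_c =
    Poly_Mapping.single (L i) (Poly_Mapping.lookup (\<psi> (virasoro_l i) virasoro_c) (L i)) +
    Poly_Mapping.single Central (if i = 0 then Poly_Mapping.lookup (\<psi> (virasoro_l 0) virasoro_c) Central else 0)"
    (is "?l = ?r")
proof (rule poly_mapping_eqI)
  fix k
  show "Poly_Mapping.lookup ?l k = Poly_Mapping.lookup ?r k"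
    using virasoro_graded.homogeneous_lookup[OF assms, of k "L i" Central]
    by (cases k) (auto simp: lookup_add lookup_single when_def)
qed

lemma virasoro_homogeneous_LL:
  assumes "\<psi> \<in> virasoro.C2" "virasoro.lie_derivative2 (virasoro_l 0) \<psi> = (\<lambda>x y. 0)"
  shows "\<psi> (virasoro_l i) (virasoro_l j) =
    Poly_Mapping.single (L (i + j)) (Poly_Mapping.lookup (\<psi> (virasoro_l i) (virasoro_l j)) (L (i + j))) +
    Poly_Mapping.single Central (if i + j = 0 then Poly_Mapping.lookup (\<psi> (virasoro_l i) (virasoro_l j)) Central else 0)"
    (is "?l = ?r")
proof (rule poly_mapping_eqI)
  fix k
  show "Poly_Mapping.lookup ?l k = Poly_Mapping.lookup ?r k"
    using virasoro_graded.homogeneous_lookup[OF assms, of k "L i" "L j"]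
    by (cases k) (auto simp: lookup_add lookup_single when_def)
qed

text \<open>
  Derivations of degree zero: the bracket \<open>[l\<^sub>i, l\<^sub>j]\<close> has the coefficient \<open>j - i\<close>, so additivity is
  only known for \<open>i \<noteq> j\<close>.
\<close>

lemma additive_off_diagonal:
  fixes \<tau> :: "int \<Rightarrow> complex"
  assumes "\<And>i j. of_int (j - i) * (\<tau> i + \<tau> j - \<tau> (i + j)) = 0"
  shows "\<tau> n = of_int n * \<tau> 1"
proof -
  have add: "\<tau> (i + j) = \<tau> i + \<tau> j" if "i \<noteq> j" for i j
  proof -
    have "(of_int (j - i) :: complex) \<noteq> 0" using that unfolding of_int_eq_0_iff by simp
    then show ?thesis using assms[of j i] by simp
  qed
  have 0: "\<tau> 0 = 0" using add[of 0 1] by simp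
  have m1: "\<tau> (-1) = - \<tau> 1" using add[of 1 "-1"] 0 by (simp add: eq_neg_iff_add_eq_0 add.commute)
  have 2: "\<tau> 2 = 2 * \<tau> 1" using add[of 2 "-1"] m1 by (simp add: algebra_simps)
  have step: "\<tau> (i + 1) = \<tau> i + \<tau> 1" for i using add[of i 1] 2 by (cases "i = 1") simp_all
  show ?thesis
  proof (induction n rule: int_induct[of _ 0])
    case (step1 i) then show ?case using step[of i] by (simp add: algebra_simps)
  next
    case (step2 i) then show ?case using step[of "i - 1"] by (simp add: algebra_simps)
  qed (simp add: 0)
qed

text \<open>
  For a cocycle of degree zero, \<open>x \<mapsto> \<psi>(x, c)\<close> is a derivation of degree zero and turns out to be a
  multiple of the inner derivation by \<open>l\<^sub>0\<close>; in particular \<open>\<psi>(l\<^sub>0, c)\<close> has no central component.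
\<close>

lemma virasoro_central_argument:
  assumes \<psi>: "\<psi> \<in> virasoro.Z2" and hom: "virasoro.lie_derivative2 (virasoro_l 0) \<psi> = (\<lambda>x y. 0)"
  obtains t where "\<And>i. \<psi> (virasoro_l i) virasoro_c = Poly_Mapping.single (L i) (of_int i * t)"
proof -
  note C2 = virasoro.Z2_C2[OF \<psi>]
  define \<tau> where "\<tau> i = Poly_Mapping.lookup (\<psi> (virasoro_l i) virasoro_c) (L i)" for i
  define \<kappa> where "\<kappa> = Poly_Mapping.lookup (\<psi> (virasoro_l 0) virasoro_c) Central"
  have \<psi>c: "\<psi> (Poly_Mapping.single (L i) a) virasoro_c =
    Poly_Mapping.single (L i) (a * \<tau> i) + Poly_Mapping.single Central (if i = 0 then a * \<kappa> else 0)" for i a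
    unfolding virasoro_graded.C2_single(1)[OF C2, of "L i" a]
    by (subst virasoro_homogeneous_LC[OF C2 hom])
      (auto intro!: poly_mapping_eqI simp: lookup_add lookup_pm_scale lookup_single when_def \<tau>_def \<kappa>_def)
  have \<psi>cc: "\<psi> (Poly_Mapping.single Central a) virasoro_c = 0" for a
    unfolding virasoro_graded.C2_single(1)[OF C2, of _ a] by (simp add: virasoro.C2_self[OF C2])
  have coc: "virasoro_bracket (virasoro_l i) (\<psi> (virasoro_l j) virasoro_c)
    - virasoro_bracket (virasoro_l j) (\<psi> (virasoro_l i) virasoro_c)
    - \<psi> (virasoro_bracket (virasoro_l i) (virasoro_l j)) virasoro_c = 0" for i j
    using virasoro.Z2_cocycle[OF \<psi>, of "virasoro_l i" "virasoro_l j" virasoro_c]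
      virasoro.C2_scale_left[OF C2, of 0 0] by simp
  have coc': "Poly_Mapping.lookup (virasoro_bracket (virasoro_l i) (\<psi> (virasoro_l j) virasoro_c)
    - virasoro_bracket (virasoro_l j) (\<psi> (virasoro_l i) virasoro_c)
    - \<psi> (virasoro_bracket (virasoro_l i) (virasoro_l j)) virasoro_c) k = 0" for i j k
    unfolding coc by simp
  have "of_int (j - i) * (\<tau> i + \<tau> j - \<tau> (i + j)) = 0" for i j
    using coc'[of i j "L (i + j)"]
    by (simp add: \<psi>c \<psi>cc virasoro_bracket_single virasoro.bracket_add_right virasoro.C2_add_left[OF C2]
        lookup_add lookup_minus lookup_single add.commute[of j i] del: mult_eq_0_iff)
      (simp add: algebra_simps del: mult_eq_0_iff)
  then have \<tau>: "\<tau> i = of_int i * \<tau> 1" for i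
    by (rule additive_off_diagonal)
  have "\<kappa> = 0"
    using coc'[of 1 "-1" Central]
    by (simp add: \<psi>c \<psi>cc virasoro_bracket_single virasoro.bracket_add_right virasoro.C2_add_left[OF C2]
        lookup_add lookup_minus lookup_single)
  then show thesis
    using \<psi>c[of _ 1] by (intro that[of "\<tau> 1"]) (simp add: \<tau>[symmetric])
qed

text \<open>
  Once \<open>\<psi>\<close> vanishes on the centre, the central terms of the bracket do not contribute, and the
  coefficients of \<open>\<psi>\<close> along the \<open>l\<^sub>n\<close> form a Witt cocycle.
\<close>

lemma virasoro_cocycle_coefficients:
  assumes \<psi>: "\<psi> \<in> virasoro.Z2" and hom: "virasoro.lie_derivative2 (virasoro_l 0) \<psi> = (\<lambda>x y. 0)"
    and \<psi>c: "\<And>i. \<psi> (virasoro_l i) virasoro_c = 0"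
  shows "witt_coefficient_cocycle (\<lambda>i j. Poly_Mapping.lookup (\<psi> (virasoro_l i) (virasoro_l j)) (L (i + j)))"
    (is "witt_coefficient_cocycle ?f")
proof -
  note C2 = virasoro.Z2_C2[OF \<psi>]
  define f where "f = ?f"
  define \<chi> where "\<chi> i j = (if i + j = 0 then Poly_Mapping.lookup (\<psi> (virasoro_l i) (virasoro_l j)) Central else 0)" for i j
  have \<psi>s: "\<psi> (Poly_Mapping.single (L i) a) (virasoro_l j) =
    Poly_Mapping.single (L (i + j)) (a * f i j) + Poly_Mapping.single Central (a * \<chi> i j)" for i j a
    unfolding virasoro_graded.C2_single(1)[OF C2, of "L i" a]
    by (subst virasoro_homogeneous_LL[OF C2 hom])
      (auto intro!: poly_mapping_eqI simp: lookup_add lookup_pm_scale lookup_single when_def f_def \<chi>_def)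
  have \<psi>cs: "\<psi> (Poly_Mapping.single Central a) (virasoro_l j) = 0" for a j
    unfolding virasoro_graded.C2_single(1)[OF C2, of _ a]
    using virasoro.C2_anti[OF C2, of virasoro_c "virasoro_l j"] by (simp add: \<psi>c)
  have "witt_coefficient_cocycle f"
    unfolding witt_coefficient_cocycle_def
  proof (intro conjI allI)
    show "f j i = - f i j" for i j
      unfolding f_def by (subst virasoro.C2_anti[OF C2]) (simp add: add.commute)
    fix i j k
    have "Poly_Mapping.lookup
     (virasoro_bracket (virasoro_l i) (\<psi> (virasoro_l j) (virasoro_l k))
     - virasoro_bracket (virasoro_l j) (\<psi> (virasoro_l i) (virasoro_l k))
     + virasoro_bracket (virasoro_l k) (\<psi> (virasoro_l i) (virasoro_l j))
     - \<psi> (virasoro_bracket (virasoro_l i) (virasoro_l j)) (virasoro_l k)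
     + \<psi> (virasoro_bracket (virasoro_l i) (virasoro_l k)) (virasoro_l j)
     - \<psi> (virasoro_bracket (virasoro_l j) (virasoro_l k)) (virasoro_l i)) (L (i + j + k)) = 0"
      unfolding virasoro.Z2_cocycle[OF \<psi>] by simp
    then show "of_int (j + k - i) * f j k - of_int (i + k - j) * f i k + of_int (i + j - k) * f i j
      - of_int (j - i) * f (i + j) k + of_int (k - i) * f (i + k) j - of_int (k - j) * f (j + k) i = 0"
      unfolding virasoro_bracket_single \<psi>s \<psi>cs virasoro.bracket_add_right virasoro.C2_add_left[OF C2]
      by (simp add: lookup_add lookup_minus lookup_single add_ac) (simp add: algebra_simps)
  qed
  then show ?thesis by (simp add: f_def)
qed

text \<open>
  A scalar 2-cocycle of degree zero is determined by its values at \<open>1\<close> and \<open>2\<close>; the recurrence is the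
  cocycle condition for \<open>(l\<^sub>1, l\<^sub>j, l\<^sub>-\<^sub>j\<^sub>-\<^sub>1)\<close>.
\<close>

lemma virasoro_central_cocycle:
  assumes \<psi>: "\<psi> \<in> virasoro.Z2"
    and \<psi>c: "\<And>i. \<psi> (virasoro_l i) virasoro_c = 0"
    and \<psi>L: "\<And>i j. \<psi> (virasoro_l i) (virasoro_l j) =
      Poly_Mapping.single Central (if i + j = 0 then \<chi> i else 0)"
    and 1: "\<chi> 1 = 0" and 2: "\<chi> 2 = 0"
  shows "\<chi> i = 0"
proof -
  note C2 = virasoro.Z2_C2[OF \<psi>]
  have \<psi>s: "\<psi> (Poly_Mapping.single (L i) a) (virasoro_l j) =
    Poly_Mapping.single Central (if i + j = 0 then a * \<chi> i else 0)" for i j a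
    unfolding virasoro_graded.C2_single(1)[OF C2, of "L i" a] by (simp add: \<psi>L pm_scale_single)
  have \<psi>cs: "\<psi> (Poly_Mapping.single Central a) (virasoro_l j) = 0" for a j
    unfolding virasoro_graded.C2_single(1)[OF C2, of _ a]
    using virasoro.C2_anti[OF C2, of virasoro_c "virasoro_l j"] by (simp add: \<psi>c)
  have odd: "\<chi> (- i) = - \<chi> i" for i
  proof -
    have "Poly_Mapping.lookup (\<psi> (virasoro_l (- i)) (virasoro_l i)) Central =
      - Poly_Mapping.lookup (\<psi> (virasoro_l i) (virasoro_l (- i))) Central"
      by (subst virasoro.C2_anti[OF C2]) simp
    then show ?thesis by (simp add: \<psi>L)
  qed
  have step: "of_int (j - 1) * \<chi> (j + 1) = of_int (j + 2) * \<chi> j" for j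
  proof -
    have "Poly_Mapping.lookup
     (virasoro_bracket (virasoro_l 1) (\<psi> (virasoro_l j) (virasoro_l (- j - 1)))
     - virasoro_bracket (virasoro_l j) (\<psi> (virasoro_l 1) (virasoro_l (- j - 1)))
     + virasoro_bracket (virasoro_l (- j - 1)) (\<psi> (virasoro_l 1) (virasoro_l j))
     - \<psi> (virasoro_bracket (virasoro_l 1) (virasoro_l j)) (virasoro_l (- j - 1))
     + \<psi> (virasoro_bracket (virasoro_l 1) (virasoro_l (- j - 1))) (virasoro_l j)
     - \<psi> (virasoro_bracket (virasoro_l j) (virasoro_l (- j - 1))) (virasoro_l 1)) Central = 0"
      unfolding virasoro.Z2_cocycle[OF \<psi>] by simp
    then show ?thesis
      unfolding virasoro_bracket_single \<psi>s \<psi>cs \<psi>L virasoro.C2_add_left[OF C2] virasoro_bracket_central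
      using odd[of j] 1 odd[of 1]
      by (simp add: lookup_add lookup_minus lookup_single algebra_simps)
  qed
  have pos: "\<chi> j = 0" if "j \<ge> 2" for j
    using that
  proof (induction j rule: int_ge_induct)
    case (step j)
    have "of_int (j - 1) * \<chi> (j + 1) = 0" using \<open>\<And>j. of_int (j - 1) * \<chi> (j + 1) = _\<close>[of j] step by simp
    moreover have "(of_int (j - 1) :: complex) \<noteq> 0" using step unfolding of_int_eq_0_iff by simp
    ultimately show ?case by (metis mult_eq_0_iff)
  qed (rule 2)
  have 0: "\<chi> 0 = 0" using step[of 0] 1 by simp
  consider "i \<ge> 2" | "i = 1" | "i = 0" | "i = -1" | "- i \<ge> 2" by linarith
  then show ?thesis using pos 0 1 odd[of 1] pos[of "- i"] odd[of i] by cases auto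
qed

lemma virasoro_d1_LC_zero:
  assumes "\<phi> virasoro_c = Poly_Mapping.single Central a" "\<phi> \<in> virasoro.C1"
  shows "virasoro.d1 \<phi> (virasoro_l i) virasoro_c = 0"
  using assms by (simp add: virasoro.d1_def virasoro.C1_zero)

theorem virasoro_H2_vanishes: "virasoro.H2_vanishes"
proof (rule virasoro_graded.H2_vanishes_if_homogeneous)
  fix \<psi> assume \<psi>: "\<psi> \<in> virasoro.Z2"
    and hom: "virasoro.lie_derivative2 (virasoro_l 0) \<psi> = (\<lambda>x y. 0)"
  obtain t where t: "\<And>i. \<psi> (virasoro_l i) virasoro_c = Poly_Mapping.single (L i) (of_int i * t)"
    by (rule virasoro_central_argument[OF \<psi> hom]) blast
  \<comment> \<open>Make \<open>\<psi>\<close> vanish on the centre, by the coboundary of \<open>c \<mapsto> -t l\<^sub>0\<close>.\<close>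
  define v1 where "v1 k = (case k of L _ \<Rightarrow> 0 | Central \<Rightarrow> Poly_Mapping.single (L 0) (- t))" for k
  define \<phi>1 where "\<phi>1 = linear_extension v1"
  define \<psi>1 where "\<psi>1 x y = \<psi> x y - virasoro.d1 \<phi>1 x y" for x y
  have \<phi>1: "\<phi>1 \<in> virasoro.C1" unfolding \<phi>1_def by (rule virasoro_graded.linear_extension_in_C1)
  have \<psi>1: "\<psi>1 \<in> virasoro.Z2" unfolding \<psi>1_def[abs_def] by (rule virasoro.Z2_minus_d1[OF \<psi> \<phi>1])
  have hom1: "virasoro.lie_derivative2 (virasoro_l 0) \<psi>1 = (\<lambda>x y. 0)"
    unfolding \<psi>1_def[abs_def]
    by (rule virasoro_graded.homogeneous_diff_d1[OF hom \<phi>1], unfold \<phi>1_def,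
        rule virasoro_graded.homogeneous_linear_extension)
      (auto simp: v1_def lookup_single when_def split: virasoro_index.splits)
  have \<psi>1c: "\<psi>1 (virasoro_l i) virasoro_c = 0" for i
    by (rule poly_mapping_eqI)
      (simp add: \<psi>1_def virasoro.d1_def t virasoro.C1_zero[OF \<phi>1] lookup_minus lookup_add,
       simp add: \<phi>1_def linear_extension_single v1_def virasoro_bracket_single pm_scale_single
        lookup_add lookup_single mult.commute)
  \<comment> \<open>Remove the components along the \<open>l\<^sub>n\<close>, which form a Witt coboundary.\<close>
  obtain p where p: "\<And>i j. Poly_Mapping.lookup (\<psi>1 (virasoro_l i) (virasoro_l j)) (L (i + j)) =
      of_int (j - i) * (p j + p i - p (i + j))"
    by (rule witt_coefficient_cocycle_coboundary[OF virasoro_cocycle_coefficients[OF \<psi>1 hom1 \<psi>1c]]) blast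
  define v2 where "v2 k = (case k of L n \<Rightarrow> Poly_Mapping.single (L n) (p n) | Central \<Rightarrow> 0)" for k
  define \<phi>2 where "\<phi>2 = linear_extension v2"
  define \<psi>2 where "\<psi>2 x y = \<psi>1 x y - virasoro.d1 \<phi>2 x y" for x y
  have \<phi>2: "\<phi>2 \<in> virasoro.C1" unfolding \<phi>2_def by (rule virasoro_graded.linear_extension_in_C1)
  have \<psi>2: "\<psi>2 \<in> virasoro.Z2" unfolding \<psi>2_def[abs_def] by (rule virasoro.Z2_minus_d1[OF \<psi>1 \<phi>2])
  have hom2: "virasoro.lie_derivative2 (virasoro_l 0) \<psi>2 = (\<lambda>x y. 0)"
    unfolding \<psi>2_def[abs_def]
    by (rule virasoro_graded.homogeneous_diff_d1[OF hom1 \<phi>2], unfold \<phi>2_def,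
        rule virasoro_graded.homogeneous_linear_extension)
      (auto simp: v2_def lookup_single when_def split: virasoro_index.splits)
  have \<phi>2c: "\<phi>2 (Poly_Mapping.single Central a) = 0" for a
    by (simp add: \<phi>2_def linear_extension_single v2_def)
  have \<phi>2L: "\<phi>2 (Poly_Mapping.single (L n) a) = Poly_Mapping.single (L n) (a * p n)" for n a
    by (simp add: \<phi>2_def linear_extension_single v2_def pm_scale_single)
  have \<psi>2c: "\<psi>2 (virasoro_l i) virasoro_c = 0" for i
    using virasoro_d1_LC_zero[of \<phi>2 0 i] by (simp add: \<psi>2_def \<psi>1c \<phi>2 \<phi>2c)
  define \<chi> where "\<chi> i = Poly_Mapping.lookup (\<psi>2 (virasoro_l i) (virasoro_l (- i))) Central" for i
  have \<psi>2L: "\<psi>2 (virasoro_l i) (virasoro_l j) = Poly_Mapping.single Central (if i + j = 0 then \<chi> i else 0)" for i j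
  proof -
    have "Poly_Mapping.lookup (\<psi>2 (virasoro_l i) (virasoro_l j)) (L (i + j)) = 0"
      by (simp add: \<psi>2_def virasoro.d1_def lookup_minus p \<phi>2L \<phi>2c virasoro.C1_add[OF \<phi>2]
          virasoro_bracket_single lookup_add lookup_single add.commute[of j i]) (simp add: algebra_simps)
    moreover have "\<chi> i = Poly_Mapping.lookup (\<psi>2 (virasoro_l i) (virasoro_l j)) Central" if "i + j = 0"
    proof -
      have "- i = j" using that by simp
      then show ?thesis by (simp add: \<chi>_def)
    qed
    ultimately show ?thesis
      using virasoro_homogeneous_LL[OF virasoro.Z2_C2[OF \<psi>2] hom2, of i j] by auto
  qed
  \<comment> \<open>Remove the central component.  The coboundary of \<open>l\<^sub>0 \<mapsto> \<mu> c\<close>, \<open>c \<mapsto> \<nu> c\<close> takes at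
      \<open>(l\<^sub>i, l\<^sub>-\<^sub>i)\<close> the value \<open>2 i \<mu> + (i\<^sup>3 - i) \<nu> / 12\<close>; \<open>\<mu>\<close> and \<open>\<nu>\<close> are fitted at \<open>i = 1\<close> and \<open>i = 2\<close>.\<close>
  define \<mu> where "\<mu> = \<chi> 1 / 2"
  define \<nu> where "\<nu> = 2 * (\<chi> 2 - 2 * \<chi> 1)"
  define v3 where "v3 k = (case k of L n \<Rightarrow> Poly_Mapping.single Central (if n = 0 then \<mu> else 0)
    | Central \<Rightarrow> Poly_Mapping.single Central \<nu>)" for k
  define \<phi>3 where "\<phi>3 = linear_extension v3"
  define \<psi>3 where "\<psi>3 x y = \<psi>2 x y - virasoro.d1 \<phi>3 x y" for x y
  have \<phi>3: "\<phi>3 \<in> virasoro.C1" unfolding \<phi>3_def by (rule virasoro_graded.linear_extension_in_C1)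
  have \<psi>3: "\<psi>3 \<in> virasoro.Z2" unfolding \<psi>3_def[abs_def] by (rule virasoro.Z2_minus_d1[OF \<psi>2 \<phi>3])
  have \<phi>3c: "\<phi>3 (Poly_Mapping.single Central a) = Poly_Mapping.single Central (a * \<nu>)" for a
    by (simp add: \<phi>3_def linear_extension_single v3_def pm_scale_single)
  have \<phi>3L: "\<phi>3 (Poly_Mapping.single (L n) a) = Poly_Mapping.single Central (if n = 0 then a * \<mu> else 0)" for n a
    by (simp add: \<phi>3_def linear_extension_single v3_def pm_scale_single)
  have \<psi>3c: "\<psi>3 (virasoro_l i) virasoro_c = 0" for i
    using virasoro_d1_LC_zero[of \<phi>3 \<nu> i] by (simp add: \<psi>3_def \<psi>2c \<phi>3 \<phi>3c)
  define \<chi>' where "\<chi>' i = \<chi> i - (2 * of_int i * \<mu> + of_int (i ^ 3 - i) / 12 * \<nu>)" for i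
  have \<psi>3L: "\<psi>3 (virasoro_l i) (virasoro_l j) = Poly_Mapping.single Central (if i + j = 0 then \<chi>' i else 0)" for i j
  proof (cases "i + j = 0")
    case True
    then have j: "j = - i" by simp
    show ?thesis unfolding j
      by (rule poly_mapping_eqI)
        (simp add: \<psi>3_def virasoro.d1_def \<psi>2L \<phi>3L \<phi>3c virasoro.C1_add[OF \<phi>3]
          virasoro_bracket_single lookup_add lookup_minus lookup_single when_def \<chi>'_def field_simps)
  next
    case False
    then show ?thesis
      by (simp add: \<psi>3_def virasoro.d1_def \<psi>2L \<phi>3L \<phi>3c virasoro.C1_add[OF \<phi>3]
          virasoro_bracket_single)
  qed
  have "\<chi>' i = 0" for i
    by (rule virasoro_central_cocycle[OF \<psi>3 \<psi>3c \<psi>3L]) (simp_all add: \<chi>'_def \<mu>_def \<nu>_def field_simps)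
  then have "\<psi>3 = (\<lambda>x y. 0)"
    by (intro virasoro_C2_eqI virasoro.Z2_C2[OF \<psi>3]) (simp_all add: virasoro.C2_iff \<psi>3c \<psi>3L)
  then have "\<psi>3 \<in> virasoro.B2" using virasoro.zero_in_B2 by simp
  then have "\<psi>2 \<in> virasoro.B2"
    unfolding \<psi>3_def[abs_def] using \<phi>3 by (rule virasoro.B2_if_difference_in_B2)
  then have "\<psi>1 \<in> virasoro.B2"
    unfolding \<psi>2_def[abs_def] using \<phi>2 by (rule virasoro.B2_if_difference_in_B2)
  then show "\<psi> \<in> virasoro.B2"
    unfolding \<psi>1_def[abs_def] using \<phi>1 by (rule virasoro.B2_if_difference_in_B2)
qed

section \<open>Powers of the maximal ideal and the continuous dual\<close>

text \<open>
  If \<open>V\<close> is spanned modulo \<open>U\<close> by finitely many elements, then every element of \<open>V\<close> is recovered modulo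
  \<open>U\<close> from finitely many coordinates, given by linear functionals on the whole space that vanish on \<open>U\<close>.
\<close>

lemma (in vector_space) finite_coordinates_modulo_subspace:
  assumes U: "subspace U" and UV: "U \<subseteq> V" and B: "finite B" "B \<subseteq> V" "V \<subseteq> span (B \<union> U)"
  obtains C \<gamma> where "finite C" "C \<subseteq> V" "\<And>c. Vector_Spaces.linear scale (*) (\<gamma> c)"
    "\<And>c a. c \<in> C \<Longrightarrow> a \<in> U \<Longrightarrow> \<gamma> c a = 0"
    "\<And>a. a \<in> V \<Longrightarrow> a - (\<Sum>c\<in>C. scale (\<gamma> c a) c) \<in> U"
proof -
  obtain B0 where B0: "B0 \<subseteq> U" "independent B0" "U \<subseteq> span B0"
    by (rule basis_exists)
  have sB0: "span B0 = U" using B0 U by (metis span_minimal subset_antisym)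
  obtain B1 where B1: "B0 \<subseteq> B1" "B1 \<subseteq> B0 \<union> B" "independent B1" "B0 \<union> B \<subseteq> span B1"
    by (rule maximal_independent_subset_extend[of B0 "B0 \<union> B"]) (use B0 in auto)
  define E where "E = extend_basis B1"
  have E: "B1 \<subseteq> E" "independent E" "span E = UNIV"
    using extend_basis_superset[OF B1(3)] independent_extend_basis[OF B1(3)] span_extend_basis[OF B1(3)]
    by (simp_all add: E_def)
  define C where "C = B1 - B0"
  have "U \<subseteq> span B1" using B0(3) span_mono[OF B1(1)] by blast
  then have VB1: "V \<subseteq> span B1"
    using B(3) B1(4) span_minimal[OF _ subspace_span, of "B \<union> U" B1] by blast
  show thesis
  proof (rule that)
    show "finite C" using B(1) B1(2) by (auto simp: C_def intro: finite_subset)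
    show "C \<subseteq> V" using B1(2) B(2) by (auto simp: C_def)
    show "Vector_Spaces.linear scale (*) (\<lambda>a. representation E a c)" for c
      by (rule linear_representation[OF E(2,3)])
    show "representation E a c = 0" if "c \<in> C" "a \<in> U" for c a
    proof -
      have "representation E a = representation B0 a"
        using that(2) sB0 B1(1) E(1) by (intro representation_extend[OF E(2)]) auto
      then show ?thesis using that(1) representation_ne_zero[of B0 a c] by (auto simp: C_def)
    qed
    show "a - (\<Sum>c\<in>C. scale (representation E a c) c) \<in> U" if "a \<in> V" for a
    proof -
      let ?R = "representation E a"
      have R: "?R = representation B1 a"
        using that VB1 by (intro representation_extend[OF E(2) _ E(1)]) auto
      have fin: "finite {b. ?R b \<noteq> 0}" by (rule finite_representation)
      have sub: "{b. ?R b \<noteq> 0} \<subseteq> B1" unfolding R using representation_ne_zero by blast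
      have "a = (\<Sum>b | ?R b \<noteq> 0. scale (?R b) b)"
        using sum_nonzero_representation_eq[OF E(2), of a] E(3) by simp
      also have "\<dots> = (\<Sum>b\<in>{b. ?R b \<noteq> 0} \<inter> B0. scale (?R b) b) + (\<Sum>b\<in>{b. ?R b \<noteq> 0} - B0. scale (?R b) b)"
        by (subst sum.Int_Diff[OF fin, of _ B0]) simp
      also have "(\<Sum>b\<in>{b. ?R b \<noteq> 0} - B0. scale (?R b) b) = (\<Sum>c\<in>C. scale (?R c) c)"
        using sub \<open>finite C\<close> by (intro sum.mono_neutral_left) (auto simp: C_def)
      finally have "a - (\<Sum>c\<in>C. scale (?R c) c) = (\<Sum>b\<in>{b. ?R b \<noteq> 0} \<inter> B0. scale (?R b) b)"
        by (rule diff_eq_eq[THEN iffD2])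
      also have "\<dots> \<in> U"
        using B0(1) U by (intro subspace_sum subspace_scale) auto
      finally show ?thesis .
    qed
  qed
qed

lemma module_mult: "module ((*) :: 'a::comm_ring_1 \<Rightarrow> 'a \<Rightarrow> 'a)"
  by unfold_locales (auto simp: algebra_simps)

context complete_local_algebra
begin

interpretation ideal: module "(*) :: 'a \<Rightarrow> 'a \<Rightarrow> 'a"
  by (rule module_mult)

lemma is_ideal_m: "is_ideal m"
  using local[of m] by (simp add: is_maximal_ideal_def)

lemma is_ideal_power: "is_ideal (ideal_power m n)"
  by (cases n) simp_all

lemma ideal_power_zero: "0 \<in> ideal_power m n"
  and ideal_power_add: "a \<in> ideal_power m n \<Longrightarrow> b \<in> ideal_power m n \<Longrightarrow> a + b \<in> ideal_power m n"
  and ideal_power_mult_left: "a \<in> ideal_power m n \<Longrightarrow> r * a \<in> ideal_power m n"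
  using is_ideal_power[of n]
  by (auto intro: ideal.subspace_0 ideal.subspace_add ideal.subspace_scale)

lemma ideal_power_mult_right: "a \<in> ideal_power m n \<Longrightarrow> a * r \<in> ideal_power m n"
  using ideal_power_mult_left[of a n r] by (simp add: mult.commute)

lemma ideal_power_Suc_subset: "ideal_power m (Suc n) \<subseteq> ideal_power m n"
  unfolding ideal_power.simps
  by (rule ideal.span_minimal) (auto intro: ideal_power_mult_left is_ideal_power)

lemma ideal_power_antimono: "n \<le> p \<Longrightarrow> ideal_power m p \<subseteq> ideal_power m n"
  by (induction p rule: dec_induct) (use ideal_power_Suc_subset in auto)

lemma ideal_power_one: "ideal_power m 1 = m"
proof -
  have "{a * b | a b. a \<in> m \<and> b \<in> (UNIV :: 'a set)} = m"
    using ideal.subspace_scale[OF is_ideal_m] by (auto simp: mult.commute) (metis mult.right_neutral)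
  then show ?thesis using is_ideal_m by (simp add: ideal.span_eq_iff)
qed

lemma ideal_power_mult:
  assumes "a \<in> ideal_power m p" "b \<in> ideal_power m n"
  shows "a * b \<in> ideal_power m (p + n)"
  using assms(1)
proof (induction p arbitrary: a)
  case 0
  then show ?case using assms(2) by (simp add: ideal_power_mult_left)
next
  case (Suc p)
  define T where "T = {a. a * b \<in> ideal_power m (Suc p + n)}"
  have "is_ideal T"
    unfolding ideal.subspace_def
  proof (intro conjI ballI allI)
    show "0 \<in> T" by (simp only: T_def mem_Collect_eq mult_zero_left ideal_power_zero)
    show "x + y \<in> T" if "x \<in> T" "y \<in> T" for x y
      using that unfolding T_def mem_Collect_eq distrib_right by (rule ideal_power_add)
    show "c * x \<in> T" if "x \<in> T" for c x
      using that unfolding T_def mem_Collect_eq mult.assoc by (rule ideal_power_mult_left)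
  qed
  moreover have "x * y \<in> T" if "x \<in> m" "y \<in> ideal_power m p" for x y
    unfolding T_def mem_Collect_eq add_Suc ideal_power.simps(2)[of m "p + n"] mult.assoc
    using that Suc.IH by (intro ideal.span_base) blast
  ultimately have "ideal_power m (Suc p) \<subseteq> T"
    unfolding ideal_power.simps(2)[of m p] by (intro ideal.span_minimal) blast
  then show ?case using Suc.prems unfolding T_def by blast
qed

lemma scale_eq_mult: "scale c a = scale c 1 * a"
  using scale_mult[of c 1 a] by simp

lemma mult_scale: "a * scale c b = scale c (a * b)"
  by (metis scale_mult mult.commute)

lemma subspace_ideal_power: "subspace (ideal_power m n)"
  unfolding subspace_def
proof (intro conjI ballI allI)
  show "scale c a \<in> ideal_power m n" if "a \<in> ideal_power m n" for c a
    unfolding scale_eq_mult[of c a] using that by (rule ideal_power_mult_left)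
qed (auto intro: ideal_power_zero ideal_power_add)

lemma finite_codimension: "\<exists>B. finite B \<and> UNIV \<subseteq> span (B \<union> ideal_power m n)"
proof (induction n)
  case 0
  show ?case by (intro exI[of _ "{}"]) (auto intro: span_base)
next
  case (Suc n)
  then obtain B where B: "finite B" "UNIV \<subseteq> span (B \<union> ideal_power m n)" by blast
  obtain B' where B': "finite B'" "ideal_power m n \<subseteq> span (B' \<union> ideal_power m (Suc n))"
    using finite_dim[of n] by blast
  let ?S = "(B \<union> B') \<union> ideal_power m (Suc n)"
  have "ideal_power m n \<subseteq> span ?S"
    using B'(2) span_mono[of "B' \<union> ideal_power m (Suc n)" ?S] by blast
  then have "B \<union> ideal_power m n \<subseteq> span ?S" using span_superset[of ?S] by blast
  then have "span (B \<union> ideal_power m n) \<subseteq> span ?S" by (rule span_minimal) (rule subspace_span)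
  then show ?case using B B' by (intro exI[of _ "B \<union> B'"]) auto
qed

text \<open>
  \<open>dual n\<close> is the annihilator of \<open>m^n\<close>, that is, the dual space of \<open>A/m^n\<close>.  The union over all \<open>n\<close> is
  the continuous dual of \<open>A\<close> for the \<open>m\<close>-adic topology.
\<close>

definition dual :: "nat \<Rightarrow> ('a \<Rightarrow> 'k) set"
  where "dual n = {\<beta>. Vector_Spaces.linear scale (*) \<beta> \<and> (\<forall>a\<in>ideal_power m n. \<beta> a = 0)}"

definition continuous_dual :: "('a \<Rightarrow> 'k) set"
  where "continuous_dual = (\<Union>n. dual n)"

lemma vector_space_field: "vector_space ((*) :: 'k \<Rightarrow> 'k \<Rightarrow> 'k)"
  by unfold_locales (auto simp: algebra_simps)

lemma dual_iff: "\<beta> \<in> dual n \<longleftrightarrow> (\<forall>a b. \<beta> (a + b) = \<beta> a + \<beta> b) \<and> (\<forall>c a. \<beta> (scale c a) = c * \<beta> a) \<and>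
   (\<forall>a\<in>ideal_power m n. \<beta> a = 0)"
  by (auto simp: dual_def Vector_Spaces.linear_iff vector_space_axioms vector_space_field)

lemma dual_add: "\<beta> \<in> dual n \<Longrightarrow> \<beta> (a + b) = \<beta> a + \<beta> b"
  and dual_scale: "\<beta> \<in> dual n \<Longrightarrow> \<beta> (scale c a) = c * \<beta> a"
  and dual_vanish: "\<beta> \<in> dual n \<Longrightarrow> a \<in> ideal_power m n \<Longrightarrow> \<beta> a = 0"
  by (simp_all add: dual_iff)

lemma dual_zero_arg: "\<beta> \<in> dual n \<Longrightarrow> \<beta> 0 = 0"
  using dual_vanish ideal_power_zero by blast

lemma dual_diff: "\<beta> \<in> dual n \<Longrightarrow> \<beta> (a - b) = \<beta> a - \<beta> b"
  using dual_add[of \<beta> n "a - b" b] by (simp add: algebra_simps)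

lemma dual_sum: "\<beta> \<in> dual n \<Longrightarrow> \<beta> (sum f I) = (\<Sum>i\<in>I. \<beta> (f i))"
  by (induction I rule: infinite_finite_induct) (simp_all add: dual_zero_arg dual_add)

lemma dual_mono: "n \<le> p \<Longrightarrow> dual n \<subseteq> dual p"
  using ideal_power_antimono[of n p] unfolding dual_def by blast

lemma dual_0: "dual 0 = {0}"
  by (auto simp: dual_iff fun_eq_iff)

lemma zero_in_dual: "0 \<in> dual n"
  by (simp add: dual_iff)

lemma add_in_dual: "\<beta> \<in> dual n \<Longrightarrow> \<beta>' \<in> dual n \<Longrightarrow> \<beta> + \<beta>' \<in> dual n"
  by (simp add: dual_iff algebra_simps)

lemma scale_in_dual: "\<beta> \<in> dual n \<Longrightarrow> (\<lambda>a. c * \<beta> a) \<in> dual n"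
  by (simp add: dual_iff algebra_simps)

lemma sum_in_dual: "(\<And>i. i \<in> I \<Longrightarrow> \<beta> i \<in> dual n) \<Longrightarrow> (\<lambda>a. \<Sum>i\<in>I. c i * \<beta> i a) \<in> dual n"
  by (simp add: dual_iff distrib_left sum.distrib sum_distrib_left mult.left_commute)

lemma shift_in_dual: "g \<in> ideal_power m p \<Longrightarrow> \<beta> \<in> dual (p + n) \<Longrightarrow> (\<lambda>b. \<beta> (g * b)) \<in> dual n"
  using ideal_power_mult[of g p] by (simp add: dual_iff distrib_left mult_scale)

lemma shift_in_dual_same: "\<beta> \<in> dual n \<Longrightarrow> (\<lambda>b. \<beta> (a * b)) \<in> dual n"
  using shift_in_dual[of a 0 \<beta> n] by simp

lemma continuous_dualI: "\<beta> \<in> dual n \<Longrightarrow> \<beta> \<in> continuous_dual"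
  by (auto simp: continuous_dual_def)

lemma continuous_dualE:
  assumes "\<beta> \<in> continuous_dual"
  obtains n where "\<And>p. n \<le> p \<Longrightarrow> \<beta> \<in> dual p"
  using assms dual_mono by (auto simp: continuous_dual_def)

lemma continuous_dualE2:
  assumes "\<beta> \<in> continuous_dual" "\<beta>' \<in> continuous_dual"
  obtains n where "\<beta> \<in> dual n" "\<beta>' \<in> dual n"
  using assms by (meson continuous_dualE max.cobounded1 max.cobounded2)

lemma zero_in_continuous_dual: "0 \<in> continuous_dual"
  using zero_in_dual by (rule continuous_dualI)

lemma add_in_continuous_dual:
  "\<beta> \<in> continuous_dual \<Longrightarrow> \<beta>' \<in> continuous_dual \<Longrightarrow> \<beta> + \<beta>' \<in> continuous_dual"
  by (meson continuous_dualE2 add_in_dual continuous_dualI)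

lemma scale_in_continuous_dual: "\<beta> \<in> continuous_dual \<Longrightarrow> (\<lambda>a. c * \<beta> a) \<in> continuous_dual"
  by (auto simp: continuous_dual_def intro: scale_in_dual)

lemma shift_in_continuous_dual: "\<beta> \<in> continuous_dual \<Longrightarrow> (\<lambda>b. \<beta> (a * b)) \<in> continuous_dual"
  by (auto simp: continuous_dual_def intro: shift_in_dual_same)

lemma eps_in_dual: "eps \<in> dual 1"
  using eps_linear eps_kernel unfolding dual_def ideal_power_one by auto

lemma dual_1_eps: assumes "\<beta> \<in> dual 1" shows "\<beta> = (\<lambda>a. \<beta> 1 * eps a)"
proof
  fix a
  have "eps (a - scale (eps a) 1) = 0"
    using dual_diff[OF eps_in_dual] dual_scale[OF eps_in_dual] by (simp add: eps_one)
  then have "\<beta> (a - scale (eps a) 1) = 0"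
    using dual_vanish[OF assms] unfolding ideal_power_one eps_kernel by blast
  then show "\<beta> a = \<beta> 1 * eps a"
    using dual_diff[OF assms] dual_scale[OF assms] by (simp add: mult.commute)
qed

text \<open>
  A finite family \<open>C\<close> in \<open>A\<close> with coordinate functionals that reconstruct every element modulo \<open>m^n\<close>.
  Independence of \<open>C\<close> modulo \<open>m^n\<close> is never used and not required.
\<close>

definition is_frame :: "nat \<Rightarrow> 'a set \<Rightarrow> ('a \<Rightarrow> 'a \<Rightarrow> 'k) \<Rightarrow> bool"
  where "is_frame n C \<gamma> \<longleftrightarrow> finite C \<and> (\<forall>c\<in>C. \<gamma> c \<in> dual n) \<and>
    (\<forall>a. a - (\<Sum>c\<in>C. scale (\<gamma> c a) c) \<in> ideal_power m n)"

lemma frame_exists: "\<exists>C \<gamma>. is_frame n C \<gamma>"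
proof -
  obtain B where B: "finite B" "UNIV \<subseteq> span (B \<union> ideal_power m n)" using finite_codimension by blast
  obtain C \<gamma> where "finite C" "\<And>c. Vector_Spaces.linear scale (*) (\<gamma> c)"
    "\<And>c a. c \<in> C \<Longrightarrow> a \<in> ideal_power m n \<Longrightarrow> \<gamma> c a = 0"
    "\<And>a. a \<in> UNIV \<Longrightarrow> a - (\<Sum>c\<in>C. scale (\<gamma> c a) c) \<in> ideal_power m n"
    by (rule finite_coordinates_modulo_subspace[OF subspace_ideal_power[of n] subset_UNIV B(1) subset_UNIV B(2)]) blast
  then have "is_frame n C \<gamma>" by (simp add: is_frame_def dual_def)
  then show ?thesis by blast
qed

lemma frame_expand:
  assumes "is_frame n C \<gamma>" "\<beta> \<in> dual n"
  shows "\<beta> = (\<lambda>a. \<Sum>c\<in>C. \<beta> c * \<gamma> c a)"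
proof
  fix a
  have "\<beta> (a - (\<Sum>c\<in>C. scale (\<gamma> c a) c)) = 0"
    using assms dual_vanish by (auto simp: is_frame_def)
  then show "\<beta> a = (\<Sum>c\<in>C. \<beta> c * \<gamma> c a)"
    by (simp add: dual_diff[OF assms(2)] dual_sum[OF assms(2)] dual_scale[OF assms(2)] mult.commute)
qed

text \<open>
  The analogous coordinates for \<open>m^n/m^{n+1}\<close>; the functionals are defined on all of \<open>A\<close>.
\<close>

lemma graded_frame_exists:
  obtains C \<gamma> where "finite C" "C \<subseteq> ideal_power m n" "\<And>c. c \<in> C \<Longrightarrow> \<gamma> c \<in> dual (Suc n)"
    "\<And>a. a \<in> ideal_power m n \<Longrightarrow> a - (\<Sum>c\<in>C. scale (\<gamma> c a) c) \<in> ideal_power m (Suc n)"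
proof -
  obtain B where B: "finite B" "B \<subseteq> ideal_power m n" "ideal_power m n \<subseteq> span (B \<union> ideal_power m (Suc n))"
    using finite_dim[of n] by blast
  show thesis
    by (rule finite_coordinates_modulo_subspace[OF subspace_ideal_power ideal_power_Suc_subset B])
      (rule that, auto simp: dual_def)
qed

lemma graded_frame_expand:
  assumes fin: "finite C" and C: "C \<subseteq> ideal_power m n" and \<gamma>: "\<And>c. c \<in> C \<Longrightarrow> \<gamma> c \<in> dual (Suc n)"
    and frame: "\<And>a. a \<in> ideal_power m n \<Longrightarrow> a - (\<Sum>c\<in>C. scale (\<gamma> c a) c) \<in> ideal_power m (Suc n)"
    and \<beta>: "\<beta> \<in> dual (Suc n)"
  shows "\<beta> - (\<lambda>a. \<Sum>c\<in>C. \<beta> c * \<gamma> c a) \<in> dual n"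
proof -
  have s: "(\<lambda>a. \<Sum>c\<in>C. \<beta> c * \<gamma> c a) \<in> dual (Suc n)"
    by (rule sum_in_dual) (rule \<gamma>)
  have "\<beta> a = (\<Sum>c\<in>C. \<beta> c * \<gamma> c a)" if "a \<in> ideal_power m n" for a
  proof -
    have "\<beta> (a - (\<Sum>c\<in>C. scale (\<gamma> c a) c)) = 0"
      using frame[OF that] \<beta> by (rule dual_vanish[rotated])
    then show ?thesis
      by (simp add: dual_diff[OF \<beta>] dual_sum[OF \<beta>] dual_scale[OF \<beta>] mult.commute)
  qed
  then show ?thesis using \<beta> s
    by (auto simp: dual_iff minus_apply right_diff_distrib)
qed

text \<open>
  Generators of \<open>m^n\<close> modulo \<open>m^{n+1}\<close> generate \<open>m^n\<close> modulo every higher power.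
\<close>

lemma ideal_power_finitely_generated_modulo:
  assumes C: "finite C" "C \<subseteq> ideal_power m n"
    and frame: "\<And>a. a \<in> ideal_power m n \<Longrightarrow> \<exists>r. a - (\<Sum>c\<in>C. r c * c) \<in> ideal_power m (Suc n)"
    and a: "a \<in> ideal_power m n"
  shows "\<exists>r. a - (\<Sum>c\<in>C. r c * c) \<in> ideal_power m (n + q)"
proof -
  define G where "G p = {a. \<exists>r. a - (\<Sum>c\<in>C. r c * c) \<in> ideal_power m p}" for p
  have GI: "a \<in> G p" if "a - (\<Sum>c\<in>C. r c * c) \<in> ideal_power m p" for a r p
    using that unfolding G_def mem_Collect_eq by (rule exI[where x = r])
  have G: "is_ideal (G p)" for p
    unfolding ideal.subspace_def
  proof (intro conjI ballI allI)
    show "0 \<in> G p" by (rule GI[of _ "\<lambda>_. 0"]) (simp add: ideal_power_zero)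
    fix a b assume "a \<in> G p" "b \<in> G p"
    then obtain r s where r: "a - (\<Sum>c\<in>C. r c * c) \<in> ideal_power m p"
      and s: "b - (\<Sum>c\<in>C. s c * c) \<in> ideal_power m p"
      unfolding G_def by blast
    have "(a + b) - (\<Sum>c\<in>C. (r c + s c) * c) = (a - (\<Sum>c\<in>C. r c * c)) + (b - (\<Sum>c\<in>C. s c * c))"
      by (simp add: distrib_right sum.distrib)
    with ideal_power_add[OF r s] have "(a + b) - (\<Sum>c\<in>C. (r c + s c) * c) \<in> ideal_power m p"
      by (simp only:)
    then show "a + b \<in> G p" by (rule GI)
  next
    fix x a assume "a \<in> G p"
    then obtain r where r: "a - (\<Sum>c\<in>C. r c * c) \<in> ideal_power m p"
      unfolding G_def mem_Collect_eq by (elim exE)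
    have "x * a - (\<Sum>c\<in>C. (x * r c) * c) = x * (a - (\<Sum>c\<in>C. r c * c))"
      by (simp only: right_diff_distrib sum_distrib_left mult.assoc)
    with ideal_power_mult_left[OF r, of x] have "x * a - (\<Sum>c\<in>C. (x * r c) * c) \<in> ideal_power m p"
      by (simp only:)
    then show "x * a \<in> G p" by (rule GI)
  qed
  have step: "ideal_power m (n + q) \<subseteq> G (Suc (n + q))" for q
  proof (induction q)
    case 0
    show ?case unfolding G_def add_0_right using frame by blast
  next
    case (Suc q)
    have "x * y \<in> G (Suc (Suc (n + q)))" if x: "x \<in> m" and y: "y \<in> ideal_power m (n + q)" for x y
    proof -
      obtain r where r: "y - (\<Sum>c\<in>C. r c * c) \<in> ideal_power m (Suc (n + q))"
        using Suc y unfolding G_def by blast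
      have xy: "x * (y - (\<Sum>c\<in>C. r c * c)) \<in> ideal_power m (Suc (Suc (n + q)))"
        unfolding ideal_power.simps(2)[of m "Suc (n + q)"] using x r by (intro ideal.span_base) blast
      have "x * y - (\<Sum>c\<in>C. (x * r c) * c) = x * (y - (\<Sum>c\<in>C. r c * c))"
        by (simp only: right_diff_distrib sum_distrib_left mult.assoc)
      with xy have "x * y - (\<Sum>c\<in>C. (x * r c) * c) \<in> ideal_power m (Suc (Suc (n + q)))"
        by (simp only:)
      then show ?thesis by (rule GI)
    qed
    then have "ideal_power m (Suc (n + q)) \<subseteq> G (Suc (Suc (n + q)))"
      unfolding ideal_power.simps(2)[of m "n + q"] by (intro ideal.span_minimal G) blast
    then show ?case by simp
  qed
  have "a \<in> G (n + q)" for q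
  proof (induction q)
    case 0
    show ?case using a by (intro GI[of _ "\<lambda>_. 0"]) simp
  next
    case (Suc q)
    then obtain r where "a - (\<Sum>c\<in>C. r c * c) \<in> ideal_power m (n + q)" unfolding G_def by blast
    then have "a - (\<Sum>c\<in>C. r c * c) \<in> G (Suc (n + q))" using step by blast
    moreover have "(\<Sum>c\<in>C. r c * c) \<in> G (Suc (n + q))"
      by (rule GI[of _ r]) (simp only: diff_self ideal_power_zero)
    ultimately have "a - (\<Sum>c\<in>C. r c * c) + (\<Sum>c\<in>C. r c * c) \<in> G (Suc (n + q))"
      by (rule ideal.subspace_add[OF G])
    then show ?case by simp
  qed
  then show ?thesis unfolding G_def by blast
qed

end

section \<open>Homomorphisms from the continuous dual to the Lie algebra\<close>

context deformation_base
begin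

abbreviation dual where "dual \<equiv> A.dual"
abbreviation continuous_dual where "continuous_dual \<equiv> A.continuous_dual"

text \<open>
  The linear maps from the continuous dual to \<open>L\<close>.  They are total functions, normalised to be zero
  outside the continuous dual, so that equality and addition are those of the function type.
\<close>

definition dual_hom :: "(('a \<Rightarrow> 'k) \<Rightarrow> 'l) set"
  where "dual_hom = {s. (\<forall>\<beta>. \<beta> \<notin> continuous_dual \<longrightarrow> s \<beta> = 0) \<and>
    (\<forall>\<beta>\<in>continuous_dual. \<forall>\<beta>'\<in>continuous_dual. s (\<beta> + \<beta>') = s \<beta> + s \<beta>') \<and>
    (\<forall>c. \<forall>\<beta>\<in>continuous_dual. s (\<lambda>a. c * \<beta> a) = scale c (s \<beta>))}"

text \<open>Multiplication by \<open>a\<close> is the transpose of the multiplication on \<open>A\<close>.\<close>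

definition hom_smult :: "'a \<Rightarrow> (('a \<Rightarrow> 'k) \<Rightarrow> 'l) \<Rightarrow> ('a \<Rightarrow> 'k) \<Rightarrow> 'l"
  where "hom_smult a s = (\<lambda>\<beta>. if \<beta> \<in> continuous_dual then s (\<lambda>b. \<beta> (a * b)) else 0)"

text \<open>The homomorphism that corresponds to \<open>1 \<otimes> x\<close>.\<close>

definition hom_const :: "'l \<Rightarrow> ('a \<Rightarrow> 'k) \<Rightarrow> 'l"
  where "hom_const x = (\<lambda>\<beta>. if \<beta> \<in> continuous_dual then scale (\<beta> 1) x else 0)"

text \<open>
  The kernel of the projection to \<open>A/m^n \<otimes> L\<close>, which is the space of linear maps on \<open>dual n\<close>.
\<close>

definition filtration :: "nat \<Rightarrow> (('a \<Rightarrow> 'k) \<Rightarrow> 'l) set"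
  where "filtration n = {s \<in> dual_hom. \<forall>\<beta>\<in>dual n. s \<beta> = 0}"

lemma hom_outside: "s \<in> dual_hom \<Longrightarrow> \<beta> \<notin> continuous_dual \<Longrightarrow> s \<beta> = 0"
  and hom_add_arg: "s \<in> dual_hom \<Longrightarrow> \<beta> \<in> continuous_dual \<Longrightarrow> \<beta>' \<in> continuous_dual \<Longrightarrow> s (\<beta> + \<beta>') = s \<beta> + s \<beta>'"
  and hom_scale_arg: "s \<in> dual_hom \<Longrightarrow> \<beta> \<in> continuous_dual \<Longrightarrow> s (\<lambda>a. c * \<beta> a) = scale c (s \<beta>)"
  by (simp_all add: dual_hom_def)

lemma dual_homI:
  assumes "\<And>\<beta>. \<beta> \<notin> continuous_dual \<Longrightarrow> s \<beta> = 0"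
    and "\<And>n \<beta> \<beta>'. \<beta> \<in> dual n \<Longrightarrow> \<beta>' \<in> dual n \<Longrightarrow> s (\<beta> + \<beta>') = s \<beta> + s \<beta>'"
    and "\<And>c n \<beta>. \<beta> \<in> dual n \<Longrightarrow> s (\<lambda>a. c * \<beta> a) = scale c (s \<beta>)"
  shows "s \<in> dual_hom"
  unfolding dual_hom_def
  using assms by (auto elim: A.continuous_dualE2) (meson A.continuous_dualE order_refl)

lemma hom_zero_arg: "s \<in> dual_hom \<Longrightarrow> s 0 = 0"
  using hom_add_arg[of s 0 0] A.zero_in_continuous_dual by simp

lemma hom_sum_arg:
  assumes "s \<in> dual_hom" "\<And>i. i \<in> I \<Longrightarrow> \<beta> i \<in> continuous_dual"
  shows "(\<Sum>i\<in>I. \<beta> i) \<in> continuous_dual \<and> s (\<Sum>i\<in>I. \<beta> i) = (\<Sum>i\<in>I. s (\<beta> i))"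
  using assms(2)
  by (induction I rule: infinite_finite_induct)
    (simp_all add: hom_zero_arg[OF assms(1)] A.zero_in_continuous_dual hom_add_arg[OF assms(1)]
      A.add_in_continuous_dual)

lemma sum_apply: "(\<Sum>i\<in>I. f i) x = (\<Sum>i\<in>I. f i x)"
  by (induction I rule: infinite_finite_induct) simp_all

lemma hom_combination_arg:
  assumes "s \<in> dual_hom" "\<And>i. i \<in> I \<Longrightarrow> \<beta> i \<in> continuous_dual"
  shows "s (\<lambda>a. \<Sum>i\<in>I. c i * \<beta> i a) = (\<Sum>i\<in>I. scale (c i) (s (\<beta> i)))"
proof -
  have "(\<lambda>a. \<Sum>i\<in>I. c i * \<beta> i a) = (\<Sum>i\<in>I. (\<lambda>a. c i * \<beta> i a))"
    by (rule ext) (simp add: sum_apply)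
  moreover have "s (\<Sum>i\<in>I. (\<lambda>a. c i * \<beta> i a)) = (\<Sum>i\<in>I. s (\<lambda>a. c i * \<beta> i a))"
    using assms by (intro conjunct2[OF hom_sum_arg]) (auto intro: A.scale_in_continuous_dual)
  moreover have "\<dots> = (\<Sum>i\<in>I. scale (c i) (s (\<beta> i)))"
    using assms by (intro sum.cong) (auto simp: hom_scale_arg)
  ultimately show ?thesis by simp
qed

lemma hom_diff_arg:
  assumes "s \<in> dual_hom" "\<beta> \<in> continuous_dual" "\<beta>' \<in> continuous_dual"
  shows "\<beta> - \<beta>' \<in> continuous_dual \<and> s (\<beta> - \<beta>') = s \<beta> - s \<beta>'"
proof -
  have eq: "\<beta> - \<beta>' = \<beta> + (\<lambda>a. (-1) * \<beta>' a)" by (simp add: fun_eq_iff)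
  have "(\<lambda>a. (-1) * \<beta>' a) \<in> continuous_dual" by (rule A.scale_in_continuous_dual[OF assms(3)])
  then show ?thesis unfolding eq
    using hom_add_arg[OF assms(1,2)] hom_scale_arg[OF assms(1,3), of "-1"] assms(2)
    by (auto intro: A.add_in_continuous_dual)
qed

lemma zero_in_hom: "0 \<in> dual_hom"
  by (simp add: dual_hom_def)

lemma add_in_hom: "s \<in> dual_hom \<Longrightarrow> t \<in> dual_hom \<Longrightarrow> s + t \<in> dual_hom"
  by (simp add: dual_hom_def scale_right_distrib)

lemma diff_in_hom: "s \<in> dual_hom \<Longrightarrow> t \<in> dual_hom \<Longrightarrow> s - t \<in> dual_hom"
  by (simp add: dual_hom_def scale_right_diff_distrib)

lemma sum_in_hom: "(\<And>i. i \<in> I \<Longrightarrow> s i \<in> dual_hom) \<Longrightarrow> (\<Sum>i\<in>I. s i) \<in> dual_hom"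
  by (induction I rule: infinite_finite_induct) (simp_all add: zero_in_hom add_in_hom)

lemma smult_in_hom: "s \<in> dual_hom \<Longrightarrow> hom_smult a s \<in> dual_hom"
proof (rule dual_homI)
  fix n \<beta> \<beta>' c
  assume s: "s \<in> dual_hom" and \<beta>: "\<beta> \<in> dual n"
  note c = \<beta>[THEN A.continuous_dualI] \<beta>[THEN A.shift_in_dual_same, THEN A.continuous_dualI]
  show "hom_smult a s (\<lambda>a. c * \<beta> a) = scale c (hom_smult a s \<beta>)"
    using c hom_scale_arg[OF s c(2)] A.scale_in_continuous_dual[OF c(1)] by (simp add: hom_smult_def)
  assume \<beta>': "\<beta>' \<in> dual n"
  note c' = \<beta>'[THEN A.continuous_dualI] \<beta>'[THEN A.shift_in_dual_same, THEN A.continuous_dualI]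
  have eq: "(\<lambda>b. (\<beta> + \<beta>') (a * b)) = (\<lambda>b. \<beta> (a * b)) + (\<lambda>b. \<beta>' (a * b))" by (simp add: fun_eq_iff)
  show "hom_smult a s (\<beta> + \<beta>') = hom_smult a s \<beta> + hom_smult a s \<beta>'"
    unfolding hom_smult_def eq
    using c c' hom_add_arg[OF s c(2) c'(2)] A.add_in_continuous_dual[OF c(1) c'(1)] by simp
qed (simp add: hom_smult_def)

lemma const_in_hom: "hom_const x \<in> dual_hom"
proof (rule dual_homI)
  fix n \<beta> \<beta>' c
  assume \<beta>: "\<beta> \<in> dual n"
  show "hom_const x (\<lambda>a. c * \<beta> a) = scale c (hom_const x \<beta>)"
    using A.scale_in_continuous_dual A.continuous_dualI[OF \<beta>] by (simp add: hom_const_def)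
  assume \<beta>': "\<beta>' \<in> dual n"
  show "hom_const x (\<beta> + \<beta>') = hom_const x \<beta> + hom_const x \<beta>'"
    using A.add_in_continuous_dual A.continuous_dualI[OF \<beta>] A.continuous_dualI[OF \<beta>']
    by (simp add: hom_const_def scale_left_distrib)
qed (simp add: hom_const_def)

lemma smult_add_right: "hom_smult a (s + t) = hom_smult a s + hom_smult a t"
  by (simp add: hom_smult_def fun_eq_iff)

lemma smult_diff_right: "hom_smult a (s - t) = hom_smult a s - hom_smult a t"
  by (simp add: hom_smult_def fun_eq_iff)

lemma smult_zero_right: "hom_smult a 0 = 0"
  by (simp add: hom_smult_def fun_eq_iff)

lemma smult_sum_right: "hom_smult a (\<Sum>i\<in>I. s i) = (\<Sum>i\<in>I. hom_smult a (s i))"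
proof (induction I rule: infinite_finite_induct)
  case (insert i I)
  then show ?case by (simp only: sum.insert[OF insert.hyps] smult_add_right)
next
  case (infinite I)
  then show ?case by (simp only: sum.infinite[OF infinite] smult_zero_right)
qed (simp only: sum.empty smult_zero_right)

lemma smult_assoc: "hom_smult a (hom_smult b s) = hom_smult (a * b) s"
  by (simp add: hom_smult_def fun_eq_iff A.shift_in_continuous_dual mult.assoc)

lemma smult_scalar:
  assumes "s \<in> dual_hom"
  shows "hom_smult (scaleA c 1) s = (\<lambda>\<beta>. scale c (s \<beta>))"
proof
  fix \<beta>
  show "hom_smult (scaleA c 1) s \<beta> = scale c (s \<beta>)"
  proof (cases "\<beta> \<in> continuous_dual")
    case True
    then obtain n where "\<beta> \<in> dual n" by (auto simp: A.continuous_dual_def)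
    then have "(\<lambda>b. \<beta> (scaleA c 1 * b)) = (\<lambda>b. c * \<beta> b)"
      using A.dual_scale A.scale_eq_mult by metis
    then show ?thesis using True hom_scale_arg[OF assms True] by (simp add: hom_smult_def)
  qed (simp add: hom_smult_def hom_outside[OF assms])
qed

lemma smult_const:
  "hom_smult a (hom_const x) = (\<lambda>\<beta>. if \<beta> \<in> continuous_dual then scale (\<beta> a) x else 0)"
  by (simp add: hom_smult_def hom_const_def fun_eq_iff A.shift_in_continuous_dual)

lemma const_add: "hom_const (x + y) = hom_const x + hom_const y"
  by (simp add: hom_const_def fun_eq_iff scale_right_distrib)

lemma const_scale: "hom_const (scale c x) = hom_smult (scaleA c 1) (hom_const x)"
  by (simp add: smult_scalar const_in_hom) (simp add: hom_const_def fun_eq_iff scale_left_commute)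

lemma filtration_hom: "s \<in> filtration n \<Longrightarrow> s \<in> dual_hom"
  by (simp add: filtration_def)

lemma filtration_eval: "s \<in> filtration n \<Longrightarrow> \<beta> \<in> dual n \<Longrightarrow> s \<beta> = 0"
  by (simp add: filtration_def)

lemma filtration_zero: "0 \<in> filtration n"
  by (simp add: filtration_def zero_in_hom)

lemma filtration_add: "s \<in> filtration n \<Longrightarrow> t \<in> filtration n \<Longrightarrow> s + t \<in> filtration n"
  by (simp add: filtration_def add_in_hom)

lemma filtration_diff: "s \<in> filtration n \<Longrightarrow> t \<in> filtration n \<Longrightarrow> s - t \<in> filtration n"
  by (simp add: filtration_def diff_in_hom)

lemma filtration_sum: "(\<And>i. i \<in> I \<Longrightarrow> s i \<in> filtration n) \<Longrightarrow> (\<Sum>i\<in>I. s i) \<in> filtration n"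
  by (induction I rule: infinite_finite_induct) (simp_all add: filtration_zero filtration_add)

lemma filtration_antimono: "n \<le> p \<Longrightarrow> filtration p \<subseteq> filtration n"
  using A.dual_mono[of n p] by (auto simp: filtration_def)

lemma filtration_0: "filtration 0 = dual_hom"
  by (auto simp: filtration_def A.dual_0 hom_zero_arg)

lemma filtration_smult:
  assumes "a \<in> ideal_power m p" "s \<in> filtration n"
  shows "hom_smult a s \<in> filtration (p + n)"
proof -
  have "hom_smult a s \<beta> = 0" if "\<beta> \<in> dual (p + n)" for \<beta>
    using filtration_eval[OF assms(2) A.shift_in_dual[OF assms(1) that]] by (simp add: hom_smult_def)
  then show ?thesis using filtration_hom[OF assms(2)] by (simp add: filtration_def smult_in_hom)
qed

lemma filtration_smult_same: "s \<in> filtration n \<Longrightarrow> hom_smult a s \<in> filtration n"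
  using filtration_smult[of a 0 s n] by simp

lemma smult_in_filtration: "a \<in> ideal_power m n \<Longrightarrow> s \<in> dual_hom \<Longrightarrow> hom_smult a s \<in> filtration n"
  using filtration_smult[of a n s 0] by (simp add: filtration_0)

lemma filtration_separated:
  assumes "\<And>n. s \<in> filtration n"
  shows "s = 0"
proof
  fix \<beta>
  show "s \<beta> = 0 \<beta>"
    using assms hom_outside[OF filtration_hom[OF assms]]
    by (cases "\<beta> \<in> continuous_dual") (auto simp: A.continuous_dual_def filtration_def)
qed

lemma frame_eval:
  assumes "A.is_frame n C \<gamma>" "s \<in> dual_hom" "\<beta> \<in> dual n"
  shows "s \<beta> = (\<Sum>c\<in>C. scale (\<beta> c) (s (\<gamma> c)))"
proof -
  have "s \<beta> = s (\<lambda>a. \<Sum>c\<in>C. \<beta> c * \<gamma> c a)"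
    using A.frame_expand[OF assms(1,3)] by (rule arg_cong)
  also have "\<dots> = (\<Sum>c\<in>C. scale (\<beta> c) (s (\<gamma> c)))"
    using assms by (intro hom_combination_arg) (auto simp: A.is_frame_def intro: A.continuous_dualI)
  finally show ?thesis .
qed

text \<open>Modulo each level, every element is a finite combination of constants.\<close>

lemma frame_approximation:
  assumes "A.is_frame n C \<gamma>" "s \<in> dual_hom"
  shows "s - (\<Sum>c\<in>C. hom_smult c (hom_const (s (\<gamma> c)))) \<in> filtration n"
proof -
  have "s \<beta> = (\<Sum>c\<in>C. hom_smult c (hom_const (s (\<gamma> c))) \<beta>)" if "\<beta> \<in> dual n" for \<beta>
    using frame_eval[OF assms that] A.continuous_dualI[OF that] by (simp add: smult_const)
  then show ?thesis
    using assms(2) by (simp add: filtration_def diff_in_hom sum_in_hom smult_in_hom const_in_hom sum_apply)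
qed

text \<open>
  Level \<open>n\<close> is \<open>m^n\<close> times the whole module, with finitely many generators.  For generators \<open>c\<close> of
  \<open>m^n\<close> let \<open>\<rho>\<close> send \<open>\<beta>\<close> to the family of functionals \<open>\<beta>(c _)\<close>.  The kernel of \<open>\<rho>\<close> on the continuous
  dual is \<open>dual n\<close>, so an \<open>s\<close> vanishing there factors through \<open>\<rho>\<close>; a linear section \<open>\<sigma>\<close> of \<open>\<rho>\<close>
  extends the factor to all families, and its components give the coefficients of \<open>s\<close>.
\<close>

lemma filtration_generated:
  obtains C where "finite C" "C \<subseteq> ideal_power m n"
    "\<And>s. s \<in> filtration n \<Longrightarrow> \<exists>t. (\<forall>c\<in>C. t c \<in> dual_hom) \<and> s = (\<Sum>c\<in>C. hom_smult c (t c))"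
proof -
  obtain C \<gamma> where C: "finite C" "C \<subseteq> ideal_power m n"
    and frame: "\<And>a. a \<in> ideal_power m n \<Longrightarrow> a - (\<Sum>c\<in>C. scaleA (\<gamma> c a) c) \<in> ideal_power m (Suc n)"
    by (rule A.graded_frame_exists) blast
  have frame': "\<exists>r. a - (\<Sum>c\<in>C. r c * c) \<in> ideal_power m (Suc n)" if "a \<in> ideal_power m n" for a
  proof
    show "a - (\<Sum>c\<in>C. scaleA (\<gamma> c a) 1 * c) \<in> ideal_power m (Suc n)"
      using frame[OF that] by (simp only: A.scale_eq_mult[symmetric])
  qed
  define sc1 :: "'k \<Rightarrow> ('a \<Rightarrow> 'k) \<Rightarrow> 'a \<Rightarrow> 'k" where "sc1 c \<beta> = (\<lambda>a. c * \<beta> a)" for c \<beta>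
  define sc2 :: "'k \<Rightarrow> ('a \<Rightarrow> 'a \<Rightarrow> 'k) \<Rightarrow> 'a \<Rightarrow> 'a \<Rightarrow> 'k" where "sc2 c f = (\<lambda>g a. c * f g a)" for c f
  interpret V1: vector_space sc1
    by unfold_locales (simp_all add: sc1_def fun_eq_iff algebra_simps)
  interpret V2: vector_space sc2
    by unfold_locales (simp_all add: sc2_def fun_eq_iff algebra_simps)
  interpret V: vector_space_pair sc1 sc2 ..
  define \<rho> :: "('a \<Rightarrow> 'k) \<Rightarrow> 'a \<Rightarrow> 'a \<Rightarrow> 'k" where "\<rho> \<beta> = (\<lambda>g b. if g \<in> C then \<beta> (g * b) else 0)" for \<beta>
  have lin: "Vector_Spaces.linear sc1 sc2 \<rho>"
    unfolding Vector_Spaces.linear_iff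
    by (auto simp: V1.vector_space_axioms V2.vector_space_axioms \<rho>_def sc1_def sc2_def fun_eq_iff)
  have sub: "V1.subspace continuous_dual"
    unfolding V1.subspace_def sc1_def
    using A.zero_in_continuous_dual A.add_in_continuous_dual A.scale_in_continuous_dual by blast
  obtain \<sigma> where \<sigma>: "range \<sigma> \<subseteq> continuous_dual" "Vector_Spaces.linear sc2 sc1 \<sigma>"
    "\<And>\<beta>. \<beta> \<in> continuous_dual \<Longrightarrow> \<rho> (\<sigma> (\<rho> \<beta>)) = \<rho> \<beta>"
    using V.linear_exists_right_inverse_on[OF lin sub] by blast
  interpret \<sigma>: Vector_Spaces.linear sc2 sc1 \<sigma> by (rule \<sigma>(2))
  have \<sigma>_dual: "\<sigma> f \<in> continuous_dual" for f using \<sigma>(1) by blast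
  define \<iota> :: "'a \<Rightarrow> ('a \<Rightarrow> 'k) \<Rightarrow> 'a \<Rightarrow> 'a \<Rightarrow> 'k" where "\<iota> g \<beta> = (\<lambda>g' b. if g' = g then \<beta> b else 0)" for g \<beta>
  show thesis
  proof (rule that[OF C])
    fix s assume s: "s \<in> filtration n"
    note sh = filtration_hom[OF s]
    define t where "t g = (\<lambda>\<beta>. if \<beta> \<in> continuous_dual then s (\<sigma> (\<iota> g \<beta>)) else 0)" for g
    have t: "t g \<in> dual_hom" for g
    proof (rule dual_homI)
      fix p \<beta> \<beta>' c
      assume \<beta>: "\<beta> \<in> dual p"
      note cd = A.continuous_dualI[OF \<beta>]
      have "\<iota> g (\<lambda>a. c * \<beta> a) = sc2 c (\<iota> g \<beta>)" by (auto simp: \<iota>_def sc2_def fun_eq_iff)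
      then have "\<sigma> (\<iota> g (\<lambda>a. c * \<beta> a)) = (\<lambda>a. c * \<sigma> (\<iota> g \<beta>) a)" by (simp add: \<sigma>.scale sc1_def)
      then show "t g (\<lambda>a. c * \<beta> a) = scale c (t g \<beta>)"
        using cd A.scale_in_continuous_dual[OF cd] hom_scale_arg[OF sh \<sigma>_dual] by (simp add: t_def)
      assume \<beta>': "\<beta>' \<in> dual p"
      note cd' = A.continuous_dualI[OF \<beta>']
      have "\<iota> g (\<beta> + \<beta>') = \<iota> g \<beta> + \<iota> g \<beta>'" by (auto simp: \<iota>_def fun_eq_iff)
      then have "\<sigma> (\<iota> g (\<beta> + \<beta>')) = \<sigma> (\<iota> g \<beta>) + \<sigma> (\<iota> g \<beta>')" by (simp add: \<sigma>.add)
      then show "t g (\<beta> + \<beta>') = t g \<beta> + t g \<beta>'"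
        using cd cd' A.add_in_continuous_dual[OF cd cd'] hom_add_arg[OF sh \<sigma>_dual \<sigma>_dual] by (simp add: t_def)
    qed (simp add: t_def)
    have "s \<beta> = (\<Sum>c\<in>C. hom_smult c (t c)) \<beta>" for \<beta>
    proof (cases "\<beta> \<in> continuous_dual")
      case True
      have "(\<Sum>c\<in>C. \<iota> c (\<lambda>b. \<beta> (c * b))) = \<rho> \<beta>"
        using C(1) by (simp add: fun_eq_iff sum_apply \<iota>_def \<rho>_def)
      then have "\<sigma> (\<rho> \<beta>) = (\<Sum>c\<in>C. \<sigma> (\<iota> c (\<lambda>b. \<beta> (c * b))))"
        by (metis \<sigma>.sum)
      then have "s (\<sigma> (\<rho> \<beta>)) = (\<Sum>c\<in>C. s (\<sigma> (\<iota> c (\<lambda>b. \<beta> (c * b)))))"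
        using hom_sum_arg[OF sh, of C "\<lambda>c. \<sigma> (\<iota> c (\<lambda>b. \<beta> (c * b)))"] \<sigma>_dual by simp
      also have "\<dots> = (\<Sum>c\<in>C. hom_smult c (t c)) \<beta>"
        using True by (simp add: sum_apply hom_smult_def t_def A.shift_in_continuous_dual)
      finally have 1: "s (\<sigma> (\<rho> \<beta>)) = (\<Sum>c\<in>C. hom_smult c (t c)) \<beta>" .
      define \<delta> where "\<delta> = \<beta> - \<sigma> (\<rho> \<beta>)"
      have \<delta>: "\<delta> \<in> continuous_dual" "s \<delta> = s \<beta> - s (\<sigma> (\<rho> \<beta>))"
        using hom_diff_arg[OF sh True \<sigma>_dual] by (auto simp: \<delta>_def)
      have "\<delta> (c * b) = 0" if "c \<in> C" for c b
      proof -
        have "\<rho> (\<sigma> (\<rho> \<beta>)) c b = \<rho> \<beta> c b" using \<sigma>(3)[OF True] by simp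
        then show ?thesis using that by (simp add: \<delta>_def \<rho>_def)
      qed
      note \<delta>C = this
      obtain q where q: "\<delta> \<in> dual (n + q)"
        using \<delta>(1) by (metis A.continuous_dualE le_add2)
      have "\<delta> a = 0" if a: "a \<in> ideal_power m n" for a
      proof -
        obtain r where r: "a - (\<Sum>c\<in>C. r c * c) \<in> ideal_power m (n + q)"
          using A.ideal_power_finitely_generated_modulo[OF C frame' a, of q] by blast
        have "\<delta> a = \<delta> (\<Sum>c\<in>C. r c * c)"
          using A.dual_vanish[OF q r] by (simp add: A.dual_diff[OF q])
        also have "\<dots> = (\<Sum>c\<in>C. \<delta> (c * r c))" by (simp add: A.dual_sum[OF q] mult.commute)
        also have "\<dots> = 0" by (simp add: \<delta>C)
        finally show ?thesis .
      qed
      then have "\<delta> \<in> dual n" using q by (simp add: A.dual_iff)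
      then have "s \<delta> = 0" by (rule filtration_eval[OF s])
      then show ?thesis using \<delta>(2) 1 by simp
    next
      case False
      then show ?thesis
        using hom_outside[OF sh] by (simp add: sum_apply hom_smult_def)
    qed
    then show "\<exists>t. (\<forall>c\<in>C. t c \<in> dual_hom) \<and> s = (\<Sum>c\<in>C. hom_smult c (t c))"
      using t by (intro exI[of _ t]) auto
  qed
qed

text \<open>The \<open>A\<close>-linear endomaps of the module; values outside of it are irrelevant.\<close>

definition hom_linear :: "((('a \<Rightarrow> 'k) \<Rightarrow> 'l) \<Rightarrow> (('a \<Rightarrow> 'k) \<Rightarrow> 'l)) \<Rightarrow> bool"
  where "hom_linear F \<longleftrightarrow> (\<forall>s\<in>dual_hom. F s \<in> dual_hom) \<and>
    (\<forall>s\<in>dual_hom. \<forall>t\<in>dual_hom. F (s + t) = F s + F t) \<and>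
    (\<forall>a. \<forall>s\<in>dual_hom. F (hom_smult a s) = hom_smult a (F s))"

lemma hom_linear_in: "hom_linear F \<Longrightarrow> s \<in> dual_hom \<Longrightarrow> F s \<in> dual_hom"
  and hom_linear_add: "hom_linear F \<Longrightarrow> s \<in> dual_hom \<Longrightarrow> t \<in> dual_hom \<Longrightarrow> F (s + t) = F s + F t"
  and hom_linear_smult: "hom_linear F \<Longrightarrow> s \<in> dual_hom \<Longrightarrow> F (hom_smult a s) = hom_smult a (F s)"
  by (simp_all add: hom_linear_def)

lemma hom_linear_zero: "hom_linear F \<Longrightarrow> F 0 = 0"
  using hom_linear_add[of F 0 0] by (simp add: zero_in_hom)

lemma hom_linear_diff:
  assumes "hom_linear F" "s \<in> dual_hom" "t \<in> dual_hom"
  shows "F (s - t) = F s - F t"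
  using hom_linear_add[OF assms(1) diff_in_hom[OF assms(2,3)] assms(3)] by (simp add: algebra_simps)

lemma hom_linear_sum:
  assumes "hom_linear F" "\<And>i. i \<in> I \<Longrightarrow> s i \<in> dual_hom"
  shows "F (\<Sum>i\<in>I. s i) = (\<Sum>i\<in>I. F (s i))"
  using assms(2)
  by (induction I rule: infinite_finite_induct)
    (simp_all add: hom_linear_zero[OF assms(1)] hom_linear_add[OF assms(1)] sum_in_hom)

text \<open>
  \<open>A\<close>-linear maps are automatically continuous, because the levels are generated by multiples.
\<close>

lemma hom_linear_filtration:
  assumes F: "hom_linear F" and p: "\<And>s. s \<in> dual_hom \<Longrightarrow> F s \<in> filtration p" and s: "s \<in> filtration n"
  shows "F s \<in> filtration (n + p)"
proof -
  obtain C where C: "C \<subseteq> ideal_power m n"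
    "\<And>s. s \<in> filtration n \<Longrightarrow> \<exists>t. (\<forall>c\<in>C. t c \<in> dual_hom) \<and> s = (\<Sum>c\<in>C. hom_smult c (t c))"
    by (rule filtration_generated) blast
  from C(2)[OF s] obtain t where t: "\<And>c. c \<in> C \<Longrightarrow> t c \<in> dual_hom" "s = (\<Sum>c\<in>C. hom_smult c (t c))"
    by blast
  have "F s = (\<Sum>c\<in>C. F (hom_smult c (t c)))"
    unfolding t(2) by (rule hom_linear_sum[OF F]) (simp add: smult_in_hom t(1))
  also have "\<dots> = (\<Sum>c\<in>C. hom_smult c (F (t c)))"
    by (intro sum.cong refl hom_linear_smult[OF F] t(1))
  also have "\<dots> \<in> filtration (n + p)"
    using C(1) by (intro filtration_sum filtration_smult p t(1)) auto
  finally show ?thesis .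
qed

lemma hom_linear_continuous:
  assumes "hom_linear F" "s \<in> filtration n"
  shows "F s \<in> filtration n"
  using hom_linear_filtration[OF assms(1) _ assms(2), of 0] hom_linear_in[OF assms(1)]
  by (simp add: filtration_0)

text \<open>An \<open>A\<close>-linear map is controlled by its values on the constants.\<close>

lemma hom_linear_determined:
  assumes F: "hom_linear F" and const: "\<And>x. F (hom_const x) \<in> filtration n" and s: "s \<in> dual_hom"
  shows "F s \<in> filtration n"
proof -
  obtain C \<gamma> where C: "A.is_frame n C \<gamma>" using A.frame_exists by blast
  let ?t = "\<Sum>c\<in>C. hom_smult c (hom_const (s (\<gamma> c)))"
  have t: "?t \<in> dual_hom" by (intro sum_in_hom smult_in_hom const_in_hom)
  have "F s = F ?t + F (s - ?t)"
    using hom_linear_add[OF F t diff_in_hom[OF s t]] by simp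
  moreover have "F ?t = (\<Sum>c\<in>C. hom_smult c (F (hom_const (s (\<gamma> c)))))"
    by (simp add: hom_linear_sum[OF F] smult_in_hom const_in_hom hom_linear_smult[OF F])
  moreover have "\<dots> \<in> filtration n"
    by (intro filtration_sum filtration_smult_same const)
  moreover have "F (s - ?t) \<in> filtration n"
    by (rule hom_linear_continuous[OF F frame_approximation[OF C s]])
  ultimately show ?thesis by (simp add: filtration_add)
qed

end

section \<open>The extension of the bracket by scalars\<close>

context deformation_base
begin

lemma hom_linear_plus: "hom_linear F \<Longrightarrow> hom_linear G \<Longrightarrow> hom_linear (\<lambda>s. F s + G s)"
  unfolding hom_linear_def by (simp add: add_in_hom smult_add_right algebra_simps)

lemma hom_linear_minus: "hom_linear F \<Longrightarrow> hom_linear G \<Longrightarrow> hom_linear (\<lambda>s. F s - G s)"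
  unfolding hom_linear_def by (simp add: diff_in_hom smult_diff_right algebra_simps)

lemma hom_linear_compose: "hom_linear F \<Longrightarrow> hom_linear G \<Longrightarrow> hom_linear (\<lambda>s. F (G s))"
  unfolding hom_linear_def by simp

lemma hom_linear_id: "hom_linear (\<lambda>s. s)"
  unfolding hom_linear_def by simp

lemma hom_linear_vanish:
  assumes "hom_linear F" "\<And>x. F (hom_const x) = 0" "s \<in> dual_hom"
  shows "F s = 0"
  by (rule filtration_separated, rule hom_linear_determined[OF assms(1) _ assms(3)])
    (simp add: assms(2) filtration_zero)

text \<open>
  The bracket of \<open>L\<close> extended \<open>A\<close>-bilinearly.  In a frame, \<open>\<beta>(a b) = \<Sum> \<beta>(c a) \<gamma>\<^sub>c(b)\<close> is the coproduct of
  \<open>\<beta>\<close>, and the bracket of \<open>s\<close> and \<open>t\<close> at \<open>\<beta>\<close> is the sum of the \<open>[s(\<beta>(c _)), t(\<gamma>\<^sub>c)]\<close>.  The definition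
  chooses a frame at the least possible level; \<open>model_bracket_eval\<close> shows that every frame gives the
  same value.
\<close>

definition model_bracket ::
  "(('a \<Rightarrow> 'k) \<Rightarrow> 'l) \<Rightarrow> (('a \<Rightarrow> 'k) \<Rightarrow> 'l) \<Rightarrow> ('a \<Rightarrow> 'k) \<Rightarrow> 'l"
  where "model_bracket s t = (\<lambda>\<beta>. if \<beta> \<in> continuous_dual
    then let p = SOME p. A.is_frame (LEAST n. \<beta> \<in> dual n) (fst p) (snd p)
      in \<Sum>c\<in>fst p. bracket (s (\<lambda>b. \<beta> (c * b))) (t (snd p c))
    else 0)"

lemma frame_shift:
  assumes "A.is_frame n C \<gamma>" "\<beta> \<in> dual n" "s \<in> dual_hom"
  shows "(\<Sum>c\<in>C. scale (\<gamma> c d) (s (\<lambda>a. \<beta> (c * a)))) = s (\<lambda>a. \<beta> (d * a))"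
proof -
  have "(\<lambda>a. \<beta> (d * a)) = (\<lambda>a. \<Sum>c\<in>C. \<gamma> c d * \<beta> (c * a))"
  proof
    fix a
    have "d - (\<Sum>c\<in>C. scaleA (\<gamma> c d) c) \<in> ideal_power m n"
      using assms(1) by (simp add: A.is_frame_def)
    then have "\<beta> ((d - (\<Sum>c\<in>C. scaleA (\<gamma> c d) c)) * a) = 0"
      by (intro A.dual_vanish[OF assms(2)] A.ideal_power_mult_right)
    then show "\<beta> (d * a) = (\<Sum>c\<in>C. \<gamma> c d * \<beta> (c * a))"
      by (simp add: left_diff_distrib sum_distrib_right A.scale_mult[symmetric] A.dual_diff[OF assms(2)]
          A.dual_sum[OF assms(2)] A.dual_scale[OF assms(2)])
  qed
  then show ?thesis
    using hom_combination_arg[OF assms(3), of C "\<lambda>c a. \<beta> (c * a)" "\<lambda>c. \<gamma> c d"]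
      A.continuous_dualI[OF A.shift_in_dual_same[OF assms(2)]] by simp
qed

lemma frame_bracket_independent:
  assumes np: "n \<le> p" and C: "A.is_frame n C \<gamma>" and D: "A.is_frame p D \<delta>" and \<beta>: "\<beta> \<in> dual n"
    and s: "s \<in> dual_hom" and t: "t \<in> dual_hom"
  shows "(\<Sum>c\<in>C. bracket (s (\<lambda>b. \<beta> (c * b))) (t (\<gamma> c))) =
    (\<Sum>d\<in>D. bracket (s (\<lambda>b. \<beta> (d * b))) (t (\<delta> d)))"
proof -
  have "t (\<gamma> c) = (\<Sum>d\<in>D. scale (\<gamma> c d) (t (\<delta> d)))" if "c \<in> C" for c
    using that C A.dual_mono[OF np] by (intro frame_eval[OF D t]) (auto simp: A.is_frame_def)
  then have "(\<Sum>c\<in>C. bracket (s (\<lambda>b. \<beta> (c * b))) (t (\<gamma> c))) =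
    (\<Sum>c\<in>C. \<Sum>d\<in>D. bracket (scale (\<gamma> c d) (s (\<lambda>b. \<beta> (c * b)))) (t (\<delta> d)))"
    by (intro sum.cong refl) (simp only: bracket_sum_right bracket_scale_right bracket_scale_left)
  also have "\<dots> = (\<Sum>d\<in>D. \<Sum>c\<in>C. bracket (scale (\<gamma> c d) (s (\<lambda>b. \<beta> (c * b)))) (t (\<delta> d)))"
    by (rule sum.swap)
  also have "\<dots> = (\<Sum>d\<in>D. bracket (s (\<lambda>b. \<beta> (d * b))) (t (\<delta> d)))"
    by (simp only: bracket_sum_left[symmetric] frame_shift[OF C \<beta> s])
  finally show ?thesis .
qed

lemma model_bracket_eval:
  assumes "A.is_frame n C \<gamma>" "\<beta> \<in> dual n" "s \<in> dual_hom" "t \<in> dual_hom"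
  shows "model_bracket s t \<beta> = (\<Sum>c\<in>C. bracket (s (\<lambda>b. \<beta> (c * b))) (t (\<gamma> c)))"
proof -
  let ?n = "LEAST n. \<beta> \<in> dual n"
  define p where "p = (SOME p. A.is_frame ?n (fst p) (snd p))"
  have "\<exists>p. A.is_frame ?n (fst p) (snd p)"
    using A.frame_exists[of ?n] by simp
  then have frame: "A.is_frame ?n (fst p) (snd p)" unfolding p_def by (rule someI_ex)
  have "model_bracket s t \<beta> = (\<Sum>c\<in>fst p. bracket (s (\<lambda>b. \<beta> (c * b))) (t (snd p c)))"
    using A.continuous_dualI[OF assms(2)] by (simp add: model_bracket_def p_def Let_def)
  also have "\<dots> = (\<Sum>c\<in>C. bracket (s (\<lambda>b. \<beta> (c * b))) (t (\<gamma> c)))"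
    using assms by (intro frame_bracket_independent[OF _ frame] Least_le LeastI[of "\<lambda>n. \<beta> \<in> dual n"])
  finally show ?thesis .
qed

lemma model_bracket_outside: "\<beta> \<notin> continuous_dual \<Longrightarrow> model_bracket s t \<beta> = 0"
  by (simp add: model_bracket_def)

lemma hom_eqI:
  assumes "s \<in> dual_hom" "t \<in> dual_hom" "\<And>n \<beta>. \<beta> \<in> dual n \<Longrightarrow> s \<beta> = t \<beta>"
  shows "s = t"
proof
  fix \<beta> show "s \<beta> = t \<beta>"
    using assms hom_outside[of s \<beta>] hom_outside[of t \<beta>]
    by (cases "\<beta> \<in> continuous_dual") (auto simp: A.continuous_dual_def)
qed

lemma model_bracket_in_hom:
  assumes s: "s \<in> dual_hom" and t: "t \<in> dual_hom"
  shows "model_bracket s t \<in> dual_hom"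
proof (rule dual_homI)
  fix n \<beta> \<beta>' c
  assume \<beta>: "\<beta> \<in> dual n"
  obtain C \<gamma> where C: "A.is_frame n C \<gamma>" using A.frame_exists by blast
  note eval = model_bracket_eval[OF C _ s t]
  note sh = A.continuous_dualI[OF A.shift_in_dual_same]
  show "model_bracket s t (\<lambda>a. c * \<beta> a) = scale c (model_bracket s t \<beta>)"
    using hom_scale_arg[OF s sh[OF \<beta>]]
    by (simp add: eval[OF \<beta>] eval[OF A.scale_in_dual[OF \<beta>]] bracket_scale_left scale_sum_right)
  assume \<beta>': "\<beta>' \<in> dual n"
  have "(\<lambda>b. (\<beta> + \<beta>') (d * b)) = (\<lambda>b. \<beta> (d * b)) + (\<lambda>b. \<beta>' (d * b))" for d by (simp add: fun_eq_iff)
  then show "model_bracket s t (\<beta> + \<beta>') = model_bracket s t \<beta> + model_bracket s t \<beta>'"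
    using hom_add_arg[OF s sh[OF \<beta>] sh[OF \<beta>']]
    by (simp add: eval[OF \<beta>] eval[OF \<beta>'] eval[OF A.add_in_dual[OF \<beta> \<beta>']] bracket_add_left sum.distrib)
qed (rule model_bracket_outside)

lemma model_bracket_linear_left:
  assumes t: "t \<in> dual_hom"
  shows "hom_linear (\<lambda>s. model_bracket s t)"
  unfolding hom_linear_def
proof (intro conjI ballI allI)
  fix s assume s: "s \<in> dual_hom"
  show "model_bracket s t \<in> dual_hom" by (rule model_bracket_in_hom[OF s t])
  show "model_bracket (s + s') t = model_bracket s t + model_bracket s' t" if s': "s' \<in> dual_hom" for s'
  proof (rule hom_eqI)
    fix n \<beta> assume \<beta>: "\<beta> \<in> dual n"
    obtain C \<gamma> where C: "A.is_frame n C \<gamma>" using A.frame_exists by blast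
    show "model_bracket (s + s') t \<beta> = (model_bracket s t + model_bracket s' t) \<beta>"
      using s s' t add_in_hom[OF s s']
      by (simp add: model_bracket_eval[OF C \<beta>] bracket_add_left sum.distrib)
  qed (simp_all add: model_bracket_in_hom add_in_hom s s' t)
next
  fix a s assume s: "s \<in> dual_hom"
  show "model_bracket (hom_smult a s) t = hom_smult a (model_bracket s t)"
  proof (rule hom_eqI)
    fix n \<beta> assume \<beta>: "\<beta> \<in> dual n"
    obtain C \<gamma> where C: "A.is_frame n C \<gamma>" using A.frame_exists by blast
    have "model_bracket (hom_smult a s) t \<beta> = (\<Sum>c\<in>C. bracket (s (\<lambda>b. \<beta> (c * (a * b)))) (t (\<gamma> c)))"
      unfolding model_bracket_eval[OF C \<beta> smult_in_hom[OF s] t]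
      using A.continuous_dualI[OF A.shift_in_dual_same[OF \<beta>]] by (simp add: hom_smult_def)
    also have "\<dots> = model_bracket s t (\<lambda>b. \<beta> (a * b))"
      by (simp add: model_bracket_eval[OF C A.shift_in_dual_same[OF \<beta>] s t] mult.left_commute)
    finally show "model_bracket (hom_smult a s) t \<beta> = hom_smult a (model_bracket s t) \<beta>"
      using A.continuous_dualI[OF \<beta>] by (simp add: hom_smult_def)
  qed (simp_all add: model_bracket_in_hom smult_in_hom s t)
qed

lemma model_bracket_linear_right:
  assumes s: "s \<in> dual_hom"
  shows "hom_linear (\<lambda>t. model_bracket s t)"
  unfolding hom_linear_def
proof (intro conjI ballI allI)
  fix t assume t: "t \<in> dual_hom"
  show "model_bracket s t \<in> dual_hom" by (rule model_bracket_in_hom[OF s t])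
  show "model_bracket s (t + t') = model_bracket s t + model_bracket s t'" if t': "t' \<in> dual_hom" for t'
  proof (rule hom_eqI)
    fix n \<beta> assume \<beta>: "\<beta> \<in> dual n"
    obtain C \<gamma> where C: "A.is_frame n C \<gamma>" using A.frame_exists by blast
    show "model_bracket s (t + t') \<beta> = (model_bracket s t + model_bracket s t') \<beta>"
      using s t t' add_in_hom[OF t t']
      by (simp add: model_bracket_eval[OF C \<beta>] bracket_add_right sum.distrib)
  qed (simp_all add: model_bracket_in_hom add_in_hom s t t')
next
  fix a t assume t: "t \<in> dual_hom"
  show "model_bracket s (hom_smult a t) = hom_smult a (model_bracket s t)"
  proof (rule hom_eqI)
    fix n \<beta> assume \<beta>: "\<beta> \<in> dual n"
    obtain C \<gamma> where C: "A.is_frame n C \<gamma>" using A.frame_exists by blast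
    have \<gamma>: "\<gamma> c \<in> dual n" if "c \<in> C" for c using C that by (simp add: A.is_frame_def)
    have "hom_smult a t (\<gamma> c) = (\<Sum>d\<in>C. scale (\<gamma> c (a * d)) (t (\<gamma> d)))" if "c \<in> C" for c
      using A.continuous_dualI[OF \<gamma>[OF that]] frame_eval[OF C t A.shift_in_dual_same[OF \<gamma>[OF that]]]
      by (simp add: hom_smult_def)
    then have "model_bracket s (hom_smult a t) \<beta> =
      (\<Sum>c\<in>C. \<Sum>d\<in>C. bracket (scale (\<gamma> c (a * d)) (s (\<lambda>b. \<beta> (c * b)))) (t (\<gamma> d)))"
      unfolding model_bracket_eval[OF C \<beta> s smult_in_hom[OF t]]
      by (intro sum.cong) (simp_all add: bracket_sum_right bracket_scale_right bracket_scale_left)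
    also have "\<dots> = (\<Sum>d\<in>C. \<Sum>c\<in>C. bracket (scale (\<gamma> c (a * d)) (s (\<lambda>b. \<beta> (c * b)))) (t (\<gamma> d)))"
      by (rule sum.swap)
    also have "\<dots> = (\<Sum>d\<in>C. bracket (s (\<lambda>b. \<beta> (a * d * b))) (t (\<gamma> d)))"
      by (simp only: bracket_sum_left[symmetric] frame_shift[OF C \<beta> s])
    also have "\<dots> = model_bracket s t (\<lambda>b. \<beta> (a * b))"
      by (simp add: model_bracket_eval[OF C A.shift_in_dual_same[OF \<beta>] s t] mult.assoc)
    finally show "model_bracket s (hom_smult a t) \<beta> = hom_smult a (model_bracket s t) \<beta>"
      using A.continuous_dualI[OF \<beta>] by (simp add: hom_smult_def)
  qed (simp_all add: model_bracket_in_hom smult_in_hom s t)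
qed

lemma model_bracket_const_left:
  assumes "t \<in> dual_hom"
  shows "model_bracket (hom_const x) t \<beta> = bracket x (t \<beta>)"
proof (cases "\<beta> \<in> continuous_dual")
  case True
  then obtain n where \<beta>: "\<beta> \<in> dual n" by (auto simp: A.continuous_dual_def)
  obtain C \<gamma> where C: "A.is_frame n C \<gamma>" using A.frame_exists by blast
  have "model_bracket (hom_const x) t \<beta> = (\<Sum>c\<in>C. bracket x (scale (\<beta> c) (t (\<gamma> c))))"
    unfolding model_bracket_eval[OF C \<beta> const_in_hom assms]
    using A.shift_in_continuous_dual[OF True]
    by (simp add: hom_const_def bracket_scale_left bracket_scale_right)
  then show ?thesis
    by (simp add: bracket_sum_right[symmetric] frame_eval[OF C assms \<beta>, symmetric])
qed (simp add: model_bracket_outside hom_outside[OF assms])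

lemma model_bracket_const_right:
  assumes "s \<in> dual_hom"
  shows "model_bracket s (hom_const y) \<beta> = bracket (s \<beta>) y"
proof (cases "\<beta> \<in> continuous_dual")
  case True
  then obtain n where \<beta>: "\<beta> \<in> dual n" by (auto simp: A.continuous_dual_def)
  obtain C \<gamma> where C: "A.is_frame n C \<gamma>" using A.frame_exists by blast
  have "model_bracket s (hom_const y) \<beta> = (\<Sum>c\<in>C. bracket (s (\<lambda>b. \<beta> (c * b))) (hom_const y (\<gamma> c)))"
    by (rule model_bracket_eval[OF C \<beta> assms const_in_hom])
  also have "\<dots> = (\<Sum>c\<in>C. bracket (scale (\<gamma> c 1) (s (\<lambda>b. \<beta> (c * b)))) y)"
    using C by (intro sum.cong)
      (auto simp: hom_const_def A.is_frame_def bracket_scale_left bracket_scale_right dest: A.continuous_dualI)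
  also have "\<dots> = bracket (s \<beta>) y"
    by (simp add: bracket_sum_left[symmetric] frame_shift[OF C \<beta> assms])
  finally show ?thesis .
qed (simp add: model_bracket_outside hom_outside[OF assms])

lemma model_bracket_const: "model_bracket (hom_const x) (hom_const y) = hom_const (bracket x y)"
  by (rule ext) (simp add: model_bracket_const_left const_in_hom, simp add: hom_const_def bracket_scale_right)

lemma model_bracket_anti:
  assumes s: "s \<in> dual_hom" and t: "t \<in> dual_hom"
  shows "model_bracket s t + model_bracket t s = 0"
proof (rule hom_linear_vanish[of "\<lambda>s. model_bracket s t + model_bracket t s", OF _ _ s])
  show "hom_linear (\<lambda>s. model_bracket s t + model_bracket t s)"
    by (intro hom_linear_plus model_bracket_linear_left model_bracket_linear_right t)
  show "model_bracket (hom_const x) t + model_bracket t (hom_const x) = 0" for x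
    using bracket_anti[of _ x]
    by (simp add: fun_eq_iff model_bracket_const_left[OF t] model_bracket_const_right[OF t])
qed

lemma model_bracket_self:
  assumes "t \<in> dual_hom"
  shows "model_bracket t t = 0"
proof
  fix \<beta>
  have "model_bracket t t \<beta> + model_bracket t t \<beta> = 0"
    using fun_cong[OF model_bracket_anti[OF assms assms], of \<beta>] by simp
  then have "scale 2 (model_bracket t t \<beta>) = 0"
    using scale_left_distrib[of 1 1 "model_bracket t t \<beta>"] by simp
  then show "model_bracket t t \<beta> = 0 \<beta>" by simp
qed

lemma model_bracket_jacobi:
  assumes s: "s \<in> dual_hom" and t: "t \<in> dual_hom" and u: "u \<in> dual_hom"
  shows "model_bracket s (model_bracket t u) + model_bracket t (model_bracket u s)
    + model_bracket u (model_bracket s t) = 0"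
proof -
  note lin = hom_linear_plus model_bracket_linear_left model_bracket_linear_right model_bracket_in_hom
    const_in_hom
    hom_linear_compose[OF model_bracket_linear_left model_bracket_linear_left]
    hom_linear_compose[OF model_bracket_linear_left model_bracket_linear_right]
    hom_linear_compose[OF model_bracket_linear_right model_bracket_linear_left]
    hom_linear_compose[OF model_bracket_linear_right model_bracket_linear_right]
  have 1: "model_bracket (hom_const x) (model_bracket (hom_const y) u)
    + model_bracket (hom_const y) (model_bracket u (hom_const x))
    + model_bracket u (model_bracket (hom_const x) (hom_const y)) = 0" for x y
    unfolding model_bracket_const
    by (rule ext) (simp add: model_bracket_const_left model_bracket_const_right model_bracket_in_hom const_in_hom u
        jacobi)
  have 2: "model_bracket (hom_const x) (model_bracket t u) + model_bracket t (model_bracket u (hom_const x))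
    + model_bracket u (model_bracket (hom_const x) t) = 0" for x
    by (rule hom_linear_vanish[of "\<lambda>t. model_bracket (hom_const x) (model_bracket t u)
      + model_bracket t (model_bracket u (hom_const x)) + model_bracket u (model_bracket (hom_const x) t)",
      OF _ 1 t]) (intro lin u)
  show ?thesis
    by (rule hom_linear_vanish[of "\<lambda>s. model_bracket s (model_bracket t u) + model_bracket t (model_bracket u s)
      + model_bracket u (model_bracket s t)", OF _ 2 s]) (intro lin u t)
qed

lemma model_bracket_filtration:
  assumes "s \<in> filtration p" "t \<in> filtration q"
  shows "model_bracket s t \<in> filtration (p + q)"
  by (rule hom_linear_filtration[OF model_bracket_linear_left[OF filtration_hom[OF assms(2)]] _ assms(1)])
    (rule hom_linear_continuous[OF model_bracket_linear_right assms(2)])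

lemma model_bracket_eps:
  assumes s: "s \<in> dual_hom" and t: "t \<in> dual_hom"
  shows "model_bracket s t eps = bracket (s eps) (t eps)"
proof -
  obtain C \<gamma> where C: "A.is_frame 1 C \<gamma>" using A.frame_exists by blast
  have "model_bracket s t eps = (\<Sum>c\<in>C. bracket (s (\<lambda>b. eps c * eps b)) (t (\<gamma> c)))"
    by (simp add: model_bracket_eval[OF C A.eps_in_dual s t] A.eps_mult)
  also have "\<dots> = (\<Sum>c\<in>C. bracket (s eps) (scale (eps c) (t (\<gamma> c))))"
    using hom_scale_arg[OF s A.continuous_dualI[OF A.eps_in_dual]]
    by (simp add: bracket_scale_left bracket_scale_right)
  also have "\<dots> = bracket (s eps) (t eps)"
    by (simp add: bracket_sum_right[symmetric] frame_eval[OF C t A.eps_in_dual, symmetric])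
  finally show ?thesis .
qed

lemma filtration_1_iff:
  assumes "s \<in> dual_hom"
  shows "s \<in> filtration 1 \<longleftrightarrow> s eps = 0"
proof
  assume "s eps = 0"
  then have "s \<beta> = 0" if "\<beta> \<in> dual 1" for \<beta>
    using hom_scale_arg[OF assms A.continuous_dualI[OF A.eps_in_dual], of "\<beta> 1"] A.dual_1_eps[OF that]
    by (metis scale_zero_right)
  then show "s \<in> filtration 1" using assms by (simp add: filtration_def)
qed (rule filtration_eval[OF _ A.eps_in_dual])

text \<open>Completeness with respect to the filtration.\<close>

lemma filtration_limit:
  assumes u: "\<And>k. u k \<in> dual_hom" and step: "\<And>k. u (Suc k) - u k \<in> filtration k"
  obtains v where "v \<in> dual_hom" "\<And>k. v - u k \<in> filtration k"
proof -
  have mono: "u k - u j \<in> filtration j" if "j \<le> k" for j k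
    using that
  proof (induction k rule: dec_induct)
    case base
    have "u j - u j \<in> filtration j" by (simp add: filtration_zero)
    then show ?case .
  next
    case (step k)
    have "u (Suc k) - u k \<in> filtration j"
      using \<open>\<And>k. u (Suc k) - u k \<in> filtration k\<close>[of k] filtration_antimono[OF step(1)] by blast
    moreover have "u k - u j \<in> filtration j" by (rule step.IH)
    ultimately have "u (Suc k) - u k + (u k - u j) \<in> filtration j" by (rule filtration_add)
    then have "u (Suc k) - u j \<in> filtration j" by simp
    then show ?case .
  qed
  define v where "v \<beta> = (if \<beta> \<in> continuous_dual then u (LEAST n. \<beta> \<in> dual n) \<beta> else 0)" for \<beta>
  have v: "v \<beta> = u k \<beta>" if "\<beta> \<in> dual k" for \<beta> k
    using filtration_eval[OF mono[OF Least_le[of "\<lambda>n. \<beta> \<in> dual n", OF that]]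
      LeastI[of "\<lambda>n. \<beta> \<in> dual n", OF that]] A.continuous_dualI[OF that]
    by (simp add: v_def)
  have "v \<in> dual_hom"
  proof (rule dual_homI)
    fix n \<beta> \<beta>' c
    assume \<beta>: "\<beta> \<in> dual n"
    show "v (\<lambda>a. c * \<beta> a) = scale c (v \<beta>)"
      using hom_scale_arg[OF u A.continuous_dualI[OF \<beta>]] by (simp add: v[OF \<beta>] v[OF A.scale_in_dual[OF \<beta>]])
    assume \<beta>': "\<beta>' \<in> dual n"
    show "v (\<beta> + \<beta>') = v \<beta> + v \<beta>'"
      using hom_add_arg[OF u A.continuous_dualI[OF \<beta>] A.continuous_dualI[OF \<beta>']]
      by (simp add: v[OF \<beta>] v[OF \<beta>'] v[OF A.add_in_dual[OF \<beta> \<beta>']])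
  qed (simp add: v_def)
  moreover from this have "v - u k \<in> filtration k" for k
    by (simp add: filtration_def diff_in_hom u v)
  ultimately show thesis by (rule that)
qed

text \<open>
  An \<open>A\<close>-linear map that is the identity modulo \<open>m\<close> is bijective: \<open>G = id - \<Phi>\<close> raises the level, so
  \<open>\<Phi> u = y\<close> is solved by iterating \<open>u \<mapsto> y + G u\<close>.
\<close>

lemma hom_linear_unipotent_bij:
  assumes \<Phi>: "hom_linear \<Phi>" and id: "\<And>s. s \<in> dual_hom \<Longrightarrow> \<Phi> s - s \<in> filtration 1"
  shows "bij_betw \<Phi> dual_hom dual_hom"
proof -
  define G where "G s = s - \<Phi> s" for s
  have G: "hom_linear G" unfolding G_def by (intro hom_linear_minus hom_linear_id \<Phi>)
  have "G s \<in> filtration 1" if "s \<in> dual_hom" for s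
    using filtration_diff[OF filtration_zero id[OF that]] by (simp add: G_def)
  then have raise: "G s \<in> filtration (Suc n)" if "s \<in> filtration n" for s n
    using hom_linear_filtration[OF G, of 1 s n] that by simp
  have "inj_on \<Phi> dual_hom"
  proof (rule inj_onI)
    fix s t assume s: "s \<in> dual_hom" and t: "t \<in> dual_hom" and eq: "\<Phi> s = \<Phi> t"
    have w: "G (s - t) = s - t"
      using hom_linear_diff[OF \<Phi> s t] eq by (simp add: G_def)
    have "s - t \<in> filtration n" for n
    proof (induction n)
      case 0
      have "s - t \<in> filtration 0" by (simp add: filtration_0 diff_in_hom s t)
      then show ?case .
    next
      case (Suc n) then show ?case using raise w by metis
    qed
    then have "s - t = 0" by (rule filtration_separated)
    then show "s = t" by simp
  qed
  moreover have "\<exists>u\<in>dual_hom. \<Phi> u = y" if y: "y \<in> dual_hom" for y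
  proof -
    define u where "u = rec_nat 0 (\<lambda>_ v. y + G v)"
    have u0: "u 0 = 0" and uS: "u (Suc k) = y + G (u k)" for k by (simp_all add: u_def)
    have u: "u k \<in> dual_hom" for k
    proof (induction k)
      case 0
      show ?case unfolding u0 by (rule zero_in_hom)
    next
      case (Suc k)
      then show ?case unfolding uS by (intro add_in_hom y hom_linear_in[OF G])
    qed
    have step: "u (Suc k) - u k \<in> filtration k" for k
    proof (induction k)
      case 0
      have "u (Suc 0) - u 0 \<in> filtration 0" by (simp add: filtration_0 diff_in_hom u)
      then show ?case .
    next
      case (Suc k)
      have "u (Suc (Suc k)) - u (Suc k) = G (u (Suc k) - u k)"
        by (simp add: hom_linear_diff[OF G u u]) (simp add: uS)
      moreover have "u (Suc k) - u k \<in> filtration k" by (rule Suc)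
      then have "G (u (Suc k) - u k) \<in> filtration (Suc k)" by (rule raise)
      ultimately have "u (Suc (Suc k)) - u (Suc k) \<in> filtration (Suc k)" by simp
      then show ?case .
    qed
    obtain v where v: "v \<in> dual_hom" "\<And>k. v - u k \<in> filtration k"
      by (rule filtration_limit[OF u step]) blast
    have "\<Phi> v - y \<in> filtration n" for n
    proof -
      have "\<Phi> v - y = (v - u (Suc n)) - G (v - u n)"
        by (simp add: hom_linear_diff[OF G v(1) u]) (simp add: uS G_def)
      moreover have "v - u (Suc n) \<in> filtration n"
        using v(2)[of "Suc n"] filtration_antimono[of n "Suc n"] by auto
      moreover have "G (v - u n) \<in> filtration n"
        by (rule hom_linear_continuous[OF G v(2)])
      ultimately show ?thesis by (simp add: filtration_diff)
    qed
    then have "\<Phi> v - y = 0" by (rule filtration_separated)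
    then show ?thesis using v(1) by (intro bexI[of _ v]) simp_all
  qed
  ultimately show ?thesis
    using hom_linear_in[OF \<Phi>] unfolding bij_betw_def by (auto simp: image_iff)
qed

end

section \<open>Removing obstructions degree by degree\<close>

context deformation_base
begin

text \<open>
  A Lie bracket on the model that agrees with the extended bracket modulo \<open>m\<close>.
\<close>

definition model_deformation ::
  "((('a \<Rightarrow> 'k) \<Rightarrow> 'l) \<Rightarrow> (('a \<Rightarrow> 'k) \<Rightarrow> 'l) \<Rightarrow> ('a \<Rightarrow> 'k) \<Rightarrow> 'l) \<Rightarrow> bool"
  where "model_deformation D \<longleftrightarrow>
    (\<forall>s\<in>dual_hom. hom_linear (\<lambda>t. D s t)) \<and> (\<forall>t\<in>dual_hom. hom_linear (\<lambda>s. D s t)) \<and>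
    (\<forall>t\<in>dual_hom. D t t = 0) \<and>
    (\<forall>s\<in>dual_hom. \<forall>t\<in>dual_hom. \<forall>u\<in>dual_hom. D s (D t u) + D t (D u s) + D u (D s t) = 0) \<and>
    (\<forall>s\<in>dual_hom. \<forall>t\<in>dual_hom. D s t - model_bracket s t \<in> filtration 1)"

text \<open>
  An \<open>A\<close>-linear map, the identity modulo \<open>m\<close>, that is a homomorphism from \<open>D\<close> to the extended bracket
  up to a defect in level \<open>n\<close>.
\<close>

definition approximate_equivalence ::
  "((('a \<Rightarrow> 'k) \<Rightarrow> 'l) \<Rightarrow> (('a \<Rightarrow> 'k) \<Rightarrow> 'l) \<Rightarrow> ('a \<Rightarrow> 'k) \<Rightarrow> 'l) \<Rightarrow> nat
    \<Rightarrow> ((('a \<Rightarrow> 'k) \<Rightarrow> 'l) \<Rightarrow> ('a \<Rightarrow> 'k) \<Rightarrow> 'l) \<Rightarrow> bool"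
  where "approximate_equivalence D n \<Phi> \<longleftrightarrow> hom_linear \<Phi> \<and> (\<forall>s\<in>dual_hom. \<Phi> s - s \<in> filtration 1) \<and>
    (\<forall>s\<in>dual_hom. \<forall>t\<in>dual_hom. \<Phi> (D s t) - model_bracket (\<Phi> s) (\<Phi> t) \<in> filtration n)"

lemma hom_linear_scale_eval:
  assumes "hom_linear F"
  shows "F (hom_const (scale c x)) \<beta> = scale c (F (hom_const x) \<beta>)"
  by (simp add: const_scale hom_linear_smult[OF assms const_in_hom] smult_scalar hom_linear_in[OF assms const_in_hom])

lemma hom_linear_add_eval:
  assumes "hom_linear F"
  shows "F (hom_const (x + y)) \<beta> = F (hom_const x) \<beta> + F (hom_const y) \<beta>"
  by (simp add: const_add hom_linear_add[OF assms const_in_hom const_in_hom])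

lemma defect_linear:
  assumes D: "model_deformation D" and \<Phi>: "hom_linear \<Phi>" and t: "t \<in> dual_hom"
  shows "hom_linear (\<lambda>s. \<Phi> (D s t) - model_bracket (\<Phi> s) (\<Phi> t))"
    and "hom_linear (\<lambda>s. \<Phi> (D t s) - model_bracket (\<Phi> t) (\<Phi> s))"
  using D t
  by (auto simp: model_deformation_def intro!: hom_linear_minus hom_linear_compose[OF \<Phi>]
      hom_linear_compose[OF model_bracket_linear_left \<Phi>] hom_linear_compose[OF model_bracket_linear_right \<Phi>]
      hom_linear_in[OF \<Phi>])

text \<open>
  The leading coefficients of the defect are cocycles.  With \<open>E(s, t) = \<Phi>(D(s, t)) - [\<Phi> s, \<Phi> t]\<close> one has
  \<open>\<Phi>(D(s, D(t, u))) = [\<Phi> s, [\<Phi> t, \<Phi> u]] + E(s, D(t, u)) + [\<Phi> s, E(t, u)]\<close>.  In the cyclic sum the left-hand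
  side and the first term on the right cancel by the Jacobi identities, and modulo level \<open>n + 1\<close> the
  rest is \<open>E(s, [t, u]) + [s, E(t, u)]\<close>.
\<close>

lemma obstruction_in_Z2:
  assumes D: "model_deformation D" and \<Phi>: "approximate_equivalence D n \<Phi>" and \<gamma>: "\<gamma> \<in> dual (Suc n)"
  shows "(\<lambda>x y. (\<Phi> (D (hom_const x) (hom_const y)) -
    model_bracket (\<Phi> (hom_const x)) (\<Phi> (hom_const y))) \<gamma>) \<in> Z2"
proof -
  have lin\<Phi>: "hom_linear \<Phi>" and \<Phi>1: "\<And>s. s \<in> dual_hom \<Longrightarrow> \<Phi> s - s \<in> filtration 1"
    and \<Phi>n: "\<And>s t. s \<in> dual_hom \<Longrightarrow> t \<in> dual_hom \<Longrightarrow> \<Phi> (D s t) - model_bracket (\<Phi> s) (\<Phi> t) \<in> filtration n"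
    using \<Phi> by (auto simp: approximate_equivalence_def)
  define E where "E s t = \<Phi> (D s t) - model_bracket (\<Phi> s) (\<Phi> t)" for s t
  have Elin: "hom_linear (\<lambda>s. E s t)" "hom_linear (\<lambda>s. E t s)" if "t \<in> dual_hom" for t
    unfolding E_def by (rule defect_linear[OF D lin\<Phi> that])+
  have En: "E s t \<in> filtration n" if "s \<in> dual_hom" "t \<in> dual_hom" for s t
    unfolding E_def by (rule \<Phi>n[OF that])
  have \<Phi>in: "\<Phi> s \<in> dual_hom" if "s \<in> dual_hom" for s by (rule hom_linear_in[OF lin\<Phi> that])
  have Din: "D s t \<in> dual_hom" if "s \<in> dual_hom" "t \<in> dual_hom" for s t
    using D that by (auto simp: model_deformation_def intro: hom_linear_in)
  have Eself: "E t t = 0" if "t \<in> dual_hom" for t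
    using D that by (simp add: E_def model_deformation_def hom_linear_zero[OF lin\<Phi>] model_bracket_self \<Phi>in)
  define \<psi> where "\<psi> x y = E (hom_const x) (hom_const y) \<gamma>" for x y
  have C2: "\<psi> \<in> C2"
    unfolding C2_iff \<psi>_def
    by (simp add: hom_linear_add_eval[OF Elin(1)[OF const_in_hom]] hom_linear_add_eval[OF Elin(2)[OF const_in_hom]]
        hom_linear_scale_eval[OF Elin(1)[OF const_in_hom]] hom_linear_scale_eval[OF Elin(2)[OF const_in_hom]]
        Eself const_in_hom)
  have r: "\<Phi> (D s (D t u)) - model_bracket (\<Phi> s) (model_bracket (\<Phi> t) (\<Phi> u))
    - (E s (model_bracket t u) + model_bracket s (E t u)) \<in> filtration (Suc n)"
    if s: "s \<in> dual_hom" and t: "t \<in> dual_hom" and u: "u \<in> dual_hom" for s t u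
  proof -
    note E = filtration_hom[OF En[OF t u]]
    note B = model_bracket_in_hom[OF \<Phi>in[OF t] \<Phi>in[OF u]]
    have "E s (D t u) - E s (model_bracket t u) = E s (D t u - model_bracket t u)"
      by (rule hom_linear_diff[OF Elin(2)[OF s], symmetric]) (simp_all add: Din t u model_bracket_in_hom)
    moreover have "E s (D t u - model_bracket t u) \<in> filtration (1 + n)"
      using D s t u by (intro hom_linear_filtration[OF Elin(2)[OF s] En[OF s]]) (simp_all add: model_deformation_def)
    ultimately have 1: "E s (D t u) - E s (model_bracket t u) \<in> filtration (Suc n)" by simp
    have "model_bracket (\<Phi> s) (E t u) - model_bracket s (E t u) = model_bracket (\<Phi> s - s) (E t u)"
      by (rule hom_linear_diff[OF model_bracket_linear_left[OF E], symmetric]) (simp_all add: \<Phi>in s)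
    moreover have "model_bracket (\<Phi> s - s) (E t u) \<in> filtration (1 + n)"
      by (rule model_bracket_filtration[OF \<Phi>1[OF s] En[OF t u]])
    ultimately have 2: "model_bracket (\<Phi> s) (E t u) - model_bracket s (E t u) \<in> filtration (Suc n)" by simp
    have "\<Phi> (D t u) = E t u + model_bracket (\<Phi> t) (\<Phi> u)" by (simp add: E_def)
    then have "model_bracket (\<Phi> s) (\<Phi> (D t u)) =
        model_bracket (\<Phi> s) (E t u) + model_bracket (\<Phi> s) (model_bracket (\<Phi> t) (\<Phi> u))"
      using hom_linear_add[OF model_bracket_linear_right[OF \<Phi>in[OF s]] E B] by simp
    then have "\<Phi> (D s (D t u)) - model_bracket (\<Phi> s) (model_bracket (\<Phi> t) (\<Phi> u))
      - (E s (model_bracket t u) + model_bracket s (E t u))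
      = (E s (D t u) - E s (model_bracket t u)) + (model_bracket (\<Phi> s) (E t u) - model_bracket s (E t u))"
      by (simp add: E_def[of s "D t u"])
    also have "\<dots> \<in> filtration (Suc n)" by (rule filtration_add[OF 1 2])
    finally show ?thesis .
  qed
  have coc: "\<psi> x (bracket y z) + bracket x (\<psi> y z) + (\<psi> y (bracket z x) + bracket y (\<psi> z x))
    + (\<psi> z (bracket x y) + bracket z (\<psi> x y)) = 0" for x y z
  proof -
    define X Y Z where "X = hom_const x" and "Y = hom_const y" and "Z = hom_const z"
    have XYZ: "X \<in> dual_hom" "Y \<in> dual_hom" "Z \<in> dual_hom" by (simp_all add: X_def Y_def Z_def const_in_hom)
    define R where "R s t u = E s (model_bracket t u) + model_bracket s (E t u)" for s t u
    have "D X (D Y Z) + D Y (D Z X) + D Z (D X Y) = 0"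
      using D XYZ unfolding model_deformation_def by blast
    then have "\<Phi> (D X (D Y Z) + D Y (D Z X) + D Z (D X Y)) = 0" by (simp only: hom_linear_zero[OF lin\<Phi>])
    then have d: "\<Phi> (D X (D Y Z)) + \<Phi> (D Y (D Z X)) + \<Phi> (D Z (D X Y)) = 0"
      by (simp add: hom_linear_add[OF lin\<Phi>] Din XYZ add_in_hom)
    have b: "model_bracket (\<Phi> X) (model_bracket (\<Phi> Y) (\<Phi> Z)) + model_bracket (\<Phi> Y) (model_bracket (\<Phi> Z) (\<Phi> X))
      + model_bracket (\<Phi> Z) (model_bracket (\<Phi> X) (\<Phi> Y)) = 0"
      by (rule model_bracket_jacobi) (simp_all add: \<Phi>in XYZ)
    have sum: "(d1 - b1 - r1) + (d2 - b2 - r2) + (d3 - b3 - r3) = - (r1 + r2 + r3)"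
      if "d1 + d2 + d3 = 0" "b1 + b2 + b3 = 0" for d1 d2 d3 b1 b2 b3 r1 r2 r3 :: "('a \<Rightarrow> 'k) \<Rightarrow> 'l"
    proof -
      have "(d1 - b1 - r1) + (d2 - b2 - r2) + (d3 - b3 - r3) = (d1 + d2 + d3) - (b1 + b2 + b3) - (r1 + r2 + r3)"
        by (simp add: algebra_simps)
      then show ?thesis by (simp only: that) simp
    qed
    have "- (R X Y Z + R Y Z X + R Z X Y) \<in> filtration (Suc n)"
      unfolding R_def sum[OF d b, symmetric] by (intro filtration_add r XYZ)
    then have "- (R X Y Z + R Y Z X + R Z X Y) \<gamma> = 0" by (rule filtration_eval[OF _ \<gamma>, THEN trans[rotated]]) simp
    then have "- (R X Y Z \<gamma> + R Y Z X \<gamma> + R Z X Y \<gamma>) = 0"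
      by (simp only: uminus_apply plus_fun_apply)
    then have "R X Y Z \<gamma> + R Y Z X \<gamma> + R Z X Y \<gamma> = 0"
      by (simp only: neg_equal_0_iff_equal)
    moreover have "R (hom_const x) (hom_const y) (hom_const z) \<gamma> = \<psi> x (bracket y z) + bracket x (\<psi> y z)" for x y z
      using filtration_hom[OF En[OF const_in_hom const_in_hom]]
      by (simp add: R_def model_bracket_const \<psi>_def model_bracket_const_left)
    ultimately show ?thesis by (simp add: X_def Y_def Z_def)
  qed
  have "d2 \<psi> x y z = 0" for x y z
    using coc[of x y z] C2_anti[OF C2, of "bracket x y" z] C2_anti[OF C2, of "bracket y z" x]
      C2_anti[OF C2, of x z] bracket_anti[of x z] C2_anti[OF C2, of "bracket x z" y]
      C2_anti[OF C2, of "bracket z x" y]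
      C2_scale_right[OF C2, of y "-1" "bracket z x"]
    by (simp add: d2_def bracket_minus_right algebra_simps)
  then have "\<psi> \<in> Z2" using C2 by (simp add: Z2_def)
  then show ?thesis by (simp add: \<psi>_def[abs_def] E_def)
qed

text \<open>
  The corrected map is \<open>\<Phi> + F\<close>, where \<open>F\<close> is the \<open>A\<close>-linear extension of \<open>\<Sum> c \<phi>\<^sub>c\<close> and \<open>\<phi>\<^sub>c\<close> is a primitive
  of the cocycle at the coordinate \<open>\<gamma>\<^sub>c\<close>.  The term \<open>[F s, F t]\<close> lies in level \<open>2 n\<close>, which is contained
  in level \<open>n + 1\<close> because \<open>n \<ge> 1\<close>.
\<close>

lemma approximate_equivalence_step:
  assumes H2: "Z2 \<subseteq> B2" and D: "model_deformation D" and n: "1 \<le> n" and \<Phi>: "approximate_equivalence D n \<Phi>"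
  obtains \<Phi>' where "approximate_equivalence D (Suc n) \<Phi>'" "\<And>s. s \<in> dual_hom \<Longrightarrow> \<Phi>' s - \<Phi> s \<in> filtration n"
proof -
  have lin\<Phi>: "hom_linear \<Phi>" and \<Phi>1: "\<And>s. s \<in> dual_hom \<Longrightarrow> \<Phi> s - s \<in> filtration 1"
    and \<Phi>n: "\<And>s t. s \<in> dual_hom \<Longrightarrow> t \<in> dual_hom \<Longrightarrow> \<Phi> (D s t) - model_bracket (\<Phi> s) (\<Phi> t) \<in> filtration n"
    using \<Phi> by (auto simp: approximate_equivalence_def)
  have \<Phi>in: "\<Phi> s \<in> dual_hom" if "s \<in> dual_hom" for s by (rule hom_linear_in[OF lin\<Phi> that])
  have Din: "D s t \<in> dual_hom" if "s \<in> dual_hom" "t \<in> dual_hom" for s t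
    using D that by (auto simp: model_deformation_def intro: hom_linear_in)
  obtain C \<gamma> where C: "finite C" "C \<subseteq> ideal_power m n" and \<gamma>: "\<And>c. c \<in> C \<Longrightarrow> \<gamma> c \<in> dual (Suc n)"
    and frame: "\<And>a. a \<in> ideal_power m n \<Longrightarrow> a - (\<Sum>c\<in>C. scaleA (\<gamma> c a) c) \<in> ideal_power m (Suc n)"
    by (rule A.graded_frame_exists) blast
  define \<psi> where "\<psi> c x y = (\<Phi> (D (hom_const x) (hom_const y)) -
    model_bracket (\<Phi> (hom_const x)) (\<Phi> (hom_const y))) (\<gamma> c)" for c x y
  have "\<psi> c \<in> B2" if "c \<in> C" for c
    unfolding \<psi>_def[abs_def] using H2 obstruction_in_Z2[OF D \<Phi> \<gamma>[OF that]] by blast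
  then have "\<forall>c\<in>C. \<exists>\<phi>\<in>C1. \<psi> c = d1 \<phi>" by (auto simp: B2_def)
  then obtain \<phi> where \<phi>: "\<And>c. c \<in> C \<Longrightarrow> \<phi> c \<in> C1" "\<And>c. c \<in> C \<Longrightarrow> \<psi> c = d1 (\<phi> c)" by metis
  define F where "F s = (\<Sum>c\<in>C. hom_smult c (\<lambda>\<beta>. \<phi> c (s \<beta>)))" for s
  have comp: "(\<lambda>\<beta>. \<phi> c (s \<beta>)) \<in> dual_hom" if "c \<in> C" "s \<in> dual_hom" for c s
    using that \<phi>(1)[OF that(1)] by (simp add: dual_hom_def C1_add C1_scale C1_zero)
  have Fn: "F s \<in> filtration n" if "s \<in> dual_hom" for s
    unfolding F_def using C(2) comp that by (intro filtration_sum smult_in_filtration) auto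
  have linF: "hom_linear F"
    unfolding hom_linear_def
  proof (intro conjI ballI allI)
    fix s assume s: "s \<in> dual_hom"
    show "F s \<in> dual_hom" by (rule filtration_hom[OF Fn[OF s]])
    fix t
    have "(\<lambda>\<beta>. \<phi> c ((s + t) \<beta>)) = (\<lambda>\<beta>. \<phi> c (s \<beta>)) + (\<lambda>\<beta>. \<phi> c (t \<beta>))" if "c \<in> C" for c
      using C1_add[OF \<phi>(1)[OF that]] by (simp add: fun_eq_iff)
    then show "F (s + t) = F s + F t"
      unfolding F_def sum.distrib[symmetric] by (intro sum.cong refl) (simp only: smult_add_right)
  next
    fix a s assume s: "s \<in> dual_hom"
    have "(\<lambda>\<beta>. \<phi> c (hom_smult a s \<beta>)) = hom_smult a (\<lambda>\<beta>. \<phi> c (s \<beta>))" if "c \<in> C" for c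
      using C1_zero[OF \<phi>(1)[OF that]] by (simp add: fun_eq_iff hom_smult_def)
    then show "F (hom_smult a s) = hom_smult a (F s)"
      unfolding F_def smult_sum_right by (intro sum.cong refl) (simp only: smult_assoc mult.commute)
  qed
  have Fin: "F s \<in> dual_hom" if "s \<in> dual_hom" for s by (rule filtration_hom[OF Fn[OF that]])
  have Fconst: "F (hom_const x) \<beta> = (\<Sum>c\<in>C. scale (\<beta> c) (\<phi> c x))" if "\<beta> \<in> continuous_dual" for x \<beta>
  proof -
    have "(\<lambda>\<beta>. \<phi> c (hom_const x \<beta>)) = hom_const (\<phi> c x)" if "c \<in> C" for c
      using C1_zero[OF \<phi>(1)[OF that]] C1_scale[OF \<phi>(1)[OF that]] by (simp add: fun_eq_iff hom_const_def)
    then have "F (hom_const x) = (\<Sum>c\<in>C. hom_smult c (hom_const (\<phi> c x)))"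
      unfolding F_def by (intro sum.cong refl) (simp only:)
    then show ?thesis using that by (simp add: sum_apply smult_const)
  qed
  define \<Phi>' where "\<Phi>' s = \<Phi> s + F s" for s
  have lin\<Phi>': "hom_linear \<Phi>'" unfolding \<Phi>'_def by (rule hom_linear_plus[OF lin\<Phi> linF])
  define E where "E s t = \<Phi>' (D s t) - model_bracket (\<Phi>' s) (\<Phi>' t)" for s t
  have Elin: "hom_linear (\<lambda>s. E s t)" "hom_linear (\<lambda>s. E t s)" if "t \<in> dual_hom" for t
    unfolding E_def by (rule defect_linear[OF D lin\<Phi>' that])+
  have Econst: "E (hom_const x) (hom_const y) \<in> filtration (Suc n)" for x y
  proof -
    define X Y where "X = hom_const x" and "Y = hom_const y"
    have XY: "X \<in> dual_hom" "Y \<in> dual_hom" by (simp_all add: X_def Y_def const_in_hom)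
    define e where "e = \<Phi> (D X Y) - model_bracket (\<Phi> X) (\<Phi> Y)"
    have e: "e \<in> filtration n" unfolding e_def by (rule \<Phi>n[OF XY])
    \<comment> \<open>The leading part of the new defect; it lies in level \<open>n + 1\<close> because \<open>\<psi> c\<close> is the coboundary of \<open>\<phi> c\<close>.\<close>
    define w where "w = e + F (hom_const (bracket x y)) - model_bracket (F X) Y - model_bracket X (F Y)"
    have r1: "F (D X Y - hom_const (bracket x y)) \<in> filtration (1 + n)"
      using D XY unfolding model_bracket_const[symmetric] X_def[symmetric] Y_def[symmetric]
      by (intro hom_linear_filtration[OF linF Fn]) (auto simp: model_deformation_def)
    have r2: "model_bracket (F X) (\<Phi> Y - Y) \<in> filtration (n + 1)"
      by (intro model_bracket_filtration Fn \<Phi>1 XY)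
    have r3: "model_bracket (\<Phi> X - X) (F Y) \<in> filtration (1 + n)"
      by (intro model_bracket_filtration Fn \<Phi>1 XY)
    have "model_bracket (F X) (F Y) \<in> filtration (n + n)"
      by (intro model_bracket_filtration Fn XY)
    then have r4: "model_bracket (F X) (F Y) \<in> filtration (Suc n)"
      using n filtration_antimono[of "Suc n" "n + n"] by auto
    have "E X Y = w + F (D X Y - hom_const (bracket x y)) - model_bracket (F X) (\<Phi> Y - Y)
      - model_bracket (\<Phi> X - X) (F Y) - model_bracket (F X) (F Y)"
      using XY
      by (simp add: E_def \<Phi>'_def w_def e_def hom_linear_diff[OF linF] Din const_in_hom \<Phi>in Fin
          hom_linear_diff[OF model_bracket_linear_left] hom_linear_diff[OF model_bracket_linear_right]
          hom_linear_add[OF model_bracket_linear_left] hom_linear_add[OF model_bracket_linear_right]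
          add_in_hom)
    moreover have "w \<in> filtration (Suc n)"
    proof -
      have "w \<beta> = 0" if \<beta>: "\<beta> \<in> dual (Suc n)" for \<beta>
      proof -
        note cd = A.continuous_dualI[OF \<beta>]
        have \<gamma>cd: "\<gamma> c \<in> continuous_dual" if "c \<in> C" for c by (rule A.continuous_dualI[OF \<gamma>[OF that]])
        have s: "(\<lambda>a. \<Sum>c\<in>C. \<beta> c * \<gamma> c a) \<in> continuous_dual"
          by (rule A.continuous_dualI, rule A.sum_in_dual) (rule \<gamma>)
        have "e (\<beta> - (\<lambda>a. \<Sum>c\<in>C. \<beta> c * \<gamma> c a)) = 0"
          by (rule filtration_eval[OF e]) (rule A.graded_frame_expand[OF C \<gamma> frame \<beta>])
        then have "e \<beta> = e (\<lambda>a. \<Sum>c\<in>C. \<beta> c * \<gamma> c a)"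
          using hom_diff_arg[OF filtration_hom[OF e] cd s] by simp
        also have "\<dots> = (\<Sum>c\<in>C. scale (\<beta> c) (e (\<gamma> c)))"
          using \<gamma>cd by (intro hom_combination_arg filtration_hom[OF e])
        also have "\<dots> = (\<Sum>c\<in>C. scale (\<beta> c) (d1 (\<phi> c) x y))"
          by (intro sum.cong refl) (simp add: \<phi>(2)[symmetric] \<psi>_def e_def X_def Y_def)
        finally have "w \<beta> = (\<Sum>c\<in>C. scale (\<beta> c) (d1 (\<phi> c) x y)) + (\<Sum>c\<in>C. scale (\<beta> c) (\<phi> c (bracket x y)))
          - bracket (\<Sum>c\<in>C. scale (\<beta> c) (\<phi> c x)) y - bracket x (\<Sum>c\<in>C. scale (\<beta> c) (\<phi> c y))"
          using XY by (simp add: w_def Fconst[OF cd] X_def Y_def model_bracket_const_left model_bracket_const_right Fin const_in_hom)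
        also have "\<dots> = (\<Sum>c\<in>C. scale (\<beta> c) (d1 (\<phi> c) x y + \<phi> c (bracket x y) - bracket (\<phi> c x) y - bracket x (\<phi> c y)))"
          by (simp add: bracket_sum_left bracket_sum_right bracket_scale_left bracket_scale_right
              sum.distrib sum_subtractf scale_right_distrib scale_right_diff_distrib)
        also have "\<dots> = 0"
          using bracket_anti[of y] by (intro sum.neutral) (simp add: d1_def)
        finally show ?thesis .
      qed
      moreover have "w \<in> dual_hom"
        unfolding w_def using XY e
        by (intro diff_in_hom add_in_hom filtration_hom[OF e] Fin const_in_hom model_bracket_in_hom)
      ultimately show ?thesis by (simp add: filtration_def)
    qed
    ultimately have "E X Y \<in> filtration (Suc n)"
      using r1 r2 r3 r4 by (simp only: add_Suc add_Suc_right One_nat_def add_0_left add_0_right) (intro filtration_diff filtration_add; simp)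
    then show ?thesis by (simp add: X_def Y_def)
  qed
  have "E (hom_const x) t \<in> filtration (Suc n)" if "t \<in> dual_hom" for x t
    by (rule hom_linear_determined[OF Elin(2)[OF const_in_hom] Econst that])
  then have "E s t \<in> filtration (Suc n)" if "s \<in> dual_hom" "t \<in> dual_hom" for s t
    using that by (intro hom_linear_determined[OF Elin(1)[OF that(2)] _ that(1)])
  moreover have "\<Phi>' s - s \<in> filtration 1" if "s \<in> dual_hom" for s
  proof -
    have "F s \<in> filtration 1" using Fn[OF that] filtration_antimono[OF n] by blast
    then have "(\<Phi> s - s) + F s \<in> filtration 1" by (rule filtration_add[OF \<Phi>1[OF that]])
    then show ?thesis by (simp add: \<Phi>'_def algebra_simps)
  qed
  ultimately have "approximate_equivalence D (Suc n) \<Phi>'"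
    using lin\<Phi>' by (simp add: approximate_equivalence_def E_def)
  then show thesis using Fn by (intro that[of \<Phi>']) (simp_all add: \<Phi>'_def)
qed

theorem model_rigidity:
  assumes H2: "Z2 \<subseteq> B2" and D: "model_deformation D"
  obtains \<Phi> where "hom_linear \<Phi>" "bij_betw \<Phi> dual_hom dual_hom"
    "\<And>s. s \<in> dual_hom \<Longrightarrow> \<Phi> s - s \<in> filtration 1"
    "\<And>s t. s \<in> dual_hom \<Longrightarrow> t \<in> dual_hom \<Longrightarrow> \<Phi> (D s t) = model_bracket (\<Phi> s) (\<Phi> t)"
proof -
  have "\<exists>f. \<forall>k. approximate_equivalence D (Suc k) (f k) \<and> (\<forall>s\<in>dual_hom. f (Suc k) s - f k s \<in> filtration (Suc k))"
  proof (rule dependent_nat_choice)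
    have "approximate_equivalence D 1 (\<lambda>s. s)"
      using D hom_linear_id by (simp add: approximate_equivalence_def model_deformation_def filtration_zero)
    then show "\<exists>\<Phi>. approximate_equivalence D (Suc 0) \<Phi>" by auto
    fix \<Phi> k assume "approximate_equivalence D (Suc k) \<Phi>"
    then obtain \<Phi>' where "approximate_equivalence D (Suc (Suc k)) \<Phi>'"
      "\<And>s. s \<in> dual_hom \<Longrightarrow> \<Phi>' s - \<Phi> s \<in> filtration (Suc k)"
      by (rule approximate_equivalence_step[OF H2 D, rotated]) auto
    then show "\<exists>\<Phi>'. approximate_equivalence D (Suc (Suc k)) \<Phi>' \<and> (\<forall>s\<in>dual_hom. \<Phi>' s - \<Phi> s \<in> filtration (Suc k))"
      by blast
  qed
  then obtain f where f: "\<And>k. approximate_equivalence D (Suc k) (f k)"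
    and step: "\<And>k s. s \<in> dual_hom \<Longrightarrow> f (Suc k) s - f k s \<in> filtration (Suc k)" by blast
  have flin: "hom_linear (f k)" for k using f by (simp add: approximate_equivalence_def)
  have "\<exists>v. v \<in> dual_hom \<and> (\<forall>k. v - f k s \<in> filtration k)" if "s \<in> dual_hom" for s
  proof -
    have "f (Suc k) s - f k s \<in> filtration k" for k
      using step[OF that] filtration_antimono[of k "Suc k"] by auto
    then show ?thesis
      using filtration_limit[of "\<lambda>k. f k s"] hom_linear_in[OF flin that] by metis
  qed
  then obtain \<Phi> where \<Phi>: "\<And>s. s \<in> dual_hom \<Longrightarrow> \<Phi> s \<in> dual_hom"
    and lim: "\<And>s k. s \<in> dual_hom \<Longrightarrow> \<Phi> s - f k s \<in> filtration k" by metis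
  have lin: "hom_linear \<Phi>"
    unfolding hom_linear_def
  proof (intro conjI ballI allI)
    fix s assume s: "s \<in> dual_hom"
    show "\<Phi> s \<in> dual_hom" by (rule \<Phi>[OF s])
    fix t assume t: "t \<in> dual_hom"
    have "\<Phi> (s + t) - (\<Phi> s + \<Phi> t) \<in> filtration k" for k
    proof -
      have "\<Phi> (s + t) - (\<Phi> s + \<Phi> t) = (\<Phi> (s + t) - f k (s + t)) - (\<Phi> s - f k s) - (\<Phi> t - f k t)"
        by (simp add: hom_linear_add[OF flin s t])
      also have "\<dots> \<in> filtration k"
        by (intro filtration_diff lim add_in_hom s t)
      finally show ?thesis .
    qed
    then have "\<Phi> (s + t) - (\<Phi> s + \<Phi> t) = 0" by (rule filtration_separated)
    then show "\<Phi> (s + t) = \<Phi> s + \<Phi> t" by simp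
  next
    fix a s assume s: "s \<in> dual_hom"
    have "\<Phi> (hom_smult a s) - hom_smult a (\<Phi> s) \<in> filtration k" for k
    proof -
      have "\<Phi> (hom_smult a s) - hom_smult a (\<Phi> s) =
        (\<Phi> (hom_smult a s) - f k (hom_smult a s)) - hom_smult a (\<Phi> s - f k s)"
        by (simp add: hom_linear_smult[OF flin s] smult_diff_right)
      also have "\<dots> \<in> filtration k"
        by (intro filtration_diff filtration_smult_same lim smult_in_hom s)
      finally show ?thesis .
    qed
    then have "\<Phi> (hom_smult a s) - hom_smult a (\<Phi> s) = 0" by (rule filtration_separated)
    then show "\<Phi> (hom_smult a s) = hom_smult a (\<Phi> s)" by simp
  qed
  have one: "\<Phi> s - s \<in> filtration 1" if "s \<in> dual_hom" for s
  proof -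
    have "f 1 s - s \<in> filtration 1" using f[of 1] that by (simp add: approximate_equivalence_def)
    from filtration_add[OF lim[OF that, of 1] this] show ?thesis by simp
  qed
  have hom: "\<Phi> (D s t) = model_bracket (\<Phi> s) (\<Phi> t)" if s: "s \<in> dual_hom" and t: "t \<in> dual_hom" for s t
  proof -
    have Dst: "D s t \<in> dual_hom" using D s t by (auto simp: model_deformation_def intro: hom_linear_in)
    have "\<Phi> (D s t) - model_bracket (\<Phi> s) (\<Phi> t) \<in> filtration k" for k
    proof -
      note fs = hom_linear_in[OF flin s, of k] and ft = hom_linear_in[OF flin t, of k]
      have 1: "f k (D s t) - model_bracket (f k s) (f k t) \<in> filtration k"
        using f[of k] s t filtration_antimono[of k "Suc k"] by (auto simp: approximate_equivalence_def)
      have 2: "model_bracket (\<Phi> s - f k s) (\<Phi> t) \<in> filtration k"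
        by (rule hom_linear_continuous[OF model_bracket_linear_left[OF \<Phi>[OF t]] lim[OF s]])
      have 3: "model_bracket (f k s) (\<Phi> t - f k t) \<in> filtration k"
        by (rule hom_linear_continuous[OF model_bracket_linear_right[OF fs] lim[OF t]])
      have "\<Phi> (D s t) - model_bracket (\<Phi> s) (\<Phi> t) = (\<Phi> (D s t) - f k (D s t))
        + (f k (D s t) - model_bracket (f k s) (f k t)) - model_bracket (\<Phi> s - f k s) (\<Phi> t)
        - model_bracket (f k s) (\<Phi> t - f k t)"
        by (simp add: hom_linear_diff[OF model_bracket_linear_left[OF \<Phi>[OF t]] \<Phi>[OF s] fs]
            hom_linear_diff[OF model_bracket_linear_right[OF fs] \<Phi>[OF t] ft])
      also have "\<dots> \<in> filtration k"
        by (intro filtration_diff filtration_add lim Dst 1 2 3)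
      finally show ?thesis .
    qed
    then have "\<Phi> (D s t) - model_bracket (\<Phi> s) (\<Phi> t) = 0" by (rule filtration_separated)
    then show ?thesis by simp
  qed
  show thesis
    by (rule that[OF lin hom_linear_unipotent_bij[OF lin one] one hom])
qed

end

section \<open>Comparison with the completed tensor product\<close>

context deformation_base
begin

lemma tensor_rel_zero: "0 \<in> tensor_rel n"
  unfolding tensor_rel_def by (rule subgroup_generated_by.zero)

lemma tensor_rel_diff: "f \<in> tensor_rel n \<Longrightarrow> g \<in> tensor_rel n \<Longrightarrow> f - g \<in> tensor_rel n"
  unfolding tensor_rel_def by (rule subgroup_generated_by.diff)

lemma tensor_rel_minus: "f \<in> tensor_rel n \<Longrightarrow> - f \<in> tensor_rel n"
  using tensor_rel_diff[OF tensor_rel_zero] by fastforce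

lemma tensor_rel_add: "f \<in> tensor_rel n \<Longrightarrow> g \<in> tensor_rel n \<Longrightarrow> f + g \<in> tensor_rel n"
  using tensor_rel_diff[OF _ tensor_rel_minus] by fastforce

lemma tensor_rel_generators:
  "frag_of (a + b, x) - frag_of (a, x) - frag_of (b, x) \<in> tensor_rel n"
  "frag_of (a, x + y) - frag_of (a, x) - frag_of (a, y) \<in> tensor_rel n"
  "frag_of (scaleA c a, x) - frag_of (a, scale c x) \<in> tensor_rel n"
  "a - b \<in> ideal_power m n \<Longrightarrow> frag_of (a, x) - frag_of (b, x) \<in> tensor_rel n"
  unfolding tensor_rel_def by (rule subgroup_generated_by.incl; blast)+

lemma tensor_rel_induct [consumes 1, case_names zero add_left add_right scale power diff]:
  assumes "f \<in> tensor_rel n" "P 0"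
    "\<And>a b x. P (frag_of (a + b, x) - frag_of (a, x) - frag_of (b, x))"
    "\<And>a x y. P (frag_of (a, x + y) - frag_of (a, x) - frag_of (a, y))"
    "\<And>c a x. P (frag_of (scaleA c a, x) - frag_of (a, scale c x))"
    "\<And>a b x. a - b \<in> ideal_power m n \<Longrightarrow> P (frag_of (a, x) - frag_of (b, x))"
    "\<And>f g. P f \<Longrightarrow> P g \<Longrightarrow> P (f - g)"
  shows "P f"
  using assms(1) unfolding tensor_rel_def
  by (induction rule: subgroup_generated_by.induct) (use assms(2-) in blast)+

lemma tensor_rel_antimono:
  assumes "n \<le> p" shows "tensor_rel p \<subseteq> tensor_rel n"
proof
  fix f assume "f \<in> tensor_rel p"
  then show "f \<in> tensor_rel n"
    by (induction rule: tensor_rel_induct)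
      (use A.ideal_power_antimono[OF assms] in \<open>auto intro: tensor_rel_zero tensor_rel_generators tensor_rel_diff\<close>)
qed

lemma coset_eq_iff: "f +o tensor_rel n = g +o tensor_rel n \<longleftrightarrow> f - g \<in> tensor_rel n"
proof
  assume "f +o tensor_rel n = g +o tensor_rel n"
  moreover have "f \<in> f +o tensor_rel n"
    using set_plus_intro2[OF tensor_rel_zero, of f n] by simp
  ultimately show "f - g \<in> tensor_rel n" using set_plus_imp_minus by blast
next
  assume *: "f - g \<in> tensor_rel n"
  have sub: "f +o tensor_rel n \<subseteq> g +o tensor_rel n" if "f - g \<in> tensor_rel n" for f g
  proof
    fix h assume "h \<in> f +o tensor_rel n"
    then obtain r where r: "r \<in> tensor_rel n" "h = f + r" by (auto simp: elt_set_plus_def)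
    then have "h = g + ((f - g) + r)" by simp
    then show "h \<in> g +o tensor_rel n"
      using tensor_rel_add[OF that r(1)] by (metis set_plus_intro2)
  qed
  have "g - f \<in> tensor_rel n" using tensor_rel_minus[OF *] by simp
  with * show "f +o tensor_rel n = g +o tensor_rel n" using sub by blast
qed

lemma coset_self: "f \<in> f +o tensor_rel n"
  using set_plus_intro2[OF tensor_rel_zero, of f n] by simp

lemma tensor_rel_plus_self: "tensor_rel n + tensor_rel n = tensor_rel n"
  using tensor_rel_add tensor_rel_zero by (auto elim!: set_plus_elim) (metis add_0_left set_plus_intro)

lemma ctensor_coset:
  assumes "t \<in> ctensor" "f \<in> t n" shows "t n = f +o tensor_rel n"
proof -
  obtain g where g: "t n = g +o tensor_rel n" using assms(1) unfolding ctensor_def inverse_limit_def by blast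
  with assms(2) have "f - g \<in> tensor_rel n" using set_plus_imp_minus by blast
  then show ?thesis using g coset_eq_iff by metis
qed

lemma ctensor_nonempty:
  assumes "t \<in> ctensor" obtains f where "f \<in> t n"
proof -
  obtain g where "t n = g +o tensor_rel n" using assms unfolding ctensor_def inverse_limit_def by blast
  then show thesis using coset_self[of g n] by (intro that[of g]) simp
qed

lemma ctensor_antimono:
  assumes "t \<in> ctensor" "n \<le> p" shows "t p \<subseteq> t n"
  using assms(2) by (induction p rule: dec_induct) (use assms(1) in \<open>auto simp: ctensor_def inverse_limit_def\<close>)

text \<open>
  Elements of the inverse limit are given by sequences of representatives that are compatible modulo
  the relations.
\<close>

lemma ctensorI:
  assumes "\<And>n. t n = f n +o tensor_rel n" "\<And>n. f (Suc n) - f n \<in> tensor_rel n"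
  shows "t \<in> ctensor"
proof -
  have "t (Suc n) \<subseteq> t n" for n
  proof -
    have "t (Suc n) \<subseteq> f (Suc n) +o tensor_rel n"
      unfolding assms(1) using tensor_rel_antimono[of n "Suc n"] by (intro set_plus_mono) simp
    also have "\<dots> = t n" unfolding assms(1) coset_eq_iff by (rule assms(2))
    finally show ?thesis .
  qed
  then show ?thesis using assms(1) by (auto simp: ctensor_def inverse_limit_def)
qed

lemma ctensor_representatives:
  assumes "t \<in> ctensor"
  obtains f where "\<And>n. f n \<in> t n" "\<And>n. t n = f n +o tensor_rel n" "\<And>n. f (Suc n) - f n \<in> tensor_rel n"
proof -
  have "\<forall>n. \<exists>f. f \<in> t n" using ctensor_nonempty[OF assms] by metis
  then obtain f where f: "\<And>n. f n \<in> t n" by metis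
  have c: "t n = f n +o tensor_rel n" for n by (rule ctensor_coset[OF assms f])
  have "f (Suc n) \<in> f n +o tensor_rel n" for n
    using f[of "Suc n"] ctensor_antimono[OF assms, of n "Suc n"] c[of n] by auto
  then have "f (Suc n) - f n \<in> tensor_rel n" for n by (rule set_plus_imp_minus)
  with f c show thesis by (rule that)
qed

lemma ct_zero_in: "ct_zero \<in> ctensor"
  by (rule ctensorI[of _ "\<lambda>_. 0"]) (simp_all add: ct_zero_def tensor_rel_zero)

lemma ct_add_in:
  assumes "s \<in> ctensor" "t \<in> ctensor" shows "ct_add s t \<in> ctensor"
proof -
  obtain f where f: "\<And>n. s n = f n +o tensor_rel n" "\<And>n. f (Suc n) - f n \<in> tensor_rel n"
    by (rule ctensor_representatives[OF assms(1)]) blast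
  obtain g where g: "\<And>n. t n = g n +o tensor_rel n" "\<And>n. g (Suc n) - g n \<in> tensor_rel n"
    by (rule ctensor_representatives[OF assms(2)]) blast
  show ?thesis
  proof (rule ctensorI[of _ "\<lambda>n. f n + g n"])
    show "ct_add s t n = (f n + g n) +o tensor_rel n" for n
      by (simp add: ct_add_def f(1) g(1) set_plus_rearrange tensor_rel_plus_self)
    show "(f (Suc n) + g (Suc n)) - (f n + g n) \<in> tensor_rel n" for n
      using tensor_rel_add[OF f(2) g(2)] by (simp add: algebra_simps)
  qed
qed

abbreviation frag_mult :: "'a \<Rightarrow> ('a \<times> 'l \<Rightarrow>\<^sub>0 int) \<Rightarrow> ('a \<times> 'l \<Rightarrow>\<^sub>0 int)"
  where "frag_mult a \<equiv> frag_extend (\<lambda>(b, x). frag_of (a * b, x))"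

lemma tensor_rel_mult:
  assumes "f \<in> tensor_rel n" shows "frag_mult a f \<in> tensor_rel n"
  using assms
proof (induction rule: tensor_rel_induct)
  case (power b c x)
  have "a * b - a * c \<in> ideal_power m n"
    using A.ideal_power_mult_left[OF power, of a] by (simp add: right_diff_distrib)
  then show ?case by (simp add: frag_extend_diff tensor_rel_generators)
qed (simp_all add: frag_extend_diff distrib_left A.mult_scale tensor_rel_zero tensor_rel_generators tensor_rel_diff)

lemma ct_smult_coset: "t n = f +o tensor_rel n \<Longrightarrow> ct_smult a t n = frag_mult a f +o tensor_rel n"
proof (intro equalityI subsetI)
  assume t: "t n = f +o tensor_rel n"
  fix h
  {
    assume "h \<in> ct_smult a t n"
    then obtain r r' where r: "r \<in> tensor_rel n" "r' \<in> tensor_rel n" "h = frag_mult a (f + r) + r'"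
      unfolding ct_smult_def t by (auto elim!: set_plus_elim simp: elt_set_plus_def)
    then have "h = frag_mult a f + (frag_mult a r + r')" by (simp add: frag_extend_add add.assoc)
    then show "h \<in> frag_mult a f +o tensor_rel n"
      using tensor_rel_add[OF tensor_rel_mult[OF r(1)] r(2)] by (metis set_plus_intro2)
  next
    assume "h \<in> frag_mult a f +o tensor_rel n"
    then obtain r where "r \<in> tensor_rel n" "h = frag_mult a f + r" by (auto simp: elt_set_plus_def)
    then show "h \<in> ct_smult a t n"
      unfolding ct_smult_def t using coset_self[of f n] by blast
  }
qed

lemma ct_smult_in:
  assumes "t \<in> ctensor" shows "ct_smult a t \<in> ctensor"
proof -
  obtain f where f: "\<And>n. t n = f n +o tensor_rel n" "\<And>n. f (Suc n) - f n \<in> tensor_rel n"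
    by (rule ctensor_representatives[OF assms]) blast
  show ?thesis
    by (rule ctensorI[of _ "\<lambda>n. frag_mult a (f n)"])
      (simp_all add: ct_smult_coset[of t, OF f(1)] tensor_rel_mult[OF f(2)] frag_extend_diff[symmetric])
qed

lemma ct_pure_in: "ct_pure a x \<in> ctensor"
  by (rule ctensorI[of _ "\<lambda>_. frag_of (a, x)"]) (simp_all add: ct_pure_def tensor_rel_zero)

text \<open>
  The map \<open>\<beta> \<otimes> id\<close> on representatives, in the form in which the augmentation is defined for \<open>\<beta> = eps\<close>.
\<close>

definition pairing :: "('a \<Rightarrow> 'k) \<Rightarrow> ('a \<times> 'l \<Rightarrow>\<^sub>0 int) \<Rightarrow> 'l"
  where "pairing \<beta> f = (\<Sum>(a, x)\<in>Poly_Mapping.keys f. scale (of_int (Poly_Mapping.lookup f (a, x)) * \<beta> a) x)"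

lemma pairing_superset:
  assumes "finite S" "Poly_Mapping.keys f \<subseteq> S"
  shows "pairing \<beta> f = (\<Sum>p\<in>S. scale (of_int (Poly_Mapping.lookup f p) * \<beta> (fst p)) (snd p))"
  unfolding pairing_def case_prod_unfold using assms
  by (intro sum.mono_neutral_cong_left) (auto simp: in_keys_iff)

lemma pairing_diff: "pairing \<beta> (f - g) = pairing \<beta> f - pairing \<beta> g"
proof -
  let ?S = "Poly_Mapping.keys f \<union> Poly_Mapping.keys g"
  have "Poly_Mapping.keys (f - g) \<subseteq> ?S" by (auto simp: in_keys_iff lookup_minus)
  then show ?thesis
    by (subst (1 2 3) pairing_superset[of ?S])
      (auto simp: lookup_minus left_diff_distrib scale_left_diff_distrib sum_subtractf)
qed

lemma pairing_zero: "pairing \<beta> 0 = 0"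
  by (simp add: pairing_def)

lemma pairing_add: "pairing \<beta> (f + g) = pairing \<beta> f + pairing \<beta> g"
  using pairing_diff[of \<beta> "f + g" g] by simp

lemma pairing_sum: "pairing \<beta> (\<Sum>i\<in>I. f i) = (\<Sum>i\<in>I. pairing \<beta> (f i))"
  by (induction I rule: infinite_finite_induct) (simp_all add: pairing_zero pairing_add)

lemma pairing_frag_of [simp]: "pairing \<beta> (frag_of (a, x)) = scale (\<beta> a) x"
  by (simp add: pairing_def)

lemma frag_induct [case_names zero frag_of diff]:
  assumes "P 0" "\<And>a x. P (frag_of (a, x))" "\<And>f g. P f \<Longrightarrow> P g \<Longrightarrow> P (f - g)"
  shows "P f"
  by (rule frag_induction[of f UNIV]) (use assms in auto)

lemma pairing_plus: "pairing (\<beta> + \<beta>') f = pairing \<beta> f + pairing \<beta>' f"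
  by (induction f rule: frag_induct) (simp_all add: pairing_zero pairing_diff scale_left_distrib)

lemma pairing_scale: "pairing (\<lambda>a. c * \<beta> a) f = scale c (pairing \<beta> f)"
  by (induction f rule: frag_induct) (simp_all add: pairing_zero pairing_diff scale_right_diff_distrib)

lemma pairing_mult: "pairing \<beta> (frag_mult a f) = pairing (\<lambda>b. \<beta> (a * b)) f"
  by (induction f rule: frag_induct) (simp_all add: pairing_zero pairing_diff frag_extend_diff)

lemma pairing_tensor_rel:
  assumes "f \<in> tensor_rel n" "\<beta> \<in> dual n" shows "pairing \<beta> f = 0"
  using assms(1)
proof (induction rule: tensor_rel_induct)
  case (power a b x)
  then show ?case
    using A.dual_vanish[OF assms(2) power] by (simp add: A.dual_diff[OF assms(2)] pairing_diff)
qed (simp_all add: pairing_zero pairing_diff A.dual_add[OF assms(2)] A.dual_scale[OF assms(2)]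
      scale_left_distrib scale_right_distrib mult.commute)

lemma tensor_rel_zero_right: "frag_of (a, 0) \<in> tensor_rel n"
  using tensor_rel_minus[OF tensor_rel_generators(2)[of a 0 0 n]] by simp

lemma tensor_rel_zero_left: "frag_of (0, x) \<in> tensor_rel n"
  using tensor_rel_minus[OF tensor_rel_generators(1)[of 0 0 x n]] by simp

lemma tensor_rel_sum_left: "frag_of (\<Sum>i\<in>I. a i, x) - (\<Sum>i\<in>I. frag_of (a i, x)) \<in> tensor_rel n"
proof (induction I rule: infinite_finite_induct)
  case (insert i I)
  have "frag_of (a i + (\<Sum>i\<in>I. a i), x) - frag_of (a i, x) - frag_of (\<Sum>i\<in>I. a i, x) \<in> tensor_rel n"
    by (rule tensor_rel_generators)
  from tensor_rel_add[OF this insert.IH] show ?case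
    using insert.hyps by (simp add: algebra_simps)
qed (simp_all add: tensor_rel_zero_left)

lemma tensor_rel_sum: "(\<And>i. i \<in> I \<Longrightarrow> f i \<in> tensor_rel n) \<Longrightarrow> (\<Sum>i\<in>I. f i) \<in> tensor_rel n"
  by (induction I rule: infinite_finite_induct) (simp_all add: tensor_rel_zero tensor_rel_add)

text \<open>
  The normal form of a tensor modulo \<open>m^n\<close> with respect to a frame.
\<close>

lemma frame_representative:
  assumes C: "A.is_frame n C \<gamma>"
  shows "f - (\<Sum>c\<in>C. frag_of (c, pairing (\<gamma> c) f)) \<in> tensor_rel n"
proof (induction f rule: frag_induct)
  case zero
  have "(\<Sum>c\<in>C. frag_of (c, 0)) \<in> tensor_rel n" by (intro tensor_rel_sum tensor_rel_zero_right)
  then show ?case using tensor_rel_minus by (auto simp: pairing_zero)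
next
  case (frag_of a x)
  let ?a = "\<Sum>c\<in>C. scaleA (\<gamma> c a) c"
  have 1: "frag_of (a, x) - frag_of (?a, x) \<in> tensor_rel n"
    using C by (intro tensor_rel_generators) (simp add: A.is_frame_def)
  have 2: "frag_of (?a, x) - (\<Sum>c\<in>C. frag_of (scaleA (\<gamma> c a) c, x)) \<in> tensor_rel n"
    by (rule tensor_rel_sum_left)
  have 3: "(\<Sum>c\<in>C. frag_of (scaleA (\<gamma> c a) c, x) - frag_of (c, scale (\<gamma> c a) x)) \<in> tensor_rel n"
    by (intro tensor_rel_sum tensor_rel_generators)
  from tensor_rel_add[OF tensor_rel_add[OF 1 2] 3] show ?case by (simp add: sum_subtractf)
next
  case (diff f g)
  have "(\<Sum>c\<in>C. frag_of (c, (pairing (\<gamma> c) f - pairing (\<gamma> c) g) + pairing (\<gamma> c) g)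
      - frag_of (c, pairing (\<gamma> c) f - pairing (\<gamma> c) g) - frag_of (c, pairing (\<gamma> c) g)) \<in> tensor_rel n"
    by (intro tensor_rel_sum tensor_rel_generators)
  from tensor_rel_add[OF tensor_rel_diff[OF diff] this] show ?case
    by (simp add: pairing_diff sum_subtractf sum.distrib algebra_simps)
qed

text \<open>The functionals in \<open>dual n\<close> separate the points of \<open>A/m^n \<otimes> L\<close>.\<close>

lemma tensor_rel_iff_pairing: "f \<in> tensor_rel n \<longleftrightarrow> (\<forall>\<beta>\<in>dual n. pairing \<beta> f = 0)"
proof
  assume *: "\<forall>\<beta>\<in>dual n. pairing \<beta> f = 0"
  obtain C \<gamma> where C: "A.is_frame n C \<gamma>" using A.frame_exists by blast
  have "frag_of (c, pairing (\<gamma> c) f) \<in> tensor_rel n" if "c \<in> C" for c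
    using * C that by (simp add: A.is_frame_def tensor_rel_zero_right)
  then have "(\<Sum>c\<in>C. frag_of (c, pairing (\<gamma> c) f)) \<in> tensor_rel n" by (rule tensor_rel_sum)
  from tensor_rel_add[OF frame_representative[OF C, of f] this] show "f \<in> tensor_rel n" by simp
qed (auto intro: pairing_tensor_rel)

text \<open>
  The comparison map \<open>t \<mapsto> (\<beta> \<mapsto> (\<beta> \<otimes> id) t)\<close>.  For \<open>\<beta>\<close> in \<open>dual n\<close> it can be computed from any
  representative of the component of \<open>t\<close> at level \<open>n\<close>, see \<open>to_hom_eval\<close>.
\<close>

definition to_hom :: "('a, 'l) cosets \<Rightarrow> ('a \<Rightarrow> 'k) \<Rightarrow> 'l"
  where "to_hom t = (\<lambda>\<beta>. if \<beta> \<in> continuous_dual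
    then pairing \<beta> (SOME f. f \<in> t (LEAST n. \<beta> \<in> dual n)) else 0)"

lemma to_hom_eval:
  assumes t: "t \<in> ctensor" and \<beta>: "\<beta> \<in> dual n" and f: "f \<in> t n"
  shows "to_hom t \<beta> = pairing \<beta> f"
proof -
  let ?n = "LEAST n. \<beta> \<in> dual n"
  have n: "\<beta> \<in> dual ?n" using \<beta> by (rule LeastI)
  have "?n \<le> n" using \<beta> by (rule Least_le)
  then have f': "f \<in> t ?n" using f ctensor_antimono[OF t] by blast
  define g where "g = (SOME f. f \<in> t ?n)"
  have g: "g \<in> t ?n" unfolding g_def using f' by (rule someI)
  have "f - g \<in> tensor_rel ?n"
    using f' ctensor_coset[OF t g] by (intro set_plus_imp_minus) simp
  then have "pairing \<beta> (f - g) = 0" using n by (rule pairing_tensor_rel)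
  then show ?thesis using A.continuous_dualI[OF \<beta>] by (simp add: to_hom_def g_def pairing_diff)
qed

lemma to_hom_outside: "\<beta> \<notin> continuous_dual \<Longrightarrow> to_hom t \<beta> = 0"
  by (simp add: to_hom_def)

lemma to_hom_in:
  assumes t: "t \<in> ctensor" shows "to_hom t \<in> dual_hom"
proof (rule dual_homI)
  fix n \<beta> \<beta>' c assume \<beta>: "\<beta> \<in> dual n"
  obtain f where f: "f \<in> t n" by (rule ctensor_nonempty[OF t])
  show "to_hom t (\<lambda>a. c * \<beta> a) = scale c (to_hom t \<beta>)"
    by (simp add: to_hom_eval[OF t _ f] \<beta> A.scale_in_dual pairing_scale)
  assume \<beta>': "\<beta>' \<in> dual n"
  show "to_hom t (\<beta> + \<beta>') = to_hom t \<beta> + to_hom t \<beta>'"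
    by (simp add: to_hom_eval[OF t _ f] \<beta> \<beta>' A.add_in_dual pairing_plus)
qed (rule to_hom_outside)

lemma to_hom_add:
  assumes s: "s \<in> ctensor" and t: "t \<in> ctensor"
  shows "to_hom (ct_add s t) = to_hom s + to_hom t"
proof (rule hom_eqI)
  fix n \<beta> assume \<beta>: "\<beta> \<in> dual n"
  obtain f where f: "f \<in> s n" by (rule ctensor_nonempty[OF s])
  obtain g where g: "g \<in> t n" by (rule ctensor_nonempty[OF t])
  have "f + g \<in> ct_add s t n" using f g by (auto simp: ct_add_def)
  then show "to_hom (ct_add s t) \<beta> = (to_hom s + to_hom t) \<beta>"
    by (simp add: to_hom_eval[OF s \<beta> f] to_hom_eval[OF t \<beta> g] to_hom_eval[OF ct_add_in[OF s t] \<beta>] pairing_add)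
qed (simp_all add: to_hom_in ct_add_in add_in_hom s t)

lemma to_hom_smult:
  assumes t: "t \<in> ctensor"
  shows "to_hom (ct_smult a t) = hom_smult a (to_hom t)"
proof (rule hom_eqI)
  fix n \<beta> assume \<beta>: "\<beta> \<in> dual n"
  obtain f where f: "f \<in> t n" by (rule ctensor_nonempty[OF t])
  have "frag_mult a f \<in> ct_smult a t n"
    unfolding ct_smult_coset[of t n f, OF ctensor_coset[OF t f]] by (rule coset_self)
  then show "to_hom (ct_smult a t) \<beta> = hom_smult a (to_hom t) \<beta>"
    using A.continuous_dualI[OF \<beta>] to_hom_eval[OF t A.shift_in_dual_same[OF \<beta>] f]
    by (simp add: hom_smult_def to_hom_eval[OF ct_smult_in[OF t] \<beta>] pairing_mult)
qed (simp_all add: to_hom_in ct_smult_in smult_in_hom t)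

lemma to_hom_pure: "to_hom (ct_pure 1 x) = hom_const x"
proof (rule hom_eqI)
  fix n \<beta> assume \<beta>: "\<beta> \<in> dual n"
  have "frag_of (1, x) \<in> ct_pure 1 x n" unfolding ct_pure_def by (rule coset_self)
  then show "to_hom (ct_pure 1 x) \<beta> = hom_const x \<beta>"
    using A.continuous_dualI[OF \<beta>] by (simp add: hom_const_def to_hom_eval[OF ct_pure_in \<beta>])
qed (simp_all add: to_hom_in ct_pure_in const_in_hom)

lemma to_hom_zero: "to_hom ct_zero = 0"
proof (rule hom_eqI)
  fix n \<beta> assume \<beta>: "\<beta> \<in> dual n"
  have "0 \<in> ct_zero n" unfolding ct_zero_def by (rule tensor_rel_zero)
  then show "to_hom ct_zero \<beta> = 0 \<beta>"
    by (simp add: to_hom_eval[OF ct_zero_in \<beta>] pairing_zero)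
qed (simp_all add: to_hom_in ct_zero_in zero_in_hom)

lemma ct_eps_eq:
  assumes t: "t \<in> ctensor" shows "ct_eps t = to_hom t eps"
proof -
  obtain f where f: "f \<in> t 1" by (rule ctensor_nonempty[OF t])
  have "pairing eps g = to_hom t eps" if "g \<in> t 1" for g
    by (rule to_hom_eval[OF t A.eps_in_dual that, symmetric])
  then have "pairing eps ` t 1 = {to_hom t eps}"
    using f by (auto simp: image_iff)
  then show ?thesis by (simp add: ct_eps_def pairing_def[abs_def])
qed

lemma to_hom_bij: "bij_betw to_hom ctensor dual_hom"
  unfolding bij_betw_def
proof (intro conjI equalityI subsetI)
  show "inj_on to_hom ctensor"
  proof (rule inj_onI)
    fix s t assume s: "s \<in> ctensor" and t: "t \<in> ctensor" and eq: "to_hom s = to_hom t"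
    show "s = t"
    proof
      fix n
      obtain f where f: "f \<in> s n" by (rule ctensor_nonempty[OF s])
      obtain g where g: "g \<in> t n" by (rule ctensor_nonempty[OF t])
      have "f - g \<in> tensor_rel n"
        unfolding tensor_rel_iff_pairing
        using to_hom_eval[OF s _ f] to_hom_eval[OF t _ g] eq by (simp add: pairing_diff)
      then show "s n = t n"
        by (simp add: ctensor_coset[OF s f] ctensor_coset[OF t g] coset_eq_iff)
    qed
  qed
  show "s \<in> dual_hom" if "s \<in> to_hom ` ctensor" for s
    using that to_hom_in by blast
  fix s assume s: "s \<in> dual_hom"
  obtain C \<gamma> where C: "\<And>n. A.is_frame n (C n) (\<gamma> n)" using A.frame_exists by metis
  define f where "f n = (\<Sum>c\<in>C n. frag_of (c, s (\<gamma> n c)))" for n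
  have pf: "pairing \<beta> (f n) = s \<beta>" if "\<beta> \<in> dual n" for n \<beta>
    by (simp add: f_def pairing_sum frame_eval[OF C s that])
  define t where "t n = f n +o tensor_rel n" for n
  have t: "t \<in> ctensor"
  proof (rule ctensorI)
    show "f (Suc n) - f n \<in> tensor_rel n" for n
      unfolding tensor_rel_iff_pairing
      using A.dual_mono[of n "Suc n"] by (auto simp: pairing_diff pf)
  qed (rule t_def)
  have "s = to_hom t"
  proof (rule hom_eqI[OF s to_hom_in[OF t]])
    fix n \<beta> assume \<beta>: "\<beta> \<in> dual n"
    have "f n \<in> t n" unfolding t_def by (rule coset_self)
    then show "s \<beta> = to_hom t \<beta>" by (simp add: to_hom_eval[OF t \<beta>] pf[OF \<beta>])
  qed
  then show "s \<in> to_hom ` ctensor" using t by blast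
qed

end

section \<open>Formal rigidity\<close>

context deformation_base
begin

text \<open>The inverse of the comparison map.\<close>

definition of_hom :: "(('a \<Rightarrow> 'k) \<Rightarrow> 'l) \<Rightarrow> ('a, 'l) cosets"
  where "of_hom = inv_into ctensor to_hom"

lemma of_hom_in: "s \<in> dual_hom \<Longrightarrow> of_hom s \<in> ctensor"
  unfolding of_hom_def using to_hom_bij by (metis bij_betw_def inv_into_into)

lemma to_hom_of_hom: "s \<in> dual_hom \<Longrightarrow> to_hom (of_hom s) = s"
  unfolding of_hom_def using to_hom_bij by (metis bij_betw_inv_into_right)

lemma of_hom_to_hom: "t \<in> ctensor \<Longrightarrow> of_hom (to_hom t) = t"
  unfolding of_hom_def using to_hom_bij by (metis bij_betw_inv_into_left)

lemma of_hom_bij: "bij_betw of_hom dual_hom ctensor"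
  unfolding of_hom_def using to_hom_bij by (rule bij_betw_inv_into)

lemma of_hom_eqI: "t \<in> ctensor \<Longrightarrow> to_hom t = s \<Longrightarrow> of_hom s = t"
  using of_hom_to_hom by auto

lemma of_hom_add:
  "s \<in> dual_hom \<Longrightarrow> t \<in> dual_hom \<Longrightarrow> of_hom (s + t) = ct_add (of_hom s) (of_hom t)"
  by (rule of_hom_eqI) (simp_all add: ct_add_in of_hom_in to_hom_add to_hom_of_hom)

lemma of_hom_smult: "s \<in> dual_hom \<Longrightarrow> of_hom (hom_smult a s) = ct_smult a (of_hom s)"
  by (rule of_hom_eqI) (simp_all add: ct_smult_in of_hom_in to_hom_smult to_hom_of_hom)

lemma of_hom_zero: "of_hom 0 = ct_zero"
  by (rule of_hom_eqI) (simp_all add: ct_zero_in to_hom_zero)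

lemma A_linear_to_hom:
  assumes "A_linear F" shows "hom_linear (\<lambda>s. to_hom (F (of_hom s)))"
  using assms unfolding A_linear_def hom_linear_def
  by (simp add: Pi_iff of_hom_in to_hom_in of_hom_add of_hom_smult to_hom_add to_hom_smult)

lemma hom_linear_of_hom:
  assumes "hom_linear G" shows "A_linear (\<lambda>t. of_hom (G (to_hom t)))"
  using assms unfolding A_linear_def hom_linear_def
  by (simp add: Pi_iff of_hom_in to_hom_in of_hom_add of_hom_smult to_hom_add to_hom_smult)

lemma model_of_deformation:
  assumes "formal_deformation D"
  shows "model_deformation (\<lambda>s t. to_hom (D (of_hom s) (of_hom t)))"
proof -
  have lie: "A_lie_bracket D"
    and eps: "\<And>s t. s \<in> ctensor \<Longrightarrow> t \<in> ctensor \<Longrightarrow> ct_eps (D s t) = bracket (ct_eps s) (ct_eps t)"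
    using assms by (auto simp: formal_deformation_def)
  have linr: "A_linear (\<lambda>t. D s t)" and linl: "A_linear (\<lambda>t. D t s)" if "s \<in> ctensor" for s
    using lie that by (auto simp: A_lie_bracket_def)
  have Din: "D s t \<in> ctensor" if "s \<in> ctensor" "t \<in> ctensor" for s t
    using linr[OF that(1)] that(2) by (auto simp: A_linear_def)
  show ?thesis
    unfolding model_deformation_def
  proof (intro conjI ballI)
    fix s assume s: "s \<in> dual_hom"
    show "hom_linear (\<lambda>t. to_hom (D (of_hom s) (of_hom t)))"
      by (rule A_linear_to_hom[OF linr[OF of_hom_in[OF s]]])
    show "hom_linear (\<lambda>t. to_hom (D (of_hom t) (of_hom s)))"
      by (rule A_linear_to_hom[OF linl[OF of_hom_in[OF s]]])
    show "to_hom (D (of_hom s) (of_hom s)) = 0"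
      using lie of_hom_in[OF s] by (simp add: A_lie_bracket_def to_hom_zero)
    fix t assume t: "t \<in> dual_hom"
    have "to_hom (D (of_hom s) (of_hom t)) eps = model_bracket s t eps"
      using s t by (simp add: model_bracket_eps ct_eps_eq[symmetric] Din of_hom_in eps)
        (simp add: ct_eps_eq of_hom_in to_hom_of_hom)
    then show "to_hom (D (of_hom s) (of_hom t)) - model_bracket s t \<in> filtration 1"
      using s t by (subst filtration_1_iff) (simp_all add: diff_in_hom to_hom_in Din of_hom_in model_bracket_in_hom)
    fix u assume u: "u \<in> dual_hom"
    define s' t' u' where "s' = of_hom s" and "t' = of_hom t" and "u' = of_hom u"
    have c: "s' \<in> ctensor" "t' \<in> ctensor" "u' \<in> ctensor"
      by (simp_all add: s'_def t'_def u'_def of_hom_in s t u)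
    have "ct_add (D s' (D t' u')) (ct_add (D t' (D u' s')) (D u' (D s' t'))) = ct_zero"
      using lie c by (simp add: A_lie_bracket_def)
    then have "to_hom (ct_add (D s' (D t' u')) (ct_add (D t' (D u' s')) (D u' (D s' t')))) = 0"
      by (simp add: to_hom_zero)
    then have "to_hom (D s' (D t' u')) + to_hom (D t' (D u' s')) + to_hom (D u' (D s' t')) = 0"
      using c by (simp add: to_hom_add ct_add_in Din add.assoc)
    then show "to_hom (D (of_hom s) (of_hom (to_hom (D (of_hom t) (of_hom u))))) +
       to_hom (D (of_hom t) (of_hom (to_hom (D (of_hom u) (of_hom s))))) +
       to_hom (D (of_hom u) (of_hom (to_hom (D (of_hom s) (of_hom t))))) = 0"
      using c by (simp add: s'_def[symmetric] t'_def[symmetric] u'_def[symmetric] of_hom_to_hom Din)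
  qed
qed

text \<open>The trivial deformation, transported from the model.\<close>

definition standard_bracket ::
  "('a, 'l) cosets \<Rightarrow> ('a, 'l) cosets \<Rightarrow> ('a, 'l) cosets"
  where "standard_bracket s t = of_hom (model_bracket (to_hom s) (to_hom t))"

lemma trivial_deformation_standard_bracket: "trivial_deformation standard_bracket"
  unfolding trivial_deformation_def formal_deformation_def A_lie_bracket_def
proof (intro conjI ballI allI)
  fix s assume s: "s \<in> ctensor"
  show "A_linear (\<lambda>t. standard_bracket s t)"
    unfolding standard_bracket_def
    by (rule hom_linear_of_hom[OF model_bracket_linear_right[OF to_hom_in[OF s]]])
  show "A_linear (\<lambda>t. standard_bracket t s)"
    unfolding standard_bracket_def
    by (rule hom_linear_of_hom[OF model_bracket_linear_left[OF to_hom_in[OF s]]])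
  show "standard_bracket s s = ct_zero"
    by (simp add: standard_bracket_def model_bracket_self to_hom_in s of_hom_zero)
  fix t assume t: "t \<in> ctensor"
  show "ct_eps (standard_bracket s t) = bracket (ct_eps s) (ct_eps t)"
    by (simp add: standard_bracket_def ct_eps_eq of_hom_in to_hom_of_hom model_bracket_in_hom to_hom_in s t
        model_bracket_eps)
  fix u assume u: "u \<in> ctensor"
  define s' t' u' where "s' = to_hom s" and "t' = to_hom t" and "u' = to_hom u"
  have h: "s' \<in> dual_hom" "t' \<in> dual_hom" "u' \<in> dual_hom"
    by (simp_all add: s'_def t'_def u'_def to_hom_in s t u)
  have "ct_add (standard_bracket s (standard_bracket t u))
      (ct_add (standard_bracket t (standard_bracket u s)) (standard_bracket u (standard_bracket s t)))
    = of_hom (model_bracket s' (model_bracket t' u') + (model_bracket t' (model_bracket u' s')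
      + model_bracket u' (model_bracket s' t')))"
    using h by (simp add: standard_bracket_def s'_def[symmetric] t'_def[symmetric] u'_def[symmetric]
        to_hom_of_hom model_bracket_in_hom of_hom_add add_in_hom)
  also have "\<dots> = ct_zero"
    using model_bracket_jacobi[OF h] by (simp add: add.assoc of_hom_zero)
  finally show "ct_add (standard_bracket s (standard_bracket t u))
      (ct_add (standard_bracket t (standard_bracket u s)) (standard_bracket u (standard_bracket s t))) = ct_zero" .
next
  fix x y
  show "standard_bracket (ct_pure 1 x) (ct_pure 1 y) = ct_pure 1 (bracket x y)"
    unfolding standard_bracket_def to_hom_pure model_bracket_const
    by (rule of_hom_eqI[OF ct_pure_in to_hom_pure])
qed

lemma equivalent_to_standard_bracket:
  assumes "Z2 \<subseteq> B2" and D: "formal_deformation D"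
  shows "equivalent_deformations D standard_bracket"
proof -
  have Din: "D s t \<in> ctensor" if "s \<in> ctensor" "t \<in> ctensor" for s t
    using D that by (auto simp: formal_deformation_def A_lie_bracket_def A_linear_def)
  obtain \<Phi> where lin: "hom_linear \<Phi>" and bij: "bij_betw \<Phi> dual_hom dual_hom"
    and one: "\<And>s. s \<in> dual_hom \<Longrightarrow> \<Phi> s - s \<in> filtration 1"
    and hom: "\<And>s t. s \<in> dual_hom \<Longrightarrow> t \<in> dual_hom \<Longrightarrow>
      \<Phi> (to_hom (D (of_hom s) (of_hom t))) = model_bracket (\<Phi> s) (\<Phi> t)"
    by (rule model_rigidity[OF assms(1) model_of_deformation[OF D]]) blast
  note \<Phi>in = hom_linear_in[OF lin]
  let ?\<Psi> = "\<lambda>t. of_hom (\<Phi> (to_hom t))"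
  show ?thesis
    unfolding equivalent_deformations_def
  proof (intro exI[of _ ?\<Psi>] conjI ballI)
    show "A_linear ?\<Psi>" by (rule hom_linear_of_hom[OF lin])
    show "bij_betw ?\<Psi> ctensor ctensor"
      using bij_betw_trans[OF bij_betw_trans[OF to_hom_bij bij] of_hom_bij] by (simp add: o_def)
    fix s assume s: "s \<in> ctensor"
    have "\<Phi> (to_hom s) eps = to_hom s eps"
      using filtration_eval[OF one[OF to_hom_in[OF s]] A.eps_in_dual] by simp
    then show "ct_eps (?\<Psi> s) = ct_eps s"
      by (simp add: ct_eps_eq of_hom_in to_hom_of_hom \<Phi>in to_hom_in s)
    fix t assume t: "t \<in> ctensor"
    show "?\<Psi> (D s t) = standard_bracket (?\<Psi> s) (?\<Psi> t)"
      using hom[OF to_hom_in[OF s] to_hom_in[OF t]]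
      by (simp add: standard_bracket_def of_hom_to_hom to_hom_of_hom \<Phi>in to_hom_in s t)
  qed
qed

end

theorem (in lie_algebra) formally_rigid_if_H2_vanishes:
  assumes H2_vanishes
  shows "formally_rigid TYPE('a::comm_ring_1)"
  unfolding formally_rigid_def
proof (intro allI impI)
  fix scaleA :: "'k \<Rightarrow> 'a \<Rightarrow> 'a" and m eps D
  assume A: "complete_local_algebra scaleA m eps"
    and D: "deformation_base.formal_deformation scaleA m eps scale bracket D"
  interpret deformation_base scaleA m eps scale bracket
    using A lie_algebra_axioms by (rule deformation_base.intro)
  show "\<exists>D\<^sub>0. trivial_deformation D\<^sub>0 \<and> equivalent_deformations D D\<^sub>0"
    using trivial_deformation_standard_bracket equivalent_to_standard_bracket[OF _ D] assms
    unfolding H2_vanishes_iff by blast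
qed

theorem corollary3p6:
  shows "(witt.H2_vanishes \<and> witt.formally_rigid TYPE('a::comm_ring_1)) \<and>
         (virasoro.H2_vanishes \<and> virasoro.formally_rigid TYPE('a))"
  by (intro conjI witt_H2_vanishes virasoro_H2_vanishes
      witt.formally_rigid_if_H2_vanishes virasoro.formally_rigid_if_H2_vanishes)

end
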